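(* Let $\theta>\frac13\left(\frac34\right)^{3/4}$ be fixed. For all sufficiently small $\varepsilon>0$, all eigenvalues of the problem $$-i\varepsilon y''=(x-\lambda)y,\qquad x\in(-1,1),\qquad y(-1)=y(1)=0,$$ lying in the domain $D_\varepsilon$ are simple and form a monotone sequence of numbers on the negative imaginary axis. Moreover, the interval $\left(d_\varepsilon,-i(\rho_{k_0}+O(\varepsilon))\right)$ of the imaginary axis can contain at most two eigenvalues, and all the other eigenvalues $\lambda_k$ of the problem in $D_\varepsilon$ have the form $$\lambda_k=-i\left(\rho_k+\rho_k^{-1}O(\varepsilon)\right),\qquad k=k_0+1,\,k_0+2,\,\ldots,$$ where the constant in $O(\varepsilon)$ does not depend on $k$.
   Context: $\lambda\in\mathbb C$ is the spectral parameter; an eigenvalue is a $\lambda$ for which there is a nontrivial solution $y$. $\ln\varepsilon^{-\theta}=\theta\ln(1/\varepsilon)$. Put $d_\varepsilon=-i\left(\frac{1}{\sqrt3}+\varepsilon^{1/2}\ln\varepsilon^{-\theta}\right)$. $D_\varepsilon$ is the domain bounded on the left and right by the lines $\operatorname{Re}\lambda=\pm1$ and from above by the two straight lines passing through $1$ and $d_\varepsilon$, respectively through $-1$ and $d_\varepsilon$ (so $D_\varepsilon$ lies below both lines): $$D_\varepsilon=\left\{\lambda:\ |\operatorname{Re}\lambda|<1,\ \operatorname{Im}\lambda<-\left(\tfrac{1}{\sqrt3}+\varepsilon^{1/2}\ln\varepsilon^{-\theta}\right)(1+|\operatorname{Re}\lambda|)\right\}.$$ For $\operatorname{Im}\lambda<0$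 let $f(\lambda)=\int_{-1}^{1}e^{-i\pi/4}\sqrt{x-\lambda}\,dx$, with the branch of the root such that $f(-i/\sqrt3)>0$ (the principal branch). On the negative imaginary axis inside $D_\varepsilon$ the function $f$ is real and increases monotonically as $\lambda\to-i\infty$, and $f$ takes no real values in $D_\varepsilon$ off the imaginary axis. $k_0=k_0(\varepsilon)$ is the smallest natural number such that for all integers $k\ge k_0$ the equation $f(\lambda)=\pi k\varepsilon^{1/2}$ has in $D_\varepsilon$ exactly one purely imaginary solution; this solution is denoted $-i\rho_k$, so that $id_\varepsilon<\rho_{k_0}<\rho_{k_0+1}<\dots$. *)

theory Defs
  imports "HOL-Analysis.Analysis"
begin

(* Classical solutions of - i eps y'' = (x - mu) y - g on (-1,1), y(-1) = y(1) = 0. With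
   L y = i eps y'' + x y under Dirichlet conditions this says (L - mu) y = g, so g = 0 is the
   eigenvalue problem and g = (eigenfunction) is the equation for an associated function. *)
definition bvp_solution ::
    "real \<Rightarrow> complex \<Rightarrow> (real \<Rightarrow> complex) \<Rightarrow> (real \<Rightarrow> complex) \<Rightarrow> bool" where
  "bvp_solution \<epsilon> \<mu> g y \<longleftrightarrow>
     continuous_on {-1..1} y \<and> y (-1) = 0 \<and> y 1 = 0 \<and>
     (\<exists>y' y''. \<forall>x\<in>{-1<..<1}.
        (y has_vector_derivative y' x) (at x) \<and>
        (y' has_vector_derivative y'' x) (at x) \<and>
        - \<i> * complex_of_real \<epsilon> * y'' x = (complex_of_real x - \<mu>) * y x - g x)"

definition eigenfunction :: "real \<Rightarrow> complex \<Rightarrow> (real \<Rightarrow> complex) \<Rightarrow> bool" where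
  "eigenfunction \<epsilon> \<mu> y \<longleftrightarrow> bvp_solution \<epsilon> \<mu> (\<lambda>x. 0) y \<and> (\<exists>x\<in>{-1..1}. y x \<noteq> 0)"

definition eigenvalue :: "real \<Rightarrow> complex \<Rightarrow> bool" where
  "eigenvalue \<epsilon> \<mu> \<longleftrightarrow> (\<exists>y. eigenfunction \<epsilon> \<mu> y)"

(* Algebraic multiplicity one: the eigenfunction is unique up to a factor and has no associated
   function. Functions matter only on [-1,1]. *)
definition simple_eigenvalue :: "real \<Rightarrow> complex \<Rightarrow> bool" where
  "simple_eigenvalue \<epsilon> \<mu> \<longleftrightarrow>
     eigenvalue \<epsilon> \<mu> \<and>
     (\<forall>y z. eigenfunction \<epsilon> \<mu> y \<and> eigenfunction \<epsilon> \<mu> z \<longrightarrow>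
        (\<exists>c. \<forall>x\<in>{-1..1}. z x = c * y x)) \<and>
     \<not> (\<exists>y z. eigenfunction \<epsilon> \<mu> y \<and> bvp_solution \<epsilon> \<mu> y z)"

definition depth :: "real \<Rightarrow> real \<Rightarrow> real" where
  "depth \<theta> \<epsilon> = 1 / sqrt 3 + sqrt \<epsilon> * ln (\<epsilon> powr (-\<theta>))"

definition d_pt :: "real \<Rightarrow> real \<Rightarrow> complex" where
  "d_pt \<theta> \<epsilon> = - \<i> * complex_of_real (depth \<theta> \<epsilon>)"

definition D_dom :: "real \<Rightarrow> real \<Rightarrow> complex set" where
  "D_dom \<theta> \<epsilon> = {\<mu>. \<bar>Re \<mu>\<bar> < 1 \<and> Im \<mu> < - depth \<theta> \<epsilon> * (1 + \<bar>Re \<mu>\<bar>)}"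

(* Only used for Im mu < 0, where x - mu lies in the open upper half-plane, off the branch cut
   of csqrt. *)
definition f_int :: "complex \<Rightarrow> complex" where
  "f_int \<mu> = integral {-1..1}
     (\<lambda>x. exp (- \<i> * complex_of_real pi / 4) * csqrt (complex_of_real x - \<mu>))"

definition k0 :: "real \<Rightarrow> real \<Rightarrow> nat" where
  "k0 \<theta> \<epsilon> = (LEAST m. \<forall>k\<ge>m. \<exists>!\<mu>. \<mu> \<in> D_dom \<theta> \<epsilon> \<and> Re \<mu> = 0 \<and>
                    f_int \<mu> = complex_of_real (pi * real k * sqrt \<epsilon>))"

definition rho :: "real \<Rightarrow> real \<Rightarrow> nat \<Rightarrow> real" where
  "rho \<theta> \<epsilon> k = (THE r. - \<i> * complex_of_real r \<in> D_dom \<theta> \<epsilon> \<and>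
                    f_int (- \<i> * complex_of_real r) = complex_of_real (pi * real k * sqrt \<epsilon>))"

end

theory Submission
  imports Defs "HOL-Probability.Distributions" "HOL-Real_Asymp.Real_Asymp"
begin

text \<open>
  In the variable \<open>s = \<i> (\<mu> - x)\<close> the equation becomes \<open>\<epsilon> u'' = s u\<close>, so \<open>\<mu>\<close> is an eigenvalue iff a
  quotient \<open>h = V / U\<close> of two Airy solutions takes equal values at \<open>\<sigma> + \<i>\<close> and \<open>\<sigma> - \<i>\<close>, where \<open>\<sigma> = \<i> \<mu>\<close>.
  The domain \<open>D_dom\<close> keeps both points strictly inside the sector \<open>\<bar>Arg s\<bar> < \<pi>/3\<close>, where the recessive
  solution \<open>U\<close> and a real dominant solution \<open>V\<close> have no zeros. There
  \<open>log h = 4/3 s powr (3/2) / sqrt \<epsilon> + L\<close> with a small holomorphic \<open>L\<close>, so eigenvalues are the solutions of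
  \<open>Q \<sigma> = \<pi> n\<close> with \<open>2 \<i> Q \<sigma> = log h (\<sigma> + \<i>) - log h (\<sigma> - \<i>)\<close>, and \<open>Q\<close> is \<open>f / sqrt \<epsilon>\<close> up to a small error.
  The real part of \<open>Q'\<close> is positive: along vertical lines this excludes non-real \<open>\<sigma>\<close>, along the real axis
  it makes \<open>Q\<close> strictly increasing, and it makes every eigenvalue simple because an associated function
  would force \<open>Q' \<sigma> = 0\<close>. The threshold for \<open>\<theta>\<close> is what makes the Stokes term \<open>exp (- 4/3 Re (s powr (3/2)) / sqrt \<epsilon>)\<close>
  at the tip of the domain at most \<open>sqrt \<epsilon>\<close>.
\<close>

section \<open>Gaussian integrals with a cubic phase\<close>

text \<open>The threshold for \<theta> comes from the tip of the domain. There \<sigma> + i has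
  horizontal distance m = \<theta> sqrt \<epsilon> ln (1/\<epsilon>) from the ray Arg s = pi/3, and
  4/3 Re s^(3/2) is at least 2 (3/4)^(1/4) m, so the Stokes term is at most \<epsilon>^(2
  (3/4)^(1/4) \<theta>). This is at most sqrt \<epsilon> once \<theta> reaches (1/3) (3/4)^(3/4). An
  error sqrt \<epsilon> in Q moves a level by O(\<epsilon>), because the slope of Q is of order 1 /
  sqrt \<epsilon>.

  The obstacle is that near the tip both endpoints approach the rays on which U and V have
  comparable size, so the asymptotics must be uniform up to these rays. For each sign of the
  argument only one of the two rotated Airy integrals has such uniform asymptotics; the other
  differs from it by a constant multiple of U.

  The number two arises because Q and f / sqrt \<epsilon> differ by less than pi: of the levels
  whose leading-order position is not inside the domain only the one with index k0 - 1 can be pushed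
  in, and level k0 is added to it because the interval ends just beyond its position.\<close>

lemma integrable_abs_moment:
  fixes c :: real assumes "c > 0"
  shows "integrable lborel (\<lambda>t. \<bar>t\<bar>^k * exp (- c * t\<^sup>2))"
proof -
  have std: "integrable lborel (\<lambda>x::real. exp (- x\<^sup>2) * \<bar>x\<bar>^k)"
  proof (cases "even k")
    case True
    then obtain m where m: "k = 2 * m" by (elim evenE)
    have "has_bochner_integral lborel (\<lambda>x::real. exp (-x\<^sup>2)*x^(2 * m))
        (2 *\<^sub>R ((sqrt pi / 2) * (fact (2 * m) / (2 ^ (2 * m) * fact m))))"
      by (rule has_bochner_integral_even_function[OF gaussian_moment_even_pos]) simp
    then have "integrable lborel (\<lambda>x::real. exp (-x\<^sup>2)*x^(2 * m))"
      by (simp only: has_bochner_integral_iff)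
    moreover have "\<bar>x\<bar>^k = x^(2 * m)" for x :: real
      using m by (simp add: power_even_abs)
    ultimately show ?thesis by (simp only:)
  next
    case False
    then obtain m where m: "k = 2 * m + 1" by (elim oddE)
    have "has_bochner_integral lborel (\<lambda>x::real. indicator {0..} x *\<^sub>R (exp (-x\<^sup>2)*\<bar>x\<bar>^(2 * m + 1))) (fact m / 2)"
      by (rule has_bochner_integral_cong[THEN iffD1, OF _ _ _ gaussian_moment_odd_pos[of m]])
        (auto split: split_indicator)
    from has_bochner_integral_even_function[OF this]
    show ?thesis using m by (simp add: has_bochner_integral_iff)
  qed
  have "integrable lborel (\<lambda>x. exp (- (0 + sqrt c * x)\<^sup>2) * \<bar>0 + sqrt c * x\<bar>^k)"
    by (rule lborel_integrable_real_affine[OF std]) (use assms in auto)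
  then have "integrable lborel (\<lambda>x. exp (- (0 + sqrt c * x)\<^sup>2) * \<bar>0 + sqrt c * x\<bar>^k / (sqrt c)^k)"
    by simp
  moreover have "exp (- (0 + sqrt c * x)\<^sup>2) * \<bar>0 + sqrt c * x\<bar>^k / (sqrt c)^k = \<bar>x\<bar>^k * exp (- c * x\<^sup>2)" for x
    using assms by (simp add: power_mult_distrib abs_mult field_simps)
  ultimately show ?thesis by simp
qed

definition abs_moment :: "nat \<Rightarrow> real" where
  "abs_moment k = (\<integral>t. \<bar>t\<bar>^k * exp (- t\<^sup>2) \<partial>lborel)"

lemma abs_moment_nonneg: "abs_moment k \<ge> 0"
  unfolding abs_moment_def by (rule integral_nonneg_AE) simp

lemma integral_abs_moment:
  fixes c :: real assumes "c > 0"
  shows "(\<integral>t. \<bar>t\<bar>^k * exp (- c * t\<^sup>2) \<partial>lborel) = abs_moment k / sqrt c ^ (k+1)"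
proof -
  have "(\<integral>t. \<bar>t\<bar>^k * exp (- c * t\<^sup>2) \<partial>lborel) =
     \<bar>1 / sqrt c\<bar> *\<^sub>R (\<integral>t. \<bar>0 + 1 / sqrt c * t\<bar>^k * exp (- c * (0 + 1 / sqrt c * t)\<^sup>2) \<partial>lborel)"
    by (rule lborel_integral_real_affine) (use assms in auto)
  also have "(\<lambda>t. \<bar>0 + 1 / sqrt c * t\<bar>^k * exp (- c * (0 + 1 / sqrt c * t)\<^sup>2))
      = (\<lambda>t. (1 / sqrt c ^ k) * (\<bar>t\<bar>^k * exp (- t\<^sup>2)))"
    using assms by (auto simp: power_divide abs_mult abs_divide)
  finally show ?thesis using assms by (simp add: abs_moment_def)
qed

text \<open>The parameter \<open>b\<close> joins the pure Gaussian \<open>b = 0\<close>, known in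
  closed form, to the Airy phase \<open>b = 1/3\<close>. The variable \<open>r\<close> stands for
  the square root of the Airy argument.\<close>

definition gauss_int :: "real \<Rightarrow> nat \<Rightarrow> complex \<Rightarrow> complex" where
  "gauss_int b k r =
     (\<integral>t. complex_of_real (t^k) * exp (- r * complex_of_real (t\<^sup>2) + \<i> * complex_of_real (b * t^3)) \<partial>lborel)"

lemma norm_gauss_integrand:
  "norm (complex_of_real (t^k) * exp (- r * complex_of_real (t\<^sup>2) + \<i> * complex_of_real (b * t^3)))
   = \<bar>t\<bar>^k * exp (- Re r * t\<^sup>2)"
  by (simp add: norm_mult norm_power power_abs)

lemma gauss_integrand_measurable [measurable]:
  "(\<lambda>t. complex_of_real (t^k) * exp (- r * complex_of_real (t\<^sup>2) + \<i> * complex_of_real (b * t^3)))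
     \<in> borel_measurable borel"
  by (intro borel_measurable_continuous_onI continuous_intros)

lemma integrable_gauss_integrand:
  assumes "Re r > 0"
  shows "integrable lborel (\<lambda>t. complex_of_real (t^k) * exp (- r * complex_of_real (t\<^sup>2) + \<i> * complex_of_real (b * t^3)))"
  by (rule Bochner_Integration.integrable_bound[OF integrable_abs_moment[OF assms, of k]])
    (use norm_gauss_integrand in \<open>auto simp: norm_mult norm_power power_abs\<close>)

lemma norm_gauss_int_le:
  assumes "Re r > 0"
  shows "norm (gauss_int b k r) \<le> abs_moment k / sqrt (Re r) ^ (k+1)"
proof -
  have "norm (gauss_int b k r) \<le> (\<integral>t. \<bar>t\<bar>^k * exp (- Re r * t\<^sup>2) \<partial>lborel)"
    unfolding gauss_int_def
    by (rule Bochner_Integration.integral_norm_bound_integral)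
      (use integrable_gauss_integrand[OF assms] integrable_abs_moment[OF assms] in
        \<open>auto simp only: norm_gauss_integrand order.refl\<close>)
  then show ?thesis using integral_abs_moment[OF assms] by simp
qed

lemma norm_exp_minus_one_minus_le:
  fixes z :: complex
  shows "norm (exp z - 1 - z) \<le> (norm z)\<^sup>2 * exp \<bar>Re z\<bar>"
  using Taylor_exp[of z 1] by (simp add: numeral_2_eq_2 algebra_simps)

text \<open>Reduces differentiation under the integral sign to one pointwise second-order estimate
  of the integrand.\<close>

lemma has_field_derivative_quadratic_remainder:
  fixes f :: "complex \<Rightarrow> complex"
  assumes "\<delta> > 0" "\<And>h. norm h < \<delta> \<Longrightarrow> norm (f (x + h) - f x - h * D) \<le> M * (norm h)\<^sup>2"
  shows "(f has_field_derivative D) (at x)"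
  unfolding DERIV_def
proof (rule LIM_zero_cancel, rule Lim_null_comparison)
  show "((\<lambda>h. M * norm h) \<longlongrightarrow> 0) (at (0::complex))"
    by (rule tendsto_eq_intros refl | simp)+
  have "\<forall>\<^sub>F h in at (0::complex). norm h < \<delta> \<and> h \<noteq> 0"
    using assms(1) by (auto simp: eventually_at dist_norm)
  then show "\<forall>\<^sub>F h in at 0. norm ((f (x + h) - f x) / h - D) \<le> M * norm h"
  proof eventually_elim
    case (elim h)
    then have "norm ((f (x + h) - f x) / h - D) = norm (f (x + h) - f x - h * D) / norm h"
      by (simp add: norm_divide[symmetric] diff_divide_distrib)
    also have "\<dots> \<le> M * (norm h)\<^sup>2 / norm h"
      using assms(2) elim by (intro divide_right_mono) auto
    finally show ?case using elim by (simp add: power2_eq_square)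
  qed
qed

text \<open>Each derivative in \<open>r\<close> brings down a factor \<open>- t\<^sup>2\<close>. For
  increments below \<open>Re r / 2\<close> the remainder consumes at most half of the Gaussian, and
  the other half still makes the additional fourth power of t integrable.\<close>

lemma has_field_derivative_gauss_int:
  assumes r: "Re r > 0"
  shows "(gauss_int b k has_field_derivative - gauss_int b (k+2) r) (at r)"
proof (rule has_field_derivative_quadratic_remainder[where \<delta> = "Re r / 2"
      and M = "\<integral>t. \<bar>t\<bar>^(k+4) * exp (- (Re r / 2) * t\<^sup>2) \<partial>lborel"])
  show "Re r / 2 > 0" using r by simp
  fix h :: complex assume h: "norm h < Re r / 2"
  have rh: "Re (r + h) > 0" using h r abs_Re_le_cmod[of h] by simp
  let ?E = "\<lambda>k r t. complex_of_real (t^k) * exp (- r * complex_of_real (t\<^sup>2) + \<i> * complex_of_real (b * t^3))"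
  have int: "integrable lborel (?E k (r+h))" "integrable lborel (?E k r)" "integrable lborel (?E (k+2) r)"
    using integrable_gauss_integrand r rh by blast+
  have eq: "gauss_int b k (r + h) - gauss_int b k r - h * - gauss_int b (k+2) r
      = (\<integral>t. ?E k (r+h) t - ?E k r t + h * ?E (k+2) r t \<partial>lborel)"
    unfolding gauss_int_def
    by (subst Bochner_Integration.integral_add Bochner_Integration.integral_diff
          Bochner_Integration.integral_mult_right,
        (intro int Bochner_Integration.integrable_diff Bochner_Integration.integrable_mult_right impI)+)+ simp
  have "norm (gauss_int b k (r + h) - gauss_int b k r - h * - gauss_int b (k+2) r)
     \<le> (\<integral>t. (norm h)\<^sup>2 * (\<bar>t\<bar>^(k+4) * exp (- (Re r / 2) * t\<^sup>2)) \<partial>lborel)"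
    unfolding eq
  proof (rule Bochner_Integration.integral_norm_bound_integral)
    show "integrable lborel (\<lambda>t. ?E k (r+h) t - ?E k r t + h * ?E (k+2) r t)"
      by (intro int Bochner_Integration.integrable_diff Bochner_Integration.integrable_add
          Bochner_Integration.integrable_mult_right impI)
    show "integrable lborel (\<lambda>t. (norm h)\<^sup>2 * (\<bar>t\<bar>^(k+4) * exp (- (Re r / 2) * t\<^sup>2)))"
      using integrable_abs_moment[of "Re r / 2" "k+4"] r by (intro integrable_mult_right) auto
    fix t :: real
    define z where "z = - h * complex_of_real (t\<^sup>2)"
    have "?E k (r+h) t - ?E k r t + h * ?E (k+2) r t = ?E k r t * (exp z - 1 - z)"
    proof -
      have "- (r + h) * complex_of_real (t\<^sup>2) + \<i> * complex_of_real (b * t^3)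
         = (- r * complex_of_real (t\<^sup>2) + \<i> * complex_of_real (b * t^3)) + z"
        by (simp add: z_def algebra_simps)
      then show ?thesis
        by (simp only: exp_add) (simp add: z_def algebra_simps power_add power2_eq_square)
    qed
    also have "norm \<dots> = \<bar>t\<bar>^k * exp (- Re r * t\<^sup>2) * norm (exp z - 1 - z)"
      by (simp only: norm_mult[of _ "exp z - 1 - z"] norm_gauss_integrand)
    also have "\<dots> \<le> \<bar>t\<bar>^k * exp (- Re r * t\<^sup>2) * ((norm z)\<^sup>2 * exp \<bar>Re z\<bar>)"
      by (intro mult_left_mono norm_exp_minus_one_minus_le) auto
    also have "\<bar>t\<bar>^k * exp (- Re r * t\<^sup>2) * ((norm z)\<^sup>2 * exp \<bar>Re z\<bar>)
       \<le> \<bar>t\<bar>^k * exp (- Re r * t\<^sup>2) * ((norm z)\<^sup>2 * exp (Re r / 2 * t\<^sup>2))"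
    proof -
      have "\<bar>Re h\<bar> * t\<^sup>2 \<le> Re r / 2 * t\<^sup>2"
        using h abs_Re_le_cmod[of h] by (intro mult_right_mono) auto
      then have "\<bar>Re z\<bar> \<le> Re r / 2 * t\<^sup>2" by (simp add: z_def abs_mult)
      then show ?thesis by (intro mult_left_mono) auto
    qed
    also have "\<dots> = \<bar>t\<bar>^k * (norm z)\<^sup>2 * exp (- Re r * t\<^sup>2 + Re r / 2 * t\<^sup>2)"
      by (simp only: exp_add) (simp add: mult_ac)
    also have "\<dots> = (norm h)\<^sup>2 * (\<bar>t\<bar>^(k+4) * exp (- (Re r / 2) * t\<^sup>2))"
    proof -
      have 1: "- Re r * t\<^sup>2 + Re r / 2 * t\<^sup>2 = - (Re r / 2) * t\<^sup>2" by (simp add: field_simps)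
      have 2: "\<bar>t\<bar>^k * (norm z)\<^sup>2 = (norm h)\<^sup>2 * \<bar>t\<bar>^(k+4)"
        by (simp add: z_def norm_mult power_mult_distrib power_add norm_power)
      show ?thesis unfolding 1 2 mult.assoc ..
    qed
    finally show "norm (?E k (r+h) t - ?E k r t + h * ?E (k+2) r t)
       \<le> (norm h)\<^sup>2 * (\<bar>t\<bar>^(k+4) * exp (- (Re r / 2) * t\<^sup>2))" .
  qed
  also have "\<dots> = (\<integral>t. \<bar>t\<bar>^(k+4) * exp (- (Re r / 2) * t\<^sup>2) \<partial>lborel) * (norm h)\<^sup>2"
    by simp
  finally show "norm (gauss_int b k (r + h) - gauss_int b k r - h * - gauss_int b (k+2) r)
    \<le> (\<integral>t. \<bar>t\<bar>^(k+4) * exp (- (Re r / 2) * t\<^sup>2) \<partial>lborel) * (norm h)\<^sup>2" .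
qed

text \<open>The derivative of \<open>t^k\<close> times the exponential integrates to zero over the
  line. These relations between moments carry the whole content of the Airy equation. At
  \<open>k = 0\<close> the truncated \<open>k - 1\<close> is multiplied by zero.\<close>

lemma gauss_int_by_parts:
  assumes r: "Re r > 0"
  shows "of_nat k * gauss_int b (k-1) r - 2 * r * gauss_int b (k+1) r
     + 3 * \<i> * complex_of_real b * gauss_int b (k+2) r = 0"
proof -
  let ?E = "\<lambda>k t. complex_of_real (t^k) * exp (- r * complex_of_real (t\<^sup>2) + \<i> * complex_of_real (b * t^3))"
  let ?D = "\<lambda>t. of_nat k * ?E (k-1) t - 2 * r * ?E (k+1) t + 3 * \<i> * complex_of_real b * ?E (k+2) t"
  have intE: "integrable lborel (?E m)" for m
    using integrable_gauss_integrand r by blast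
  have int: "integrable lborel ?D"
    by (intro intE Bochner_Integration.integrable_diff Bochner_Integration.integrable_add
          Bochner_Integration.integrable_mult_right impI)
  have normE: "norm (?E k t) = \<bar>t\<bar>^k * exp (- Re r * t\<^sup>2)" for t
    by (rule norm_gauss_integrand)
  have top: "((\<lambda>t. \<bar>t\<bar>^k * exp (- Re r * t\<^sup>2)) \<longlongrightarrow> 0) at_top"
    using r by real_asymp
  have bot: "((\<lambda>t. \<bar>t\<bar>^k * exp (- Re r * t\<^sup>2)) \<longlongrightarrow> 0) at_bot"
    using r by real_asymp
  have "(LBINT t=-\<infinity>..\<infinity>. ?D t) = 0 - 0"
  proof (rule interval_integral_FTC_integrable[where F = "?E k"])
    fix t :: real
    show "(?E k has_vector_derivative ?D t) (at t)"
    proof -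
      have "((\<lambda>x. x ^ k * exp (- r * x\<^sup>2 + \<i> * (complex_of_real b * x^3))) has_field_derivative
         of_nat k * of_real t ^ (k-1) * exp (- r * (of_real t)\<^sup>2 + \<i> * (complex_of_real b * of_real t^3))
        + of_real t ^ k * (exp (- r * (of_real t)\<^sup>2 + \<i> * (complex_of_real b * of_real t^3))
           * (- r * (2 * of_real t) + \<i> * (complex_of_real b * (3 * (of_real t)\<^sup>2))))) (at (complex_of_real t))"
        by (rule derivative_eq_intros refl | simp)+
      from has_vector_derivative_real_field[OF this]
      have "((\<lambda>x. ?E k x) has_vector_derivative
         of_nat k * of_real t ^ (k-1) * exp (- r * (of_real t)\<^sup>2 + \<i> * (complex_of_real b * of_real t^3))
        + of_real t ^ k * (exp (- r * (of_real t)\<^sup>2 + \<i> * (complex_of_real b * of_real t^3))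
           * (- r * (2 * of_real t) + \<i> * (complex_of_real b * (3 * (of_real t)\<^sup>2))))) (at t)"
        by simp
      then show ?thesis
        by (rule back_subst[where P = "\<lambda>D. (_ has_vector_derivative D) _"])
           (simp add: algebra_simps power_add power2_eq_square)
    qed
    show "isCont ?D t" by (intro continuous_intros)
  next
    show "set_integrable lborel (einterval (- \<infinity>) \<infinity>) ?D"
      using int by (simp add: set_integrable_def)
    have e1: "(?E k \<longlongrightarrow> 0) at_top" by (rule tendsto_norm_zero_cancel) (use top in \<open>simp only: normE\<close>)
    have e2: "(?E k \<longlongrightarrow> 0) at_bot" by (rule tendsto_norm_zero_cancel) (use bot in \<open>simp only: normE\<close>)
    show "((?E k \<circ> real_of_ereal) \<longlongrightarrow> 0) (at_right (- \<infinity>))"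
      using e2 unfolding at_right_MInf filterlim_filtermap comp_def
      by (simp add: filterlim_filtermap)
    show "((?E k \<circ> real_of_ereal) \<longlongrightarrow> 0) (at_left \<infinity>)"
      using e1 unfolding at_left_PInf filterlim_filtermap comp_def
      by (simp add: filterlim_filtermap)
  qed simp
  then have "(\<integral>t. ?D t \<partial>lborel) = 0"
    by (simp add: interval_lebesgue_integral_def set_lebesgue_integral_def)
  moreover have "(\<integral>t. ?D t \<partial>lborel) = of_nat k * gauss_int b (k-1) r - 2 * r * gauss_int b (k+1) r
     + 3 * \<i> * complex_of_real b * gauss_int b (k+2) r"
    unfolding gauss_int_def
    by (subst Bochner_Integration.integral_add Bochner_Integration.integral_diff
          Bochner_Integration.integral_mult_right,
        (intro intE Bochner_Integration.integrable_diff Bochner_Integration.integrable_mult_right impI)+)+ simp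
  ultimately show ?thesis by simp
qed

text \<open>Integration by parts with \<open>k = 1\<close> and \<open>b = 0\<close> relates the
  moments 0 and 2 and makes the derivative of the product vanish on the convex half-plane. The
  constant is read off at \<open>r = 1\<close>.\<close>

lemma gauss_int_0_eq:
  assumes r: "Re r > 0"
  shows "gauss_int 0 0 r * csqrt r = complex_of_real (abs_moment 0)"
proof -
  have *: "((\<lambda>r. gauss_int 0 0 r * csqrt r) has_field_derivative 0) (at r within {r. Re r > 0})"
    if "r \<in> {r. Re r > 0}" for r
  proof -
    from that have r: "Re r > 0" by simp
    then have nn: "r \<notin> \<real>\<^sub>\<le>\<^sub>0" by (auto simp: complex_nonpos_Reals_iff)
    have nz: "csqrt r \<noteq> 0" using r by auto
    have "((\<lambda>r. gauss_int 0 0 r * csqrt r) has_field_derivative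
       - gauss_int 0 (0+2) r * csqrt r + inverse (2 * csqrt r) * gauss_int 0 0 r) (at r)"
      by (rule DERIV_mult[OF has_field_derivative_gauss_int[OF r] has_field_derivative_csqrt[OF nn]])
    moreover have "- gauss_int 0 (0+2) r * csqrt r + inverse (2 * csqrt r) * gauss_int 0 0 r = 0"
    proof -
      have "gauss_int 0 0 r = 2 * r * gauss_int 0 2 r"
        using gauss_int_by_parts[OF r, of 1 0] by (simp add: numeral_2_eq_2)
      moreover have "csqrt r * csqrt r = r"
        by (metis power2_csqrt power2_eq_square)
      ultimately have "gauss_int 0 0 r = 2 * (csqrt r * csqrt r) * gauss_int 0 2 r" by simp
      then show ?thesis using nz by (simp only: add_0) (simp add: field_simps)
    qed
    ultimately show ?thesis by (simp add: has_field_derivative_at_within)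
  qed
  have "convex {r. Re r > 0}" by (rule convex_halfspace_Re_gt)
  from has_field_derivative_zero_constant[OF this *]
  obtain c where c: "\<And>r. Re r > 0 \<Longrightarrow> gauss_int 0 0 r * csqrt r = c" by auto
  have "c = gauss_int 0 0 1" using c[of 1] by simp
  also have "\<dots> = (\<integral>t. complex_of_real (\<bar>t\<bar>^0 * exp (- t\<^sup>2)) \<partial>lborel)"
    unfolding gauss_int_def by (intro Bochner_Integration.integral_cong) (auto simp flip: exp_of_real)
  also have "\<dots> = complex_of_real (abs_moment 0)"
    unfolding abs_moment_def by (rule integral_complex_of_real)
  finally show ?thesis using c[OF r] by simp
qed

lemma abs_moment_0_pos: "abs_moment 0 > 0"
proof -
  have "has_bochner_integral lborel (\<lambda>x::real. exp (-x\<^sup>2)) (2 *\<^sub>R (sqrt pi / 2))"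
    by (rule has_bochner_integral_even_function[OF gaussian_moment_0]) simp
  then show ?thesis by (simp add: abs_moment_def has_bochner_integral_iff)
qed


text \<open>The term linear in \<open>b\<close> is an odd moment of a Gaussian and vanishes, so the
  error is quadratic in \<open>b\<close>. After multiplication by \<open>csqrt r\<close> it has
  order |r|^-3 instead of |r|^(-3/2), and after rescaling sqrt \<epsilon> instead of
  \<epsilon>^(1/4).\<close>

lemma norm_gauss_int_diff_le:
  assumes r: "Re r > 0"
  shows "norm (gauss_int b 0 r - gauss_int 0 0 r) \<le> b\<^sup>2 * abs_moment 6 / sqrt (Re r) ^ 7"
proof -
  have rz: "r \<noteq> 0" using r by auto
  have "gauss_int 0 1 r = 0" using gauss_int_by_parts[OF r, of 0 0] rz by simp
  then have G3: "gauss_int 0 3 r = 0"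
    using gauss_int_by_parts[OF r, of 2 0] rz by simp
  let ?E = "\<lambda>b k t. complex_of_real (t^k) * exp (- r * complex_of_real (t\<^sup>2) + \<i> * complex_of_real (b * t^3))"
  have intE: "integrable lborel (?E b m)" for b m
    using integrable_gauss_integrand r by blast
  have "gauss_int b 0 r - gauss_int 0 0 r - \<i> * b * gauss_int 0 3 r = (\<integral>t. ?E b 0 t - ?E 0 0 t - \<i> * b * ?E 0 3 t \<partial>lborel)"
  proof -
    have 1: "integrable lborel (\<lambda>t. \<i> * b * ?E 0 3 t)"
      by (intro Bochner_Integration.integrable_mult_right impI intE)
    have 2: "integrable lborel (\<lambda>t. ?E b 0 t - ?E 0 0 t)"
      by (intro Bochner_Integration.integrable_diff intE)
    have 3: "(\<integral>t. \<i> * b * ?E 0 3 t \<partial>lborel) = \<i> * b * gauss_int 0 3 r"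
      unfolding gauss_int_def by (rule Bochner_Integration.integral_mult_right) (rule intE)
    have 4: "(\<integral>t. ?E b 0 t - ?E 0 0 t \<partial>lborel) = gauss_int b 0 r - gauss_int 0 0 r"
      unfolding gauss_int_def by (rule Bochner_Integration.integral_diff) (rule intE)+
    show ?thesis
      unfolding Bochner_Integration.integral_diff[OF 2 1] 3 4 ..
  qed
  then have eq: "gauss_int b 0 r - gauss_int 0 0 r = (\<integral>t. ?E b 0 t - ?E 0 0 t - \<i> * b * ?E 0 3 t \<partial>lborel)"
    using G3 by simp
  have "norm (gauss_int b 0 r - gauss_int 0 0 r) \<le> (\<integral>t. b\<^sup>2 * (\<bar>t\<bar>^6 * exp (- Re r * t\<^sup>2)) \<partial>lborel)"
    unfolding eq
  proof (rule Bochner_Integration.integral_norm_bound_integral)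
    show "integrable lborel (\<lambda>t. ?E b 0 t - ?E 0 0 t - \<i> * b * ?E 0 3 t)"
      by (intro intE Bochner_Integration.integrable_diff Bochner_Integration.integrable_add
          Bochner_Integration.integrable_mult_right impI)
    show "integrable lborel (\<lambda>t. b\<^sup>2 * (\<bar>t\<bar>^6 * exp (- Re r * t\<^sup>2)))"
      using integrable_abs_moment[OF r, of 6] by (intro integrable_mult_right) auto
    fix t :: real
    define z where "z = \<i> * complex_of_real (b * t^3)"
    have "?E b 0 t - ?E 0 0 t - \<i> * b * ?E 0 3 t = ?E 0 0 t * (exp z - 1 - z)"
      unfolding exp_add z_def by (simp add: algebra_simps)
    also have "norm \<dots> = \<bar>t\<bar>^0 * exp (- Re r * t\<^sup>2) * norm (exp z - 1 - z)"
      by (simp only: norm_mult[of _ "exp z - 1 - z"] norm_gauss_integrand)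
    also have "\<dots> \<le> \<bar>t\<bar>^0 * exp (- Re r * t\<^sup>2) * ((norm z)\<^sup>2 * exp \<bar>Re z\<bar>)"
      by (intro mult_left_mono norm_exp_minus_one_minus_le) auto
    also have "\<dots> = b\<^sup>2 * (\<bar>t\<bar>^6 * exp (- Re r * t\<^sup>2))"
      proof -
      have "(norm z)\<^sup>2 = b\<^sup>2 * \<bar>t\<bar>^6"
      proof -
        have "norm z = \<bar>b\<bar> * \<bar>t\<bar>^3"
          by (simp add: z_def norm_mult norm_power abs_mult power_abs)
        then show ?thesis by (simp only: power_mult_distrib power_mult[symmetric] power2_abs) simp
      qed
      then show ?thesis by (simp add: z_def norm_mult)
    qed
    finally show "norm (?E b 0 t - ?E 0 0 t - \<i> * b * ?E 0 3 t) \<le> b\<^sup>2 * (\<bar>t\<bar>^6 * exp (- Re r * t\<^sup>2))" .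
  qed
  also have "\<dots> = b\<^sup>2 * abs_moment 6 / sqrt (Re r) ^ 7"
    using integral_abs_moment[OF r, of 6] by simp
  finally show ?thesis .
qed

text \<open>The substitution of - t for t flips the sign of the cubic phase, as conjugation does.
  All later reflection and reality statements rest on this.\<close>

lemma gauss_int_cnj:
  assumes "even k"
  shows "gauss_int b k (cnj r) = cnj (gauss_int b k r)"
proof -
  let ?E = "\<lambda>r t. complex_of_real (t^k) * exp (- r * complex_of_real (t\<^sup>2) + \<i> * complex_of_real (b * t^3))"
  have "gauss_int b k (cnj r) = \<bar>-1\<bar> *\<^sub>R (\<integral>t. ?E (cnj r) (0 + (-1) * t) \<partial>lborel)"
    unfolding gauss_int_def by (rule lborel_integral_real_affine) simp
  also have "(\<lambda>t. ?E (cnj r) (0 + (-1) * t)) = (\<lambda>t. cnj (?E r t))"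
    using assms by (auto simp: exp_cnj algebra_simps minus_diff_commute)
  finally show ?thesis by (simp only: Bochner_Integration.integral_cnj gauss_int_def abs_minus_cancel abs_one scaleR_one)
qed

text \<open>\<open>airy_r r\<close> is \<open>2 \<pi> Ai (r\<^sup>2)\<close>: the Airy integral moved to the contour through the saddle point.\<close>

definition airy_r :: "complex \<Rightarrow> complex" where
  "airy_r r = exp (- (2/3) * r^3) * gauss_int (1/3) 0 r"

text \<open>The derivative with respect to the Airy argument \<open>r\<^sup>2\<close>, that is 1/(2
  r) times the derivative in \<open>r\<close>; hence the factor \<open>2 * r\<close> in the two
  differentiation rules.\<close>

definition airy_r' :: "complex \<Rightarrow> complex" where
  "airy_r' r = exp (- (2/3) * r^3) * (- r * gauss_int (1/3) 0 r - gauss_int (1/3) 2 r / (2 * r))"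

lemma airy_r_cnj: "airy_r (cnj r) = cnj (airy_r r)" "airy_r' (cnj r) = cnj (airy_r' r)"
  by (simp_all add: airy_r_def airy_r'_def gauss_int_cnj exp_cnj)

lemma DERIV_airy_r:
  assumes r: "Re r > 0"
  shows "(airy_r has_field_derivative 2 * r * airy_r' r) (at r)"
proof -
  have rz: "r \<noteq> 0" using r by auto
  note [derivative_intros] = DERIV_chain2[OF has_field_derivative_gauss_int]
  show ?thesis
    unfolding airy_r_def[abs_def] airy_r'_def
    by (rule derivative_eq_intros refl r | simp)+
       (use rz in \<open>simp add: field_simps power2_eq_square numeral_2_eq_2\<close>)
qed

text \<open>This is the Airy equation in the variable \<open>r\<close>. Integration by parts for k =
  0, 1, 2 eliminates the odd moments and expresses \<open>r\<close> times the fourth moment by the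
  moments 0 and 2.\<close>

lemma DERIV_airy_r':
  assumes r: "Re r > 0"
  shows "(airy_r' has_field_derivative 2 * r * (r\<^sup>2 * airy_r r)) (at r)"
proof -
  have rz: "r \<noteq> 0" using r by auto
  let ?G = "\<lambda>k. gauss_int (1/3) k r"
  have p0: "\<i> * ?G 2 = 2 * r * ?G 1"
    using gauss_int_by_parts[OF r, of 0 "1/3"] by (simp add: numeral_2_eq_2 algebra_simps)
  have p1: "?G 0 - 2 * r * ?G 2 + \<i> * ?G 3 = 0"
    using gauss_int_by_parts[OF r, of 1 "1/3"] by (simp add: numeral_2_eq_2 numeral_3_eq_3)
  have p2: "2 * ?G 1 - 2 * r * ?G 3 + \<i> * ?G 4 = 0"
    using gauss_int_by_parts[OF r, of 2 "1/3"] by simp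
  have "\<i> * ?G 4 = 2 * r * ?G 3 - 2 * ?G 1"
  proof -
    have "\<i> * ?G 4 - (2 * r * ?G 3 - 2 * ?G 1) = 0" using p2 by (simp add: algebra_simps)
    then show ?thesis by simp
  qed
  then have "- (\<i> * r) * (\<i> * ?G 4) = - (\<i> * r) * (2 * r * ?G 3 - 2 * ?G 1)" by simp
  then have "r * ?G 4 = \<i> * (2 * r * ?G 1) - 2 * r\<^sup>2 * (\<i> * ?G 3)"
    by (simp add: algebra_simps power2_eq_square)
  also have "\<i> * ?G 3 = 2 * r * ?G 2 - ?G 0" using p1 by (simp add: algebra_simps add_eq_0_iff)
  also have "2 * r * ?G 1 = \<i> * ?G 2" using p0 by simp
  finally have key: "r * ?G 4 = - ?G 2 - 4 * r^3 * ?G 2 + 2 * r\<^sup>2 * ?G 0"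
    by (simp add: algebra_simps power2_eq_square power3_eq_cube)
  let ?e = "exp (- (2/3) * r^3)"
  have dG: "(gauss_int (1/3) 0 has_field_derivative - ?G 2) (at r)"
    "(gauss_int (1/3) 2 has_field_derivative - ?G 4) (at r)"
    using has_field_derivative_gauss_int[OF r, of "1/3" 0] has_field_derivative_gauss_int[OF r, of "1/3" 2]
    by (simp_all add: numeral_2_eq_2 numeral_eq_Suc)
  have de: "((\<lambda>r. exp (- (2/3) * r^3)) has_field_derivative ?e * (- 2 * r\<^sup>2)) (at r)"
    by (rule derivative_eq_intros refl | simp)+
  have d1: "((\<lambda>r. - r * gauss_int (1/3) 0 r) has_field_derivative - ?G 0 + r * ?G 2) (at r)"
    using DERIV_mult[OF DERIV_minus[OF DERIV_ident] dG(1)] by (simp add: algebra_simps)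
  have d2: "((\<lambda>r. gauss_int (1/3) 2 r / (2 * r)) has_field_derivative
      (- ?G 4 * (2 * r) - ?G 2 * 2) / ((2 * r) * (2 * r))) (at r)"
    using DERIV_divide[OF dG(2) DERIV_cmult[OF DERIV_ident, of 2]] rz by simp
  have "(airy_r' has_field_derivative
      ?e * (- 2 * r\<^sup>2) * (- r * ?G 0 - ?G 2 / (2 * r))
      + (- ?G 0 + r * ?G 2 - (- ?G 4 * (2 * r) - ?G 2 * 2) / ((2 * r) * (2 * r))) * ?e) (at r)"
    unfolding airy_r'_def[abs_def] by (rule DERIV_mult[OF de DERIV_diff[OF d1 d2]])
  moreover have "?e * (- 2 * r\<^sup>2) * (- r * ?G 0 - ?G 2 / (2 * r))
      + (- ?G 0 + r * ?G 2 - (- ?G 4 * (2 * r) - ?G 2 * 2) / ((2 * r) * (2 * r))) * ?e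
     = 2 * r * (r\<^sup>2 * airy_r r)"
  proof -
    have G4: "?G 4 = (- ?G 2 - 4 * r^3 * ?G 2 + 2 * r\<^sup>2 * ?G 0) / r"
      using key rz by (simp add: field_simps)
    have "(- 2 * r\<^sup>2) * (- r * ?G 0 - ?G 2 / (2 * r))
      + (- ?G 0 + r * ?G 2 - (- ?G 4 * (2 * r) - ?G 2 * 2) / ((2 * r) * (2 * r))) = 2 * r^3 * ?G 0"
      unfolding G4 using rz by (simp add: field_simps power2_eq_square power3_eq_cube)
    then have "?e * ((- 2 * r\<^sup>2) * (- r * ?G 0 - ?G 2 / (2 * r))
      + (- ?G 0 + r * ?G 2 - (- ?G 4 * (2 * r) - ?G 2 * 2) / ((2 * r) * (2 * r)))) = ?e * (2 * r^3 * ?G 0)"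
      by (simp only:)
    moreover have "?e * A * B + C * ?e = ?e * (A * B + C)" for A B C
      by (simp add: algebra_simps)
    moreover have "?e * (2 * r^3 * ?G 0) = 2 * r * (r\<^sup>2 * airy_r r)"
      by (simp add: airy_r_def power2_eq_square power3_eq_cube)
    ultimately show ?thesis by (simp only:)
  qed
  ultimately show ?thesis by simp
qed

section \<open>Large-argument asymptotics and the Airy sector\<close>

definition gauss_const :: complex where "gauss_const = complex_of_real (abs_moment 0)"

lemma gauss_const_pos: "norm gauss_const > 0" "gauss_const \<noteq> 0"
  using abs_moment_0_pos by (auto simp: gauss_const_def)

text \<open>In the cone |Arg r| \<le> pi/3 bounds in terms of \<open>Re r\<close> become bounds in
  terms of \<open>norm r\<close>. The cone must be this wide because the dominant solution is
  evaluated there up to the ray through \<open>third_root\<close>.\<close>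

lemma gauss_int_asymptotics:
  obtains C where "C > 0"
    "\<And>r. \<lbrakk>r \<noteq> 0; norm r \<le> 2 * Re r\<rbrakk> \<Longrightarrow> norm (gauss_int (1/3) 0 r * csqrt r - gauss_const) \<le> C / norm r ^ 3"
    "\<And>r. \<lbrakk>r \<noteq> 0; norm r \<le> 2 * Re r\<rbrakk> \<Longrightarrow> norm (gauss_int (1/3) 2 r * csqrt r) \<le> C / norm r"
proof
  define C where "C = sqrt 2 ^ 7 * abs_moment 6 + sqrt 2 ^ 3 * abs_moment 2 + 1"
  show "C > 0" unfolding C_def using abs_moment_nonneg by (intro add_nonneg_pos) auto
  have sq: "sqrt (norm r) \<le> sqrt 2 * sqrt (Re r)" if "norm r \<le> 2 * Re r" for r
    using that by (metis real_sqrt_le_iff real_sqrt_mult)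
  have nsq: "norm (csqrt r) = sqrt (norm r)" for r by simp
  fix r :: complex assume rz: "r \<noteq> 0" and rr: "norm r \<le> 2 * Re r"
  have r: "Re r > 0" using rz rr by (smt (verit) zero_less_norm_iff)
  define a where "a = sqrt (norm r)"
  have a: "a > 0" "a\<^sup>2 = norm r" using rz by (auto simp: a_def)
  have ba: "1 / sqrt (Re r) ^ k \<le> sqrt 2 ^ k / a ^ k" for k
  proof -
    have "a ^ k \<le> (sqrt 2 * sqrt (Re r)) ^ k" using sq[OF rr] a by (intro power_mono) (auto simp: a_def)
    then show ?thesis using a r by (simp add: divide_simps power_mult_distrib)
  qed
  have b: "m / sqrt (Re r) ^ k \<le> m * sqrt 2 ^ k / a ^ k" if "m \<ge> 0" for k m
    using mult_left_mono[OF ba that] by simp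
  have "norm (gauss_int (1/3) 0 r * csqrt r - gauss_const)
     = norm (gauss_int (1/3) 0 r - gauss_int 0 0 r) * a"
    unfolding gauss_const_def gauss_int_0_eq[OF r, symmetric] left_diff_distrib[symmetric] norm_mult nsq a_def ..
  also have "\<dots> \<le> (abs_moment 6 / sqrt (Re r) ^ 7) * a"
  proof (rule mult_right_mono)
    have "(1/3)\<^sup>2 * abs_moment 6 / sqrt (Re r) ^ 7 \<le> abs_moment 6 / sqrt (Re r) ^ 7"
      using r abs_moment_nonneg[of 6] by (intro divide_right_mono) (auto simp: power2_eq_square)
    with norm_gauss_int_diff_le[OF r, of "1/3"]
    show "norm (gauss_int (1/3) 0 r - gauss_int 0 0 r) \<le> abs_moment 6 / sqrt (Re r) ^ 7" by linarith
  qed (use a in auto)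
  also have "\<dots> \<le> (abs_moment 6 * sqrt 2 ^ 7 / a ^ 7) * a"
    using a by (intro mult_right_mono b abs_moment_nonneg) auto
  also have "\<dots> = (sqrt 2 ^ 7 * abs_moment 6) / (a\<^sup>2) ^ 3"
    using a(1) by (simp add: field_simps eval_nat_numeral)
  also have "\<dots> \<le> C / (a\<^sup>2) ^ 3"
    using a abs_moment_nonneg[of 2] by (intro divide_right_mono) (auto simp: C_def)
  finally show "norm (gauss_int (1/3) 0 r * csqrt r - gauss_const) \<le> C / norm r ^ 3" using a by simp
  have "norm (gauss_int (1/3) 2 r * csqrt r) = norm (gauss_int (1/3) 2 r) * a"
    unfolding norm_mult nsq a_def ..
  also have "\<dots> \<le> (abs_moment 2 / sqrt (Re r) ^ 3) * a"
    using norm_gauss_int_le[OF r, of "1/3" 2] a by (intro mult_right_mono) auto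
  also have "\<dots> \<le> (abs_moment 2 * sqrt 2 ^ 3 / a ^ 3) * a"
    using a by (intro mult_right_mono b abs_moment_nonneg) auto
  also have "\<dots> = (sqrt 2 ^ 3 * abs_moment 2) / a\<^sup>2"
    using a(1) by (simp add: field_simps eval_nat_numeral)
  also have "\<dots> \<le> C / a\<^sup>2"
    using a abs_moment_nonneg[of 6] by (intro divide_right_mono) (auto simp: C_def)
  finally show "norm (gauss_int (1/3) 2 r * csqrt r) \<le> C / norm r" using a by simp
qed

text \<open>For \<open>z\<close> in this set \<open>csqrt z\<close> stays in the right half-plane after rotation by \<open>\<plusminus> \<pi>/3\<close>, so the
  recessive and both dominant Airy solutions are given by the same integral.\<close>

definition airy_sector :: "real \<Rightarrow> complex set" where
  "airy_sector R = {z. R < Re z \<and> \<bar>Im z\<bar> < sqrt 3 * Re z}"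

text \<open>Since its cube is -1, replacing r by \<open>third_root * r\<close> inverts the
  exponential in \<open>airy_r\<close> and makes the solution dominant; since its sixth power is 1,
  the Airy equation is preserved.\<close>

definition third_root :: complex where "third_root = cis (- pi / 3)"

lemma third_root_simps:
  "third_root = Complex (1/2) (- sqrt 3 / 2)" "third_root ^ 3 = -1" "norm third_root = 1"
  "third_root \<noteq> 0"
proof -
  show 1: "third_root = Complex (1/2) (- sqrt 3 / 2)"
    by (simp add: third_root_def complex_eq_iff cos_60 sin_60)
  show "third_root ^ 3 = -1" by (simp add: third_root_def Complex.DeMoivre complex_eq_iff)
  show "norm third_root = 1" by (simp add: third_root_def)
  then show "third_root \<noteq> 0" by auto
qed

lemma convex_airy_sector: "convex (airy_sector R)"
proof -
  have "airy_sector R = {z. R < Re z} \<inter> {z. (\<i> - complex_of_real (sqrt 3)) \<bullet> z < 0}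
      \<inter> {z. (- \<i> - complex_of_real (sqrt 3)) \<bullet> z < 0}"
    by (auto simp: airy_sector_def inner_complex_def abs_less_iff)
  then show ?thesis
    by (simp add: convex_Int convex_halfspace_Re_gt convex_halfspace_lt)
qed

lemma csqrt_airy_sector:
  assumes z: "z \<in> airy_sector R" and R: "R \<ge> 0"
  shows "Re (csqrt z) > 0" "sqrt 3 * \<bar>Im (csqrt z)\<bar> < Re (csqrt z)" "z \<notin> \<real>\<^sub>\<le>\<^sub>0"
    "R \<le> (norm (csqrt z))\<^sup>2" "csqrt z \<noteq> 0"
proof -
  define p q where "p = Re (csqrt z)" and "q = Im (csqrt z)"
  have zz: "z = (Complex p q)\<^sup>2" by (simp only: p_def q_def complex_surj power2_csqrt)
  have Rez: "Re z = p\<^sup>2 - q\<^sup>2" and Imz: "Im z = 2 * p * q" by (simp_all add: zz power2_eq_square)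
  have pos: "Re z > 0" using z R by (simp add: airy_sector_def)
  show nn: "z \<notin> \<real>\<^sub>\<le>\<^sub>0" using pos by (auto simp: complex_nonpos_Reals_iff)
  show cz: "csqrt z \<noteq> 0" using pos by auto
  have p0: "p \<ge> 0" using csqrt_principal[of z] cz by (auto simp: p_def)
  have "p \<noteq> 0" using pos Rez by auto
  with p0 have p: "p > 0" by simp
  then show "Re (csqrt z) > 0" by (simp add: p_def)
  have s3: "sqrt 3 * sqrt 3 = 3" by simp
  have "2 * p * \<bar>q\<bar> < sqrt 3 * (p\<^sup>2 - q\<^sup>2)"
    using z p by (simp add: airy_sector_def Rez Imz abs_mult)
  \<comment> \<open>The condition |Arg z| < pi/3 must become |Arg (csqrt z)| < pi/6. The quadratic
    form in p and |q| splits into two linear factors, of which the second is positive.\<close>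
  then have "(p - sqrt 3 * \<bar>q\<bar>) * (sqrt 3 * p + \<bar>q\<bar>) > 0"
    using s3 by (simp add: algebra_simps power2_eq_square)
  moreover have "sqrt 3 * p + \<bar>q\<bar> > 0" using p by (intro add_pos_nonneg) auto
  ultimately have "p - sqrt 3 * \<bar>q\<bar> > 0" by (simp add: zero_less_mult_iff)
  then show "sqrt 3 * \<bar>Im (csqrt z)\<bar> < Re (csqrt z)" by (simp add: p_def q_def)
  have "R \<le> Re z" using z by (simp add: airy_sector_def)
  also have "\<dots> \<le> norm z" by (rule complex_Re_le_cmod)
  finally show "R \<le> (norm (csqrt z))\<^sup>2" by simp
qed

lemma airy_sector_cnj: "cnj z \<in> airy_sector R \<longleftrightarrow> z \<in> airy_sector R"
  by (simp add: airy_sector_def)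

section \<open>Airy solutions in the sector\<close>

text \<open>One chain-rule computation for all three solutions: \<gamma> is 1,
  \<open>third_root\<close> or its conjugate.\<close>

lemma DERIV_airy_branch:
  assumes z: "z \<notin> \<real>\<^sub>\<le>\<^sub>0" and g: "Re (\<gamma> * csqrt z) > 0" "\<gamma> ^ 6 = 1"
  shows "((\<lambda>z. airy_r (\<gamma> * csqrt z)) has_field_derivative \<gamma>\<^sup>2 * airy_r' (\<gamma> * csqrt z)) (at z)"
    "((\<lambda>z. \<gamma>\<^sup>2 * airy_r' (\<gamma> * csqrt z)) has_field_derivative z * airy_r (\<gamma> * csqrt z)) (at z)"
proof -
  define r where "r = csqrt z"
  have rz: "r \<noteq> 0" using g by (auto simp: r_def)
  have zr: "z = r\<^sup>2" by (simp add: r_def)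
  have d: "((\<lambda>z. \<gamma> * csqrt z) has_field_derivative \<gamma> * inverse (2 * r)) (at z)"
    unfolding r_def by (rule DERIV_cmult[OF has_field_derivative_csqrt[OF z]])
  have "((\<lambda>z. airy_r (\<gamma> * csqrt z)) has_field_derivative
      2 * (\<gamma> * r) * airy_r' (\<gamma> * r) * (\<gamma> * inverse (2 * r))) (at z)"
    using DERIV_chain2[OF DERIV_airy_r[OF g(1)] d] by (simp add: r_def)
  also have "2 * (\<gamma> * r) * airy_r' (\<gamma> * r) * (\<gamma> * inverse (2 * r)) = \<gamma>\<^sup>2 * airy_r' (\<gamma> * csqrt z)"
    using rz by (simp add: field_simps power2_eq_square flip: r_def)
  finally show "((\<lambda>z. airy_r (\<gamma> * csqrt z)) has_field_derivative \<gamma>\<^sup>2 * airy_r' (\<gamma> * csqrt z)) (at z)" .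
  have "((\<lambda>z. \<gamma>\<^sup>2 * airy_r' (\<gamma> * csqrt z)) has_field_derivative
      \<gamma>\<^sup>2 * (2 * (\<gamma> * r) * ((\<gamma> * r)\<^sup>2 * airy_r (\<gamma> * r)) * (\<gamma> * inverse (2 * r)))) (at z)"
    using DERIV_cmult[OF DERIV_chain2[OF DERIV_airy_r'[OF g(1)] d]] by (simp add: r_def)
  also have "\<gamma>\<^sup>2 * (2 * (\<gamma> * r) * ((\<gamma> * r)\<^sup>2 * airy_r (\<gamma> * r)) * (\<gamma> * inverse (2 * r)))
     = \<gamma> ^ 6 * (r\<^sup>2 * airy_r (\<gamma> * r))"
    using rz by (simp add: field_simps eval_nat_numeral)
  also have "\<dots> = z * airy_r (\<gamma> * csqrt z)" using g(2) by (simp flip: r_def zr)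
  finally show "((\<lambda>z. \<gamma>\<^sup>2 * airy_r' (\<gamma> * csqrt z)) has_field_derivative z * airy_r (\<gamma> * csqrt z)) (at z)" .
qed

definition airy_U :: "complex \<Rightarrow> complex" where "airy_U z = airy_r (csqrt z)"
definition airy_U' :: "complex \<Rightarrow> complex" where "airy_U' z = airy_r' (csqrt z)"
text \<open>The factor \<open>csqrt third_root\<close> normalises \<open>airy_V1 z / airy_U z\<close> to \<open>exp (4/3 csqrt z ^ 3)\<close> at leading order.\<close>

definition airy_V1 :: "complex \<Rightarrow> complex" where
  "airy_V1 z = csqrt third_root * airy_r (third_root * csqrt z)"
definition airy_V1' :: "complex \<Rightarrow> complex" where
  "airy_V1' z = csqrt third_root * (third_root\<^sup>2 * airy_r' (third_root * csqrt z))"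
definition airy_V2 :: "complex \<Rightarrow> complex" where
  "airy_V2 z = cnj (csqrt third_root) * airy_r (cnj third_root * csqrt z)"
definition airy_V2' :: "complex \<Rightarrow> complex" where
  "airy_V2' z = cnj (csqrt third_root) * ((cnj third_root)\<^sup>2 * airy_r' (cnj third_root * csqrt z))"

lemma Re_third_root_times:
  assumes "sqrt 3 * \<bar>Im r\<bar> < Re r"
  shows "Re (third_root * r) > 0" "Re (cnj third_root * r) > 0"
proof -
  have "\<bar>sqrt 3 * Im r\<bar> < Re r" using assms by (simp add: abs_mult)
  then have 1: "sqrt 3 * Im r < Re r" "- (sqrt 3 * Im r) < Re r" by linarith+
  then show "Re (third_root * r) > 0" "Re (cnj third_root * r) > 0"
    by (simp_all add: third_root_simps(1))
qed

context
  fixes z :: complex and R :: real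
  assumes z: "z \<in> airy_sector R" and R: "R \<ge> 0"
begin

lemma DERIV_airy_U:
  "(airy_U has_field_derivative airy_U' z) (at z)"
  "(airy_U' has_field_derivative z * airy_U z) (at z)"
  using DERIV_airy_branch[of z 1] csqrt_airy_sector[OF z R]
  by (simp_all add: airy_U_def[abs_def] airy_U'_def[abs_def])

lemma DERIV_airy_V1:
  "(airy_V1 has_field_derivative airy_V1' z) (at z)"
  "(airy_V1' has_field_derivative z * airy_V1 z) (at z)"
proof -
  have 6: "third_root ^ 6 = 1"
    using third_root_simps(2) power_mult[of third_root 3 2] by simp
  note c = csqrt_airy_sector[OF z R]
  note d = DERIV_airy_branch[OF c(3) Re_third_root_times(1)[OF c(2)] 6]
  show "(airy_V1 has_field_derivative airy_V1' z) (at z)"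
    unfolding airy_V1_def[abs_def] airy_V1'_def by (rule DERIV_cmult[OF d(1)])
  have "(airy_V1' has_field_derivative csqrt third_root * (z * airy_r (third_root * csqrt z))) (at z)"
    unfolding airy_V1'_def[abs_def] by (rule DERIV_cmult[OF d(2)])
  then show "(airy_V1' has_field_derivative z * airy_V1 z) (at z)"
    by (simp add: airy_V1_def mult_ac)
qed

lemma DERIV_airy_V2:
  "(airy_V2 has_field_derivative airy_V2' z) (at z)"
  "(airy_V2' has_field_derivative z * airy_V2 z) (at z)"
proof -
  have 6: "cnj third_root ^ 6 = 1"
    using third_root_simps(2) power_mult[of third_root 3 2] by (simp flip: complex_cnj_power)
  note c = csqrt_airy_sector[OF z R]
  note d = DERIV_airy_branch[OF c(3) Re_third_root_times(2)[OF c(2)] 6]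
  show "(airy_V2 has_field_derivative airy_V2' z) (at z)"
    unfolding airy_V2_def[abs_def] airy_V2'_def by (rule DERIV_cmult[OF d(1)])
  have "(airy_V2' has_field_derivative cnj (csqrt third_root) * (z * airy_r (cnj third_root * csqrt z))) (at z)"
    unfolding airy_V2'_def[abs_def] by (rule DERIV_cmult[OF d(2)])
  then show "(airy_V2' has_field_derivative z * airy_V2 z) (at z)"
    by (simp add: airy_V2_def mult_ac)
qed

lemma airy_cnj:
  "airy_U (cnj z) = cnj (airy_U z)" "airy_U' (cnj z) = cnj (airy_U' z)"
  "airy_V1 (cnj z) = cnj (airy_V2 z)" "airy_V1' (cnj z) = cnj (airy_V2' z)"
  "airy_V2 (cnj z) = cnj (airy_V1 z)" "airy_V2' (cnj z) = cnj (airy_V1' z)"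
proof -
  have c: "csqrt (cnj z) = cnj (csqrt z)" using csqrt_airy_sector[OF z R] by (simp add: cnj_csqrt)
  have 1: "third_root * cnj w = cnj (cnj third_root * w)" "cnj third_root * cnj w = cnj (third_root * w)" for w
    by simp_all
  show "airy_U (cnj z) = cnj (airy_U z)" "airy_U' (cnj z) = cnj (airy_U' z)"
    by (simp_all only: airy_U_def airy_U'_def c airy_r_cnj)
  show "airy_V1 (cnj z) = cnj (airy_V2 z)" "airy_V1' (cnj z) = cnj (airy_V2' z)"
    "airy_V2 (cnj z) = cnj (airy_V1 z)" "airy_V2' (cnj z) = cnj (airy_V1' z)"
    unfolding airy_V1_def airy_V1'_def airy_V2_def airy_V2'_def c 1 airy_r_cnj
    by simp_all
qed

end

section \<open>Amplitudes, products and Wronskians\<close>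

text \<open>The factor \<open>csqrt r\<close> compensates the decay of the Gaussian integral: for
  \<open>k = 0\<close> the amplitude tends to \<open>gauss_const\<close>, for \<open>k = 2\<close>
  to zero.\<close>

definition airy_amp :: "nat \<Rightarrow> complex \<Rightarrow> complex" where
  "airy_amp k r = gauss_int (1/3) k r * csqrt r"

lemma csqrt_third_root_times:
  assumes "Re r > 0"
  shows "csqrt (third_root * r) = csqrt third_root * csqrt r"
proof (rule csqrt_mult)
  have "Arg third_root = - pi / 3" unfolding third_root_def
    by (rule Arg_cis) (use pi_gt_zero in \<open>simp add: field_simps\<close>)
  moreover have "\<bar>Arg r\<bar> < pi / 2" using assms Arg_Re_pos by blast
  ultimately show "Arg third_root + Arg r \<in> {-pi<..pi}" using pi_gt_zero by auto
qed

text \<open>The exponentials of \<open>airy_U\<close> and \<open>airy_V1\<close> are reciprocal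
  because \<open>third_root ^ 3 = -1\<close>. Thus the first and third expressions contain
  amplitudes only and can be followed to infinity, while the second isolates the WKB
  exponential.\<close>

lemma airy_product:
  assumes r: "Re (csqrt z) > 0"
  shows "airy_U z * airy_V1 z = airy_amp 0 (csqrt z) * airy_amp 0 (third_root * csqrt z) / csqrt z"
    "airy_V1 z * airy_amp 0 (csqrt z)
        = exp (4/3 * csqrt z ^ 3) * airy_amp 0 (third_root * csqrt z) * airy_U z"
    "airy_U z * airy_V1' z - airy_U' z * airy_V1 z
       = 2 * airy_amp 0 (csqrt z) * airy_amp 0 (third_root * csqrt z)
       + (airy_amp 2 (csqrt z) * airy_amp 0 (third_root * csqrt z)
          - third_root * airy_amp 0 (csqrt z) * airy_amp 2 (third_root * csqrt z)) / (2 * (csqrt z)\<^sup>2)"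
proof -
  define r a s b where "r = csqrt z" and "a = third_root" and "s = csqrt r" and "b = csqrt a"
  have rz: "r \<noteq> 0" "Re r > 0" using r by (auto simp: r_def)
  have sz: "s \<noteq> 0" and bz: "b \<noteq> 0" using rz third_root_simps(4) by (auto simp: s_def b_def a_def)
  have rs: "r = s\<^sup>2" by (simp add: s_def)
  have ab: "a = b\<^sup>2" by (simp add: b_def)
  have a3: "a ^ 3 = -1" unfolding a_def by (rule third_root_simps(2))
  have c: "csqrt (a * r) = b * s" using csqrt_third_root_times[OF rz(2)] by (simp add: a_def b_def s_def)
  let ?G = "gauss_int (1/3)"
  define e where "e = exp (- (2/3) * r^3)"
  define e' where "e' = exp ((2/3) * r^3)"
  have ee: "e * e' = 1" by (simp add: e_def e'_def flip: exp_add)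
  have w: "airy_r r = e * ?G 0 r" "airy_r (a * r) = e' * ?G 0 (a * r)"
    "airy_r' r = e * (- r * ?G 0 r - ?G 2 r / (2 * r))"
    "airy_r' (a * r) = e' * (- (a * r) * ?G 0 (a * r) - ?G 2 (a * r) / (2 * (a * r)))"
    using a3 by (simp_all add: airy_r_def airy_r'_def e_def e'_def power_mult_distrib)
  note defs = airy_U_def airy_V1_def airy_U'_def airy_V1'_def airy_amp_def
  note folds = r_def[symmetric] a_def[symmetric] b_def[symmetric] s_def[symmetric]
  show "airy_U z * airy_V1 z = airy_amp 0 (csqrt z) * airy_amp 0 (third_root * csqrt z) / csqrt z"
  proof -
    have "airy_U z * airy_V1 z = (e * e') * (b * ?G 0 r * ?G 0 (a * r))"
      unfolding defs folds c w by (simp add: mult_ac)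
    also have "\<dots> = ?G 0 r * s * (?G 0 (a * r) * (b * s)) / s\<^sup>2"
      using sz unfolding ee by (simp add: field_simps power2_eq_square)
    finally show ?thesis unfolding defs folds c by (simp flip: rs)
  qed
  show "airy_V1 z * airy_amp 0 (csqrt z)
        = exp (4/3 * csqrt z ^ 3) * airy_amp 0 (third_root * csqrt z) * airy_U z"
  proof -
    have "exp (4/3 * r ^ 3) = e' * e'" by (simp add: e'_def flip: exp_add)
    then have "exp (4/3 * r ^ 3) * airy_amp 0 (a * r) * airy_U z
       = (e * e') * (e' * (?G 0 (a * r) * (b * s)) * ?G 0 r)"
      unfolding defs folds c w by (simp add: mult_ac)
    also have "\<dots> = airy_V1 z * airy_amp 0 r"
      unfolding ee unfolding defs folds c w by (simp add: mult_ac)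
    finally show ?thesis unfolding folds by simp
  qed
  have "airy_U z * airy_V1' z - airy_U' z * airy_V1 z
    = (e * e') * (b * a\<^sup>2 * ?G 0 r * (- (a * r) * ?G 0 (a * r) - ?G 2 (a * r) / (2 * (a * r)))
       + b * (r * ?G 0 r + ?G 2 r / (2 * r)) * ?G 0 (a * r))"
    unfolding defs folds c w by (simp add: algebra_simps)
  also have "\<dots> = b * (- (a ^ 3) * r * ?G 0 r * ?G 0 (a * r) - a * ?G 0 r * ?G 2 (a * r) / (2 * r)
       + (r * ?G 0 r + ?G 2 r / (2 * r)) * ?G 0 (a * r))"
    using rz(1) third_root_simps(4) unfolding ee folds
    by (simp add: field_simps power2_eq_square power3_eq_cube)
  also have "\<dots> = b * (2 * r * ?G 0 r * ?G 0 (a * r) - a * ?G 0 r * ?G 2 (a * r) / (2 * r)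
       + ?G 2 r / (2 * r) * ?G 0 (a * r))"
    unfolding a3 by (simp add: algebra_simps)
  also have "\<dots> = 2 * airy_amp 0 r * airy_amp 0 (a * r)
       + (airy_amp 2 r * airy_amp 0 (a * r) - a * airy_amp 0 r * airy_amp 2 (a * r)) / (2 * r\<^sup>2)"
    using sz unfolding defs folds c unfolding rs
    by (simp add: field_simps power2_eq_square)
  finally show "airy_U z * airy_V1' z - airy_U' z * airy_V1 z
       = 2 * airy_amp 0 (csqrt z) * airy_amp 0 (third_root * csqrt z)
       + (airy_amp 2 (csqrt z) * airy_amp 0 (third_root * csqrt z)
          - third_root * airy_amp 0 (csqrt z) * airy_amp 2 (third_root * csqrt z)) / (2 * (csqrt z)\<^sup>2)"
    unfolding folds .
qed

lemma real_in_airy_sector: "x > R \<Longrightarrow> x > 0 \<Longrightarrow> complex_of_real x \<in> airy_sector R"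
  by (simp add: airy_sector_def)

lemma constant_on_airy_sector:
  assumes "\<And>z. z \<in> airy_sector R \<Longrightarrow> (f has_field_derivative 0) (at z)"
  obtains c where "\<And>z. z \<in> airy_sector R \<Longrightarrow> f z = c"
  using has_field_derivative_zero_constant[OF convex_airy_sector[of R], of f] assms
  by (meson has_field_derivative_at_within)

text \<open>The rotation by - pi/3 sends arguments in [0, pi/2) into the cone of
  \<open>gauss_int_asymptotics\<close>. For negative arguments near - pi/6 the rotated point
  approaches the imaginary axis, so \<open>airy_V1\<close> is estimated only in the upper half and
  the lower half is obtained by reflection.\<close>

lemma third_root_times_cone:
  assumes "Im r \<ge> 0" "Re r > 0"
  shows "norm (third_root * r) \<le> 2 * Re (third_root * r)"
proof -
  have "(norm r)\<^sup>2 \<le> (Re r + sqrt 3 * Im r)\<^sup>2"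
  proof -
    have "0 \<le> Re r * (sqrt 3 * Im r)" using assms by simp
    moreover have "(sqrt 3 * Im r)\<^sup>2 = 3 * (Im r)\<^sup>2" by (simp add: power_mult_distrib)
    ultimately show ?thesis
      unfolding cmod_power2 power2_sum using zero_le_power2[of "Im r"] by linarith
  qed
  then have "norm r \<le> Re r + sqrt 3 * Im r"
    using assms by - (rule power2_le_imp_le, auto)
  then show ?thesis by (simp add: norm_mult third_root_simps(3)) (simp add: third_root_simps(1))
qed

lemma norm_le_2_Re:
  assumes "sqrt 3 * \<bar>Im r\<bar> < Re r"
  shows "norm r \<le> 2 * Re r"
proof -
  have "(sqrt 3 * \<bar>Im r\<bar>)\<^sup>2 \<le> (Re r)\<^sup>2" using assms by (intro power_mono) auto
  then have "3 * (Im r)\<^sup>2 \<le> (Re r)\<^sup>2" by (simp add: power_mult_distrib)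
  then have "(norm r)\<^sup>2 \<le> (2 * Re r)\<^sup>2"
    unfolding cmod_power2 power_mult_distrib using zero_le_power2[of "Re r"] zero_le_power2[of "Im r"]
    unfolding power2_eq_square[of 2] by linarith
  moreover have "Re r \<ge> 0" using assms by (smt (verit) mult_nonneg_nonneg real_sqrt_ge_0_iff abs_ge_zero)
  ultimately show ?thesis by - (rule power2_le_imp_le, auto)
qed

lemma airy_amp_limits:
  assumes u: "norm u = 1" "norm u \<le> 2 * Re u"
  shows "((\<lambda>x. airy_amp 0 (u * complex_of_real x)) \<longlongrightarrow> gauss_const) at_top"
    "((\<lambda>x. airy_amp 2 (u * complex_of_real x)) \<longlongrightarrow> 0) at_top"
proof -
  obtain C where C: "C > 0"
    "\<And>r. \<lbrakk>r \<noteq> 0; norm r \<le> 2 * Re r\<rbrakk> \<Longrightarrow> norm (gauss_int (1/3) 0 r * csqrt r - gauss_const) \<le> C / norm r ^ 3"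
    "\<And>r. \<lbrakk>r \<noteq> 0; norm r \<le> 2 * Re r\<rbrakk> \<Longrightarrow> norm (gauss_int (1/3) 2 r * csqrt r) \<le> C / norm r"
    by (rule gauss_int_asymptotics) (rule that)
  have cone: "u * complex_of_real x \<noteq> 0" "norm (u * complex_of_real x) \<le> 2 * Re (u * complex_of_real x)"
    "norm (u * complex_of_real x) = x" if "x > 0" for x
    using u that mult_right_mono[OF u(2), of x] by (auto simp: norm_mult)
  have *: "norm (airy_amp 0 (u * complex_of_real x) - gauss_const) \<le> C / x ^ 3"
    "norm (airy_amp 2 (u * complex_of_real x)) \<le> C / x" if "x > 0" for x
    using C(2,3)[OF cone(1,2)[OF that]] cone(3)[OF that] by (simp_all add: airy_amp_def)
  show "((\<lambda>x. airy_amp 0 (u * complex_of_real x)) \<longlongrightarrow> gauss_const) at_top"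
  proof (rule LIM_zero_cancel, rule Lim_null_comparison)
    show "\<forall>\<^sub>F x in at_top. norm (airy_amp 0 (u * complex_of_real x) - gauss_const) \<le> C / x ^ 3"
      using eventually_gt_at_top[of 0] by eventually_elim (use * in auto)
    show "((\<lambda>x. C / x ^ 3) \<longlongrightarrow> 0) at_top" by real_asymp
  qed
  show "((\<lambda>x. airy_amp 2 (u * complex_of_real x)) \<longlongrightarrow> 0) at_top"
  proof (rule Lim_null_comparison)
    show "\<forall>\<^sub>F x in at_top. norm (airy_amp 2 (u * complex_of_real x)) \<le> C / x"
      using eventually_gt_at_top[of 0] by eventually_elim (use * in auto)
    show "((\<lambda>x. C / x) \<longlongrightarrow> 0) at_top" by real_asymp
  qed
qed

text \<open>The Wronskian is constant because the equation has no first-order term. Its value is the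
  limit along the positive real axis, where the amplitudes converge.\<close>

lemma wronskian_U_V1:
  assumes z: "z \<in> airy_sector 0"
  shows "airy_U z * airy_V1' z - airy_U' z * airy_V1 z = 2 * gauss_const\<^sup>2"
proof -
  let ?W = "\<lambda>z. airy_U z * airy_V1' z - airy_U' z * airy_V1 z"
  have "(?W has_field_derivative 0) (at z)" if "z \<in> airy_sector 0" for z
  proof -
    note U = DERIV_airy_U[OF that order_refl] and V = DERIV_airy_V1[OF that order_refl]
    show ?thesis
      using DERIV_diff[OF DERIV_mult[OF U(1) V(2)] DERIV_mult[OF U(2) V(1)]]
      by (rule back_subst[where P = "\<lambda>D. (_ has_field_derivative D) _"]) (simp add: algebra_simps)
  qed
  then obtain c where c: "\<And>z. z \<in> airy_sector 0 \<Longrightarrow> ?W z = c"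
    using constant_on_airy_sector by blast
  let ?f = "\<lambda>x. 2 * airy_amp 0 (1 * complex_of_real x) * airy_amp 0 (third_root * complex_of_real x)
       + (airy_amp 2 (1 * complex_of_real x) * airy_amp 0 (third_root * complex_of_real x)
          - third_root * airy_amp 0 (1 * complex_of_real x) * airy_amp 2 (third_root * complex_of_real x))
         * complex_of_real (1 / (2 * x\<^sup>2))"
  have tr: "norm third_root = 1" "norm third_root \<le> 2 * Re third_root"
    unfolding third_root_simps(3) by (simp_all add: third_root_simps(1))
  have inv: "((\<lambda>x::real. complex_of_real (1 / (2 * x\<^sup>2))) \<longlongrightarrow> complex_of_real 0) at_top"
    by (intro tendsto_of_real) real_asymp
  have "(?f \<longlongrightarrow> 2 * gauss_const * gauss_const + (0 * gauss_const - third_root * gauss_const * 0) * complex_of_real 0) at_top"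
    by (intro tendsto_intros airy_amp_limits tr inv) auto
  then have 1: "(?f \<longlongrightarrow> 2 * gauss_const\<^sup>2) at_top" by (simp add: power2_eq_square mult.assoc)
  have "\<forall>\<^sub>F x in at_top. ?f x = c"
    using eventually_gt_at_top[of "0::real"]
  proof eventually_elim
    case (elim x)
    have s: "csqrt (complex_of_real (x\<^sup>2)) = complex_of_real x"
      using elim by (subst of_real_sqrt[symmetric]) auto
    have "complex_of_real (x\<^sup>2) \<in> airy_sector 0"
      using elim by (intro real_in_airy_sector) auto
    from c[OF this] show ?case
      using airy_product(3)[of "complex_of_real (x\<^sup>2)"] elim unfolding s by simp
  qed
  then have "(?f \<longlongrightarrow> c) at_top" by (rule tendsto_eventually)
  then have "c = 2 * gauss_const\<^sup>2" using 1 by (intro tendsto_unique) (auto simp del: of_real_divide)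
  then show ?thesis using c[OF z] by simp
qed

lemma wronskian_U_V2:
  assumes z: "z \<in> airy_sector 0"
  shows "airy_U z * airy_V2' z - airy_U' z * airy_V2 z = 2 * gauss_const\<^sup>2"
proof -
  have z': "cnj z \<in> airy_sector 0" using z by (simp add: airy_sector_cnj)
  have "cnj (airy_U z * airy_V2' z - airy_U' z * airy_V2 z) = 2 * gauss_const\<^sup>2"
    using wronskian_U_V1[OF z'] by (simp add: airy_cnj[OF z order_refl])
  then have "cnj (cnj (airy_U z * airy_V2' z - airy_U' z * airy_V2 z)) = cnj (2 * gauss_const\<^sup>2)"
    by (simp only:)
  then show ?thesis by (simp add: gauss_const_def)
qed

text \<open>The average of the two conjugate dominant solutions is real on the real axis, which makes the
  quantisation function below real there.\<close>

definition airy_V :: "complex \<Rightarrow> complex" where "airy_V z = (airy_V1 z + airy_V2 z) / 2"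
definition airy_V' :: "complex \<Rightarrow> complex" where "airy_V' z = (airy_V1' z + airy_V2' z) / 2"

lemma DERIV_airy_V:
  assumes z: "z \<in> airy_sector R" "R \<ge> 0"
  shows "(airy_V has_field_derivative airy_V' z) (at z)"
    "(airy_V' has_field_derivative z * airy_V z) (at z)"
  using DERIV_cdivide[OF DERIV_add[OF DERIV_airy_V1(1)[OF z] DERIV_airy_V2(1)[OF z]], of 2]
    DERIV_cdivide[OF DERIV_add[OF DERIV_airy_V1(2)[OF z] DERIV_airy_V2(2)[OF z]], of 2]
  by (simp_all add: airy_V_def[abs_def] airy_V'_def[abs_def] algebra_simps)

lemma airy_V_cnj:
  assumes "z \<in> airy_sector R" "R \<ge> 0"
  shows "airy_V (cnj z) = cnj (airy_V z)"
  by (simp add: airy_V_def airy_cnj[OF assms] add.commute)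

lemma wronskian_U_V:
  assumes z: "z \<in> airy_sector 0"
  shows "airy_U z * airy_V' z - airy_U' z * airy_V z = 2 * gauss_const\<^sup>2"
  using wronskian_U_V1[OF z] wronskian_U_V2[OF z]
  by (simp add: airy_V_def airy_V'_def field_simps)

section \<open>The quotient of the dominant and the recessive solution\<close>

text \<open>The quotient of solutions with its leading exponential removed; it is close to 1, and
  its logarithm is the small correction in the quantisation condition.\<close>

definition airy_K :: "complex \<Rightarrow> complex" where
  "airy_K z = airy_V z / airy_U z * exp (- (4/3 * csqrt z ^ 3))"

text \<open>The size of U relative to V at leading order, that is the Stokes term. It reaches 1 on
  the boundary rays of the sector.\<close>

definition airy_E :: "complex \<Rightarrow> real" where
  "airy_E z = exp (- (4/3 * Re (csqrt z ^ 3)))"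

lemma airy_K_cnj:
  assumes "z \<in> airy_sector R" "R \<ge> 0"
  shows "airy_K (cnj z) = cnj (airy_K z)" "airy_E (cnj z) = airy_E z"
proof -
  have c: "csqrt (cnj z) = cnj (csqrt z)" using csqrt_airy_sector[OF assms] by (simp add: cnj_csqrt)
  show "airy_K (cnj z) = cnj (airy_K z)"
    by (simp add: airy_K_def airy_V_cnj[OF assms] airy_cnj[OF assms] exp_cnj c)
  have "Re (cnj (csqrt z) ^ 3) = Re (csqrt z ^ 3)"
    by (simp only: complex_cnj_power[symmetric] cnj.sel)
  then show "airy_E (cnj z) = airy_E z" by (simp only: airy_E_def c)
qed

text \<open>The solutions \<open>airy_V1\<close> and \<open>airy_V2\<close> have the same Wronskian
  with \<open>airy_U\<close>, so they differ by a constant multiple b of it and V = V1 - (b/2) U.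
  The first error term comes from the amplitudes, the second from this admixture of U. By the
  Wronskian the logarithmic derivative of V / U is a constant over U V, so no asymptotic expansion
  has to be differentiated.\<close>

lemma airy_K_estimates:
  obtains R C c where "R \<ge> 1" "C > 0" "c > 0"
    "\<And>z. z \<in> airy_sector R \<Longrightarrow> airy_U z \<noteq> 0"
    "\<And>z. \<lbrakk>z \<in> airy_sector R; airy_E z \<le> c\<rbrakk> \<Longrightarrow> airy_V z \<noteq> 0"
    "\<And>z. \<lbrakk>z \<in> airy_sector R; airy_E z \<le> c\<rbrakk> \<Longrightarrow>
       norm (airy_K z - 1) \<le> C * (1 / norm (csqrt z) ^ 3 + airy_E z)"
    "\<And>z. \<lbrakk>z \<in> airy_sector R; airy_E z \<le> c\<rbrakk> \<Longrightarrow>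
       norm (2 * gauss_const\<^sup>2 / (airy_U z * airy_V z) - 2 * csqrt z)
         \<le> C * (1 / (norm (csqrt z))\<^sup>2 + norm (csqrt z) * airy_E z)"
proof -
  obtain C0 where C0: "C0 > 0"
    "\<And>r. \<lbrakk>r \<noteq> 0; norm r \<le> 2 * Re r\<rbrakk> \<Longrightarrow> norm (gauss_int (1/3) 0 r * csqrt r - gauss_const) \<le> C0 / norm r ^ 3"
    "\<And>r. \<lbrakk>r \<noteq> 0; norm r \<le> 2 * Re r\<rbrakk> \<Longrightarrow> norm (gauss_int (1/3) 2 r * csqrt r) \<le> C0 / norm r"
    by (rule gauss_int_asymptotics) (rule that)
  define G where "G r = airy_amp 0 r / gauss_const" for r
  define C1 where "C1 = C0 / norm gauss_const"
  have C1: "C1 > 0" using C0 gauss_const_pos by (simp add: C1_def)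
  have G1: "norm (G r - 1) \<le> C1 / norm r ^ 3" if "r \<noteq> 0" "norm r \<le> 2 * Re r" for r
  proof -
    have "norm (G r - 1) = norm (airy_amp 0 r - gauss_const) / norm gauss_const"
      using gauss_const_pos(2) by (simp add: G_def field_simps flip: norm_divide)
    also have "\<dots> \<le> C0 / norm r ^ 3 / norm gauss_const"
      using C0(2)[OF that] by (intro divide_right_mono) (auto simp: airy_amp_def)
    finally show ?thesis by (simp add: C1_def mult.commute)
  qed
  \<comment> \<open>Large enough to keep the normalised amplitudes within 1/4 of 1.\<close>
  define R where "R = 4 * C1 + 1"
  have R: "R \<ge> 1" "R \<ge> 0" using C1 by (auto simp: R_def)
  have big: "C1 / norm (csqrt z) ^ 3 \<le> 1 / 4" "norm (csqrt z) \<ge> 1" if "z \<in> airy_sector R" for z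
  proof -
    define t where "t = norm (csqrt z)"
    have t2: "R \<le> t\<^sup>2" using csqrt_airy_sector(4)[OF that R(2)] by (simp add: t_def)
    then have "1\<^sup>2 \<le> t\<^sup>2" using R by simp
    then have t1: "t \<ge> 1" by (rule power2_le_imp_le) (simp add: t_def)
    have "t\<^sup>2 \<le> t ^ 3" using t1 by (intro power_increasing) auto
    then have "4 * C1 \<le> t ^ 3" using t2 by (simp add: R_def)
    then show "C1 / norm (csqrt z) ^ 3 \<le> 1 / 4" "norm (csqrt z) \<ge> 1"
      unfolding t_def[symmetric] using t1 by (simp_all add: divide_simps)
  qed
  have Gr: "norm (G (csqrt z) - 1) \<le> C1 / norm (csqrt z) ^ 3" "G (csqrt z) \<noteq> 0" if "z \<in> airy_sector R" for z
  proof -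
    note c = csqrt_airy_sector[OF that R(2)]
    show *: "norm (G (csqrt z) - 1) \<le> C1 / norm (csqrt z) ^ 3"
      by (intro G1 c norm_le_2_Re)
    show "G (csqrt z) \<noteq> 0" using order.trans[OF * big(1)[OF that]] by auto
  qed
  have U0: "airy_U z \<noteq> 0" if z: "z \<in> airy_sector R" for z
    using Gr(2)[OF z] by (auto simp: G_def airy_amp_def airy_U_def airy_r_def)
  have sub: "airy_sector R \<subseteq> airy_sector 0" using R by (auto simp: airy_sector_def)
  obtain b where b: "\<And>z. z \<in> airy_sector R \<Longrightarrow> (airy_V1 z - airy_V2 z) / airy_U z = b"
  proof (rule constant_on_airy_sector[of R "\<lambda>z. (airy_V1 z - airy_V2 z) / airy_U z"])
    fix z assume z: "z \<in> airy_sector R"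
    have "((\<lambda>z. (airy_V1 z - airy_V2 z) / airy_U z) has_field_derivative
       ((airy_V1' z - airy_V2' z) * airy_U z - (airy_V1 z - airy_V2 z) * airy_U' z) / (airy_U z * airy_U z)) (at z)"
      by (intro DERIV_divide DERIV_diff DERIV_airy_V1(1)[OF z R(2)] DERIV_airy_V2(1)[OF z R(2)]
          DERIV_airy_U(1)[OF z R(2)] U0 z)
    moreover have "(airy_V1' z - airy_V2' z) * airy_U z - (airy_V1 z - airy_V2 z) * airy_U' z = 0"
      using wronskian_U_V1[of z] wronskian_U_V2[of z] z sub by (auto simp: algebra_simps)
    ultimately show "((\<lambda>z. (airy_V1 z - airy_V2 z) / airy_U z) has_field_derivative 0) (at z)"
      by simp
  qed blast
  \<comment> \<open>The bound \<open>c\<close> limits the admixture \<open>q\<close> below to 1/4.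
    The factor 32 in \<open>C\<close> is 2 * 4 / (1/4), from the estimate of
    \<open>2 * r * (1 - p) / p\<close>.\<close>
  define c where "c = 1 / (4 * (norm b + 1))"
  define C where "C = 32 * (C1 + norm b + 1)"
  have cpos: "c > 0" and Cpos: "C > 0" using C1 by (auto simp: c_def C_def intro!: add_pos_nonneg add_nonneg_pos)
  have upper: "airy_V z \<noteq> 0 \<and> norm (airy_K z - 1) \<le> C * (1 / norm (csqrt z) ^ 3 + airy_E z) \<and>
      norm (2 * gauss_const\<^sup>2 / (airy_U z * airy_V z) - 2 * csqrt z)
         \<le> C * (1 / (norm (csqrt z))\<^sup>2 + norm (csqrt z) * airy_E z)"
    if z: "z \<in> airy_sector R" and E: "airy_E z \<le> c" and Im: "Im (csqrt z) \<ge> 0" for z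
  proof -
    define r where "r = csqrt z"
    define e where "e = airy_E z"
    have e0: "e \<ge> 0" by (simp add: e_def airy_E_def)
    define g g' where "g = G r" and "g' = G (third_root * r)"
    define d where "d = C1 / norm r ^ 3"
    note cs = csqrt_airy_sector[OF z R(2), folded r_def]
    have d: "d \<le> 1 / 4" "norm r \<ge> 1" "d \<ge> 0" using big[OF z] C1 by (auto simp: d_def r_def)
    have g: "norm (g - 1) \<le> d" using Gr[OF z] by (simp add: g_def d_def r_def)
    have "norm (G (third_root * r) - 1) \<le> C1 / norm (third_root * r) ^ 3"
      using third_root_times_cone[of r] Im cs(1,5) third_root_simps(4) by (intro G1) (auto simp: r_def)
    then have g': "norm (g' - 1) \<le> d" by (simp add: g'_def d_def norm_mult third_root_simps(3))
    have ng: "norm g \<ge> 3 / 4" "norm g' \<ge> 3 / 4" "norm g \<le> 5 / 4"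
      using g g' d norm_triangle_ineq2[of 1 "1 - g"] norm_triangle_ineq2[of 1 "1 - g'"]
        norm_triangle_ineq2[of g 1] by (auto simp: norm_minus_commute)
    have gz: "g \<noteq> 0" "g' \<noteq> 0" using ng by auto
    have amp: "airy_amp 0 r = gauss_const * g" "airy_amp 0 (third_root * r) = gauss_const * g'"
      using gauss_const_pos(2) by (simp_all add: g_def g'_def G_def)
    have Uz: "airy_U z \<noteq> 0" by (rule U0[OF z])
    define x where "x = exp (- (4/3 * r ^ 3))"
    have nx: "norm x = e" by (simp add: x_def e_def airy_E_def r_def)
    have xx: "exp (4/3 * r ^ 3) * x = 1" by (simp add: x_def flip: exp_add)
    have xz: "x \<noteq> 0" by (simp add: x_def)
    have UV1: "airy_U z * airy_V1 z = gauss_const\<^sup>2 * g * g' / r"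
      using airy_product(1)[of z] cs(1) by (simp add: amp power2_eq_square flip: r_def)
    have V1: "airy_V1 z * x = g' / g * airy_U z"
    proof -
      note h = airy_product(2)[of z, folded r_def, OF cs(1), unfolded amp]
      have "airy_V1 z * (gauss_const * g) * x = (exp (4/3 * r ^ 3) * x) * (gauss_const * g') * airy_U z"
        unfolding h by (simp only: mult_ac)
      then show ?thesis using gz gauss_const_pos(2) unfolding xx by (simp add: field_simps)
    qed
    have V: "airy_V z = airy_V1 z - b / 2 * airy_U z"
      using b[OF z] Uz by (simp add: airy_V_def field_simps)
    have K: "airy_K z = g' / g - b / 2 * x"
    proof -
      have "airy_K z = (airy_V1 z * x - b / 2 * x * airy_U z) / airy_U z"
        by (simp add: airy_K_def V x_def r_def algebra_simps)
      then show ?thesis unfolding V1 left_diff_distrib[symmetric] using Uz by simp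
    qed
    have "norm (g' / g - 1) = norm ((g' - 1) - (g - 1)) / norm g"
      using gz by (simp add: field_simps flip: norm_divide)
    also have "\<dots> \<le> (2 * d) / (3 / 4)"
      using g g' ng norm_triangle_ineq4[of "g' - 1" "g - 1"] d by (intro frac_le) auto
    finally have gg: "norm (g' / g - 1) \<le> 3 * d" using d by simp
    have "norm (airy_K z - 1) \<le> norm (g' / g - 1) + norm (b / 2 * x)"
      unfolding K using norm_triangle_ineq4[of "g' / g - 1" "b / 2 * x"] by (simp add: algebra_simps)
    also have "\<dots> \<le> 3 * C1 * (1 / norm r ^ 3) + norm b * e"
    proof -
      have "norm (b / 2 * x) = norm b * e / 2" by (simp add: norm_mult norm_divide nx)
      moreover have "norm b * e \<ge> 0" by (simp add: e_def airy_E_def)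
      ultimately show ?thesis using gg by (simp add: d_def)
    qed
    also have "\<dots> \<le> C * (1 / norm r ^ 3) + C * e"
      using C1 by (intro add_mono mult_right_mono) (auto simp: C_def e_def airy_E_def)
    finally have r1: "norm (airy_K z - 1) \<le> C * (1 / norm r ^ 3 + e)" by (simp add: algebra_simps)
    \<comment> \<open>The share of U in V relative to V1, so that V = V1 (1 - q).\<close>
    define q where "q = b / 2 * x * g / g'"
    have nq: "norm q \<le> norm b * e"
    proof -
      have "norm q = norm b / 2 * e * (norm g / norm g')" by (simp add: q_def norm_mult norm_divide nx)
      also have "\<dots> \<le> norm b / 2 * e * 2"
        using ng by (intro mult_left_mono) (auto simp: divide_simps e_def airy_E_def)
      finally show ?thesis by simp
    qed
    have "norm b * e \<le> norm b * c" using E by (intro mult_left_mono) (auto simp: e_def)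
    also have "\<dots> \<le> 1 / 4"
      using norm_ge_zero[of b] by (simp add: c_def divide_simps del: norm_ge_zero)
    finally have nq4: "norm q \<le> 1 / 4" using nq by linarith
    have nq1: "norm (1 - q) \<ge> 3 / 4" using norm_triangle_ineq2[of 1 q] nq4 by simp
    then have q1: "1 - q \<noteq> 0" by auto
    have Vq: "airy_V z = airy_V1 z * (1 - q)"
    proof -
      have "airy_V1 z * q = b / 2 * (airy_V1 z * x) * g / g'" by (simp add: q_def)
      also have "\<dots> = b / 2 * airy_U z" unfolding V1 using gz by simp
      finally show ?thesis by (simp add: V algebra_simps)
    qed
    have UV: "airy_U z * airy_V z = gauss_const\<^sup>2 * g * g' * (1 - q) / r"
      unfolding Vq mult.assoc[symmetric] UV1 by simp
    then have "airy_U z * airy_V z \<noteq> 0" using gz q1 cs(5) gauss_const_pos(2) by simp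
    then have Vz: "airy_V z \<noteq> 0" by simp
    define p where "p = g * g' * (1 - q)"
    have np: "norm p \<ge> 1 / 4"
    proof -
      have "(3/4) * (3/4) * (3/4) \<le> norm g * norm g' * norm (1 - q)"
        using ng nq1 by (intro mult_mono) auto
      then show ?thesis by (simp add: p_def norm_mult)
    qed
    have p1: "norm (1 - p) \<le> 4 * d + 2 * norm b * e"
    proof -
      have pq: "1 - p = (1 - g) + g * (1 - g') + g * g' * q" by (simp add: p_def algebra_simps)
      have "norm (1 - p) \<le> norm (1 - g) + norm g * norm (1 - g') + norm g * norm g' * norm q"
        unfolding pq using norm_triangle_ineq[of "(1 - g) + g * (1 - g')" "g * g' * q"]
          norm_triangle_ineq[of "1 - g" "g * (1 - g')"] by (simp add: norm_mult)
      also have "norm g' \<le> 5 / 4" using g' d norm_triangle_ineq2[of g' 1] by simp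
      then have "norm (1 - g) + norm g * norm (1 - g') + norm g * norm g' * norm q
          \<le> d + 5/4 * d + 5/4 * (5/4) * (norm b * e)"
        using g g' ng nq d e0 by (intro add_mono mult_mono) (auto simp: norm_minus_commute)
      also have "\<dots> \<le> 4 * d + 2 * norm b * e"
      proof -
        have "norm b * e \<ge> 0" by (simp add: e_def airy_E_def)
        then show ?thesis using d by simp
      qed
      finally show ?thesis .
    qed
    have pz: "p \<noteq> 0" using np by auto
    have "2 * gauss_const\<^sup>2 / (airy_U z * airy_V z) - 2 * r = 2 * r * (1 - p) / p"
      unfolding UV using gauss_const_pos(2) cs(5) pz gz q1 by (simp add: p_def field_simps)
    also have "norm \<dots> = 2 * norm r * norm (1 - p) / norm p" by (simp add: norm_mult norm_divide)
    also have "\<dots> \<le> 2 * norm r * (4 * d + 2 * norm b * e) / (1 / 4)"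
      using p1 np order.trans[OF norm_ge_zero p1] by (intro frac_le mult_left_mono mult_nonneg_nonneg) auto
    also have "\<dots> = 32 * C1 * (1 / (norm r)\<^sup>2) + 16 * norm b * (norm r * e)"
      using d(2) by (simp add: d_def field_simps eval_nat_numeral)
    also have "\<dots> \<le> C * (1 / (norm r)\<^sup>2) + C * (norm r * e)"
      using C1 by (intro add_mono mult_right_mono) (auto simp: C_def e_def airy_E_def)
    finally have r2: "norm (2 * gauss_const\<^sup>2 / (airy_U z * airy_V z) - 2 * r) \<le> C * (1 / (norm r)\<^sup>2 + norm r * e)"
      by (simp add: algebra_simps)
    show ?thesis using Vz r1 r2 by (simp add: r_def e_def)
  qed
  have all: "airy_V z \<noteq> 0 \<and> norm (airy_K z - 1) \<le> C * (1 / norm (csqrt z) ^ 3 + airy_E z) \<and>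
      norm (2 * gauss_const\<^sup>2 / (airy_U z * airy_V z) - 2 * csqrt z)
         \<le> C * (1 / (norm (csqrt z))\<^sup>2 + norm (csqrt z) * airy_E z)"
    if z: "z \<in> airy_sector R" and E: "airy_E z \<le> c" for z
  proof (cases "Im (csqrt z) \<ge> 0")
    case True
    then show ?thesis using upper[OF z E] by blast
  next
    case False
    \<comment> \<open>Reflection exchanges V1 and V2 but preserves their average, so the estimate
      for the upper half transfers.\<close>
    have cs: "csqrt (cnj z) = cnj (csqrt z)" using csqrt_airy_sector[OF z R(2)] by (simp add: cnj_csqrt)
    have z': "cnj z \<in> airy_sector R" using z by (simp add: airy_sector_cnj)
    have "Im (csqrt (cnj z)) \<ge> 0" unfolding cs using False by simp
    with upper[OF z'] E
    have *: "airy_V (cnj z) \<noteq> 0 \<and> norm (airy_K (cnj z) - 1) \<le> C * (1 / norm (csqrt (cnj z)) ^ 3 + airy_E (cnj z)) \<and>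
      norm (2 * gauss_const\<^sup>2 / (airy_U (cnj z) * airy_V (cnj z)) - 2 * csqrt (cnj z))
         \<le> C * (1 / (norm (csqrt (cnj z)))\<^sup>2 + norm (csqrt (cnj z)) * airy_E (cnj z))"
      using airy_K_cnj(2)[OF z R(2)] by simp
    have 1: "norm (cnj (airy_K z) - 1) = norm (airy_K z - 1)"
      by (metis complex_cnj_diff complex_cnj_one complex_mod_cnj)
    have "2 * gauss_const\<^sup>2 / (cnj (airy_U z) * cnj (airy_V z)) - 2 * cnj (csqrt z)
      = cnj (2 * gauss_const\<^sup>2 / (airy_U z * airy_V z) - 2 * csqrt z)"
      by (simp add: gauss_const_def)
    then have 2: "norm (2 * gauss_const\<^sup>2 / (cnj (airy_U z) * cnj (airy_V z)) - 2 * cnj (csqrt z))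
      = norm (2 * gauss_const\<^sup>2 / (airy_U z * airy_V z) - 2 * csqrt z)"
      by (metis complex_mod_cnj)
    show ?thesis
      using * unfolding cs airy_K_cnj[OF z R(2)] airy_V_cnj[OF z R(2)] airy_cnj(1)[OF z R(2)] 1 2
        complex_mod_cnj by simp
  qed
  show thesis using that[of R C c] R(1) cpos Cpos U0 all by blast
qed

section \<open>The boundary value problem\<close>

text \<open>An abstract fundamental system whose first member has no zeros. The equations hold with
  two-sided derivatives at the endpoints too, although \<open>bvp_solution\<close> demands them only
  inside; this is what allows boundary values to be taken.\<close>

locale airy_bvp =
  fixes \<epsilon> :: real and \<mu> :: complex and p q p' q' :: "real \<Rightarrow> complex" and w :: complex
  assumes eps: "\<epsilon> > 0"
    and p: "\<And>x. \<bar>x\<bar> \<le> 1 \<Longrightarrow> (p has_vector_derivative p' x) (at x)"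
      "\<And>x. \<bar>x\<bar> \<le> 1 \<Longrightarrow> (p' has_vector_derivative (\<i> / \<epsilon>) * (x - \<mu>) * p x) (at x)"
    and q: "\<And>x. \<bar>x\<bar> \<le> 1 \<Longrightarrow> (q has_vector_derivative q' x) (at x)"
      "\<And>x. \<bar>x\<bar> \<le> 1 \<Longrightarrow> (q' has_vector_derivative (\<i> / \<epsilon>) * (x - \<mu>) * q x) (at x)"
    and w: "\<And>x. \<bar>x\<bar> \<le> 1 \<Longrightarrow> p x * q' x - p' x * q x = w" "w \<noteq> 0"
    and pz: "\<And>x. \<bar>x\<bar> \<le> 1 \<Longrightarrow> p x \<noteq> 0"
begin

lemma continuous_pq: "continuous_on {-1..1} p" "continuous_on {-1..1} q"
  by (auto intro!: continuous_at_imp_continuous_on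
      has_vector_derivative_continuous[OF p(1)] has_vector_derivative_continuous[OF q(1)])

text \<open>The Wronskians of \<open>y\<close> with \<open>p\<close> and with \<open>q\<close> are
  constant on the open interval, and Cramer's rule recovers \<open>y\<close>. Continuity carries the
  identity to the endpoints.\<close>

lemma solution_in_span:
  assumes y: "bvp_solution \<epsilon> \<mu> (\<lambda>x. 0) y"
  obtains a b where "\<And>x. x \<in> {-1..1} \<Longrightarrow> y x = a * p x + b * q x"
proof -
  obtain y' y'' where y': "\<And>x. x \<in> {-1<..<1} \<Longrightarrow> (y has_vector_derivative y' x) (at x)"
    "\<And>x. x \<in> {-1<..<1} \<Longrightarrow> (y' has_vector_derivative y'' x) (at x)"
    "\<And>x. x \<in> {-1<..<1} \<Longrightarrow> - \<i> * complex_of_real \<epsilon> * y'' x = (complex_of_real x - \<mu>) * y x - 0"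
    using y unfolding bvp_solution_def by metis
  have yy: "y'' x = (\<i> / \<epsilon>) * (x - \<mu>) * y x" if "x \<in> {-1<..<1}" for x
  proof -
    have "(\<i> / \<epsilon>) * (- \<i> * complex_of_real \<epsilon> * y'' x) = (\<i> / \<epsilon>) * ((complex_of_real x - \<mu>) * y x)"
      using y'(3)[OF that] by simp
    then show ?thesis using eps by (simp add: mult.assoc)
  qed
  have const: "\<exists>c. \<forall>x\<in>{-1<..<1}. y x * r' x - y' x * r x = c"
    if r: "\<And>x. \<bar>x\<bar> \<le> 1 \<Longrightarrow> (r has_vector_derivative r' x) (at x)"
      "\<And>x. \<bar>x\<bar> \<le> 1 \<Longrightarrow> (r' has_vector_derivative (\<i> / \<epsilon>) * (x - \<mu>) * r x) (at x)" for r r'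
  proof -
    have "((\<lambda>x. y x * r' x - y' x * r x) has_vector_derivative 0) (at x within {-1<..<1})"
      if x: "x \<in> {-1<..<1}" for x
    proof -
      have x1: "\<bar>x\<bar> \<le> 1" using x by auto
      have "((\<lambda>x. y x * r' x - y' x * r x) has_vector_derivative
         (y x * ((\<i> / \<epsilon>) * (x - \<mu>) * r x) + y' x * r' x) - (y' x * r' x + y'' x * r x)) (at x)"
        by (intro has_vector_derivative_diff has_vector_derivative_mult y'(1,2) x r x1)
      then show ?thesis
        by (simp add: yy[OF x] has_vector_derivative_at_within algebra_simps)
    qed
    then obtain c where "\<And>x. x \<in> {-1<..<1} \<Longrightarrow> y x * r' x - y' x * r x = c"
      by (rule has_vector_derivative_zero_constant[OF convex_real_interval(8)]) (assumption | rule that)+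
    then show ?thesis by (intro exI ballI)
  qed
  obtain A where A: "\<And>x. x \<in> {-1<..<1} \<Longrightarrow> y x * q' x - y' x * q x = A" using const[OF q] by blast
  obtain B where B: "\<And>x. x \<in> {-1<..<1} \<Longrightarrow> y x * p' x - y' x * p x = B" using const[OF p] by blast
  let ?f = "\<lambda>x. y x - (A / w * p x + (- B / w) * q x)"
  have "?f x = 0" if x: "x \<in> {-1<..<1}" for x
  proof -
    have "A * p x - B * q x = y x * (p x * q' x - p' x * q x)"
      unfolding A[OF x, symmetric] B[OF x, symmetric] by (simp add: algebra_simps)
    also have "p x * q' x - p' x * q x = w" using w(1)[of x] x by auto
    finally have "A * p x - B * q x = y x * w" .
    then show ?thesis using w(2) by (simp add: field_simps)
  qed
  moreover have "continuous_on {-1..1} ?f"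
    using y by (intro continuous_intros continuous_pq) (auto simp: bvp_solution_def)
  moreover have "closure {-1<..<1::real} = {-1..1}" by simp
  ultimately have "?f x = 0" if "x \<in> {-1..1}" for x
    using continuous_constant_on_closure[of "{-1<..<1}" ?f 0] that by auto
  then show thesis using that[of "A / w" "- B / w"] by simp
qed

lemma bvp_solution_span:
  assumes "a * p (-1) + b * q (-1) = 0" "a * p 1 + b * q 1 = 0"
  shows "bvp_solution \<epsilon> \<mu> (\<lambda>x. 0) (\<lambda>x. a * p x + b * q x)"
  unfolding bvp_solution_def
proof (intro conjI exI ballI)
  show "continuous_on {-1..1} (\<lambda>x. a * p x + b * q x)" by (intro continuous_intros continuous_pq)
  fix x :: real assume "x \<in> {-1<..<1}"
  then have x: "\<bar>x\<bar> \<le> 1" by auto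
  show "((\<lambda>x. a * p x + b * q x) has_vector_derivative a * p' x + b * q' x) (at x)"
    by (intro has_vector_derivative_add has_vector_derivative_mult_right p q x)
  show "((\<lambda>x. a * p' x + b * q' x) has_vector_derivative
      a * ((\<i> / \<epsilon>) * (x - \<mu>) * p x) + b * ((\<i> / \<epsilon>) * (x - \<mu>) * q x)) (at x)"
    by (intro has_vector_derivative_add has_vector_derivative_mult_right p q x)
  show "- \<i> * complex_of_real \<epsilon> * (a * ((\<i> / \<epsilon>) * (x - \<mu>) * p x) + b * ((\<i> / \<epsilon>) * (x - \<mu>) * q x))
     = (complex_of_real x - \<mu>) * (a * p x + b * q x) - 0"
    using eps by (simp add: field_simps)
qed (use assms in auto)

lemma eigenfunction_form:
  assumes "eigenfunction \<epsilon> \<mu> y"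
  obtains b where "b \<noteq> 0" "\<And>x. x \<in> {-1..1} \<Longrightarrow> y x = b * (q x - q 1 / p 1 * p x)"
    "q (-1) / p (-1) = q 1 / p 1"
proof -
  have y: "bvp_solution \<epsilon> \<mu> (\<lambda>x. 0) y" "\<exists>x\<in>{-1..1}. y x \<noteq> 0"
    using assms by (auto simp: eigenfunction_def)
  obtain a b where ab: "\<And>x. x \<in> {-1..1} \<Longrightarrow> y x = a * p x + b * q x"
    using solution_in_span[OF y(1)] by blast
  have bc: "a * p (-1) + b * q (-1) = 0" "a * p 1 + b * q 1 = 0"
    using y(1) ab[of 1] ab[of "-1"] by (auto simp: bvp_solution_def)
  have b: "b \<noteq> 0"
  proof
    assume "b = 0"
    then have "a = 0" using bc pz[of 1] by simp
    then show False using \<open>b = 0\<close> ab y(2) by auto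
  qed
  have a: "a = - b * (q 1 / p 1)" "a = - b * (q (-1) / p (-1))"
    using bc pz[of 1] pz[of "-1"] by (simp_all add: field_simps add_eq_0_iff)
  show thesis
  proof
    show "b \<noteq> 0" by fact
    show "q (-1) / p (-1) = q 1 / p 1" using a b by (metis mult_cancel_left neg_equal_0_iff_equal)
    show "y x = b * (q x - q 1 / p 1 * p x)" if "x \<in> {-1..1}" for x
      using ab[OF that] by (simp only: a(1)) (simp add: algebra_simps)
  qed
qed

lemma eigenvalue_iff: "eigenvalue \<epsilon> \<mu> \<longleftrightarrow> q (-1) / p (-1) = q 1 / p 1"
proof
  assume "eigenvalue \<epsilon> \<mu>"
  then show "q (-1) / p (-1) = q 1 / p 1"
    unfolding eigenvalue_def using eigenfunction_form by blast
next
  assume h: "q (-1) / p (-1) = q 1 / p 1"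
  define a where "a = - (q 1 / p 1)"
  have "a * p (-1) + 1 * q (-1) = 0" "a * p 1 + 1 * q 1 = 0"
    using pz[of 1] pz[of "-1"] h by (simp_all add: a_def field_simps)
  then have sol: "bvp_solution \<epsilon> \<mu> (\<lambda>x. 0) (\<lambda>x. a * p x + 1 * q x)"
    by (rule bvp_solution_span)
  have "\<exists>x\<in>{-1..1}. a * p x + 1 * q x \<noteq> 0"
  proof (rule ccontr)
    assume "\<not> ?thesis"
    then have z: "a * p x + 1 * q x = 0" if "x \<in> {-1..1}" for x using that by blast
    \<comment> \<open>An identically vanishing combination would also have zero derivative at 0,
      making \<open>p\<close> and \<open>q\<close> proportional to first order there and
      contradicting \<open>w\<close> nonzero.\<close>
    have d: "((\<lambda>x. a * p x + 1 * q x) has_vector_derivative a * p' 0 + 1 * q' 0) (at 0)"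
      by (intro has_vector_derivative_add has_vector_derivative_mult_right p q) auto
    have "((\<lambda>x::real. 0) has_vector_derivative a * p' 0 + 1 * q' 0) (at 0)"
      by (rule has_vector_derivative_transform_within_open[OF d, of "{-1<..<1}"]) (use z in auto)
    moreover have "((\<lambda>x::real. 0) has_vector_derivative (0::complex)) (at 0)" by simp
    ultimately have "a * p' 0 + 1 * q' 0 = 0" by (rule vector_derivative_unique_at)
    then have "q' 0 = - a * p' 0" "q 0 = - a * p 0" using z[of 0] by (simp_all add: add_eq_0_iff)
    then have "w = 0" using w(1)[of 0] by simp
    then show False using w(2) by simp
  qed
  with sol show "eigenvalue \<epsilon> \<mu>" unfolding eigenvalue_def eigenfunction_def by blast
qed

text \<open>An associated function forces the bilinear square integral of the eigenfunction \<open>Y\<close> to vanish;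
  that integral is the increment of \<open>(x - \<mu>) Y\<^sup>2 + \<i> \<epsilon> Y'\<^sup>2\<close>.\<close>

lemma no_associated_function:
  assumes y: "eigenfunction \<epsilon> \<mu> y" and z: "bvp_solution \<epsilon> \<mu> y z"
  shows "(p 1)\<^sup>2 = (p (-1))\<^sup>2"
proof -
  obtain b where b: "b \<noteq> 0" "\<And>x. x \<in> {-1..1} \<Longrightarrow> y x = b * (q x - q 1 / p 1 * p x)"
    "q (-1) / p (-1) = q 1 / p 1"
    using eigenfunction_form[OF y] by blast
  define h where "h = q 1 / p 1"
  define Y where "Y x = b * (q x - h * p x)" for x
  define Y' where "Y' x = b * (q' x - h * p' x)" for x
  have Y: "(Y has_vector_derivative Y' x) (at x)"
    "(Y' has_vector_derivative (\<i> / \<epsilon>) * (x - \<mu>) * Y x) (at x)" if "\<bar>x\<bar> \<le> 1" for x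
  proof -
    show "(Y has_vector_derivative Y' x) (at x)" unfolding Y_def[abs_def] Y'_def
      by (intro has_vector_derivative_diff has_vector_derivative_mult_right p q that)
    have "(Y' has_vector_derivative b * ((\<i> / \<epsilon>) * (x - \<mu>) * q x - h * ((\<i> / \<epsilon>) * (x - \<mu>) * p x))) (at x)"
      unfolding Y'_def[abs_def]
      by (intro has_vector_derivative_diff has_vector_derivative_mult_right p q that)
    then show "(Y' has_vector_derivative (\<i> / \<epsilon>) * (x - \<mu>) * Y x) (at x)"
      by (rule back_subst[where P = "\<lambda>D. (Y' has_vector_derivative D) (at x)"])
        (simp add: Y_def right_diff_distrib diff_divide_distrib mult_ac)
  qed
  have yY: "y x = Y x" if "x \<in> {-1..1}" for x using b(2)[OF that] by (simp add: Y_def h_def)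
  have Y0: "Y 1 = 0" "Y (-1) = 0" using yY[of 1] yY[of "-1"] y by (auto simp: eigenfunction_def bvp_solution_def)
  obtain z' z'' where z': "\<And>x. x \<in> {-1<..<1} \<Longrightarrow> (z has_vector_derivative z' x) (at x)"
    "\<And>x. x \<in> {-1<..<1} \<Longrightarrow> (z' has_vector_derivative z'' x) (at x)"
    "\<And>x. x \<in> {-1<..<1} \<Longrightarrow> - \<i> * complex_of_real \<epsilon> * z'' x = (complex_of_real x - \<mu>) * z x - y x"
    using z unfolding bvp_solution_def by metis
  have zc: "continuous_on {-1..1} z" "z 1 = 0" "z (-1) = 0" using z by (auto simp: bvp_solution_def)
  have Yc: "continuous_on {-1..1} Y" "continuous_on {-1..1} Y'"
    by (auto intro!: continuous_at_imp_continuous_on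
        has_vector_derivative_continuous[OF Y(1)] has_vector_derivative_continuous[OF Y(2)])
  have zz: "z'' x = (\<i> / \<epsilon>) * ((x - \<mu>) * z x - Y x)" if "x \<in> {-1<..<1}" for x
  proof -
    have "(\<i> / \<epsilon>) * (- \<i> * complex_of_real \<epsilon> * z'' x) = (\<i> / \<epsilon>) * ((complex_of_real x - \<mu>) * z x - Y x)"
      using z'(3)[OF that] yY[of x] that by simp
    then show ?thesis using eps by (simp add: mult.assoc)
  qed
  have "compact ((\<lambda>x. (\<i> / \<epsilon>) * ((complex_of_real x - \<mu>) * z x - Y x)) ` {-1..1})"
    by (intro compact_continuous_image continuous_intros zc Yc) auto
  then obtain M where "\<forall>v\<in>(\<lambda>x. (\<i> / \<epsilon>) * ((complex_of_real x - \<mu>) * z x - Y x)) ` {-1..1}. norm v \<le> M"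
    using compact_imp_bounded bounded_iff by blast
  then have M: "norm ((\<i> / \<epsilon>) * ((complex_of_real x - \<mu>) * z x - Y x)) \<le> M" if "x \<in> {-1..1}" for x
    using that by blast
  \<comment> \<open>At the endpoints \<open>z\<close> is only known to be continuous, so its
    derivative might blow up there. The equation bounds z'' on the open interval and hence z', so
    that z' Y tends to zero at both ends.\<close>
  have z'_diff: "norm (z' x - z' 0) \<le> M * norm (x - 0)" if "x \<in> {-1<..<1}" for x
  proof (rule differentiable_bound[of "{-1<..<1}" z' "\<lambda>x h. h *\<^sub>R z'' x"])
    fix x :: real assume x: "x \<in> {-1<..<1}"
    show "(z' has_derivative (\<lambda>h. h *\<^sub>R z'' x)) (at x within {-1<..<1})"
      using z'(2)[OF x] by (simp add: has_vector_derivative_def has_derivative_at_withinI)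
    have zM: "norm (z'' x) \<le> M" using M[of x] x zz[OF x] by simp
    show "onorm (\<lambda>h. h *\<^sub>R z'' x) \<le> M"
    proof (rule onorm_le)
      show "norm (h *\<^sub>R z'' x) \<le> M * norm h" for h
        using mult_right_mono[OF zM, of "\<bar>h\<bar>"] by (simp add: mult.commute)
    qed
  qed (use that in auto)
  have zb: "norm (z' x) \<le> norm (z' 0) + \<bar>M\<bar>" if "x \<in> {-1<..<1}" for x
  proof -
    have "norm (z' x - z' 0) \<le> M * norm x" using z'_diff[OF that] by simp
    also have "\<dots> \<le> \<bar>M\<bar> * 1" using that by (intro mult_mono) auto
    finally show ?thesis using norm_triangle_ineq2[of "z' x" "z' 0"] by linarith
  qed
  \<comment> \<open>The Lagrange bracket of \<open>z\<close> and \<open>Y\<close> has derivative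
    (\<i> / \<epsilon>) times the square of Y; subtracting the explicit antiderivative leaves a
    constant.\<close>
  let ?H = "\<lambda>x::real. z x * Y' x - z' x * Y x - (\<i> / \<epsilon>) * ((x - \<mu>) * (Y x * Y x) + \<i> * \<epsilon> * (Y' x * Y' x))"
  have "(?H has_vector_derivative 0) (at x within {-1<..<1})" if x: "x \<in> {-1<..<1}" for x
  proof -
    have x1: "\<bar>x\<bar> \<le> 1" using x by auto
    have xm: "((\<lambda>x. complex_of_real x - \<mu>) has_vector_derivative (1 - 0)) (at x)"
      by (intro has_vector_derivative_diff has_vector_derivative_const)
         (auto intro!: derivative_eq_intros has_vector_derivative_of_real simp: has_vector_derivative_def scaleR_conv_of_real)
    have "(?H has_vector_derivative
       (z x * ((\<i> / \<epsilon>) * (x - \<mu>) * Y x) + z' x * Y' x) - (z' x * Y' x + z'' x * Y x)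
       - (\<i> / \<epsilon>) * (((x - \<mu>) * (Y x * Y' x + Y' x * Y x) + (1 - 0) * (Y x * Y x))
           + \<i> * \<epsilon> * (Y' x * ((\<i> / \<epsilon>) * (x - \<mu>) * Y x) + ((\<i> / \<epsilon>) * (x - \<mu>) * Y x) * Y' x))) (at x)"
      by (intro has_vector_derivative_diff has_vector_derivative_add has_vector_derivative_mult
          has_vector_derivative_mult_right z'(1,2) x Y x1 xm)
    also have "(z x * ((\<i> / \<epsilon>) * (x - \<mu>) * Y x) + z' x * Y' x) - (z' x * Y' x + z'' x * Y x)
       - (\<i> / \<epsilon>) * (((x - \<mu>) * (Y x * Y' x + Y' x * Y x) + (1 - 0) * (Y x * Y x))
           + \<i> * \<epsilon> * (Y' x * ((\<i> / \<epsilon>) * (x - \<mu>) * Y x) + ((\<i> / \<epsilon>) * (x - \<mu>) * Y x) * Y' x)) = 0"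
      unfolding zz[OF x] using eps by (simp add: field_simps)
    finally show ?thesis by (rule has_vector_derivative_at_within)
  qed
  then obtain c where c: "\<And>x. x \<in> {-1<..<1} \<Longrightarrow> ?H x = c"
    by (rule has_vector_derivative_zero_constant[OF convex_real_interval(8)]) (assumption | rule that)+
  \<comment> \<open>At both ends \<open>z\<close> and \<open>Y\<close> vanish, and the product of
    \<i> / \<epsilon> and \<i> \<epsilon> leaves the square of Y' with coefficient 1.\<close>
  have lim: "c = (Y' a)\<^sup>2" if a: "a = 1 \<or> a = -1" for a :: real
  proof -
    let ?F = "at a within {-1<..<1}"
    have nt: "?F \<noteq> bot" using a by (auto simp: trivial_limit_within islimpt_greaterThanLessThan1 islimpt_greaterThanLessThan2)
    have sub: "{-1<..<1} \<subseteq> {-1..1::real}" by auto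
    have a1: "a \<in> {-1..1}" using a by auto
    have t: "(z \<longlongrightarrow> z a) ?F" "(Y \<longlongrightarrow> Y a) ?F" "(Y' \<longlongrightarrow> Y' a) ?F"
      using zc Yc a1 tendsto_within_subset[OF _ sub] by (meson continuous_on_def)+
    have za: "z a = 0" "Y a = 0" using a zc Y0 by auto
    have "((\<lambda>x. z' x * Y x) \<longlongrightarrow> 0) ?F"
    proof (rule Lim_null_comparison)
      show "\<forall>\<^sub>F x in ?F. norm (z' x * Y x) \<le> (norm (z' 0) + \<bar>M\<bar>) * norm (Y x)"
        unfolding eventually_at_filter
        by (rule always_eventually) (auto simp: norm_mult intro!: mult_right_mono zb)
      show "((\<lambda>x. (norm (z' 0) + \<bar>M\<bar>) * norm (Y x)) \<longlongrightarrow> 0) ?F"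
        using tendsto_mult[OF tendsto_const tendsto_norm[OF t(2)]] za by simp
    qed
    moreover have "((\<lambda>x. complex_of_real x) \<longlongrightarrow> complex_of_real a) ?F"
      by (intro tendsto_of_real tendsto_ident_at)
    ultimately have "(?H \<longlongrightarrow> z a * Y' a - 0 - (\<i> / \<epsilon>) * ((a - \<mu>) * (Y a * Y a) + \<i> * \<epsilon> * (Y' a * Y' a))) ?F"
      by (intro tendsto_intros t)
    then have "(?H \<longlongrightarrow> (Y' a)\<^sup>2) ?F"
      using eps by (simp add: za power2_eq_square)
    moreover have "(?H \<longlongrightarrow> c) ?F"
    proof (rule tendsto_eventually)
      show "\<forall>\<^sub>F x in ?F. ?H x = c"
        unfolding eventually_at_filter by (rule always_eventually) (use c in blast)
    qed
    ultimately show ?thesis using nt tendsto_unique by blast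
  qed
  have Y1: "Y' x = b * w / p x" if "x = 1 \<or> x = -1" for x
  proof -
    have qx: "q x = h * p x" and x: "\<bar>x\<bar> \<le> 1" using that b(3) pz[of 1] pz[of "-1"] by (auto simp: h_def field_simps)
    have "Y' x * p x = b * (p x * q' x - p' x * q x)" by (simp add: Y'_def qx algebra_simps)
    then show ?thesis using w(1)[OF x] pz[OF x] by (simp add: field_simps)
  qed
  have "(Y' 1)\<^sup>2 = (Y' (-1))\<^sup>2" using lim[of 1] lim[of "-1"] by simp
  then show ?thesis using b(1) w(2) pz[of 1] pz[of "-1"]
    by (simp add: Y1 power_divide power_mult_distrib field_simps)
qed

text \<open>The derivative of q / p is w over the square of p, so the second assumption says that q
  / p has different slopes at the two endpoints: the characteristic equation has a nondegenerate
  root.\<close>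

lemma simple_eigenvalueI:
  assumes "eigenvalue \<epsilon> \<mu>" "(p 1)\<^sup>2 \<noteq> (p (-1))\<^sup>2"
  shows "simple_eigenvalue \<epsilon> \<mu>"
  unfolding simple_eigenvalue_def
proof (intro conjI allI impI notI)
  show "eigenvalue \<epsilon> \<mu>" by fact
  fix y z assume yz: "eigenfunction \<epsilon> \<mu> y \<and> eigenfunction \<epsilon> \<mu> z"
  obtain b where b: "b \<noteq> 0" "\<And>x. x \<in> {-1..1} \<Longrightarrow> y x = b * (q x - q 1 / p 1 * p x)"
    using eigenfunction_form yz by blast
  obtain b' where b': "\<And>x. x \<in> {-1..1} \<Longrightarrow> z x = b' * (q x - q 1 / p 1 * p x)"
    using eigenfunction_form yz by blast
  show "\<exists>c. \<forall>x\<in>{-1..1}. z x = c * y x"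
    by (rule exI[of _ "b' / b"]) (use b b' in auto)
next
  assume "\<exists>y z. eigenfunction \<epsilon> \<mu> y \<and> bvp_solution \<epsilon> \<mu> y z"
  then show False using no_associated_function assms(2) by blast
qed

end

section \<open>The logarithm of the quotient of solutions\<close>

text \<open>The Wronskian gives the logarithmic derivative of V / U, from which the derivative
  \<open>2 * csqrt z\<close> of the leading exponent is subtracted.\<close>

lemma DERIV_airy_K:
  assumes z: "z \<in> airy_sector R" "R \<ge> 0" and nz: "airy_U z \<noteq> 0" "airy_V z \<noteq> 0"
  shows "(airy_K has_field_derivative
     airy_K z * (2 * gauss_const\<^sup>2 / (airy_U z * airy_V z) - 2 * csqrt z)) (at z)"
proof -
  define r where "r = csqrt z"
  note cs = csqrt_airy_sector[OF z]
  have rz: "r \<noteq> 0" using cs(5) by (simp add: r_def)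
  have z0: "z \<in> airy_sector 0" using z by (auto simp: airy_sector_def)
  have d1: "((\<lambda>z. airy_V z / airy_U z) has_field_derivative
      (airy_V' z * airy_U z - airy_V z * airy_U' z) / (airy_U z * airy_U z)) (at z)"
    by (rule DERIV_divide[OF DERIV_airy_V(1)[OF z] DERIV_airy_U(1)[OF z] nz(1)])
  have "(csqrt has_field_derivative inverse (2 * r)) (at z)"
    unfolding r_def by (rule has_field_derivative_csqrt[OF cs(3)])
  then have "((\<lambda>z. exp (- (4/3 * csqrt z ^ 3))) has_field_derivative
      exp (- (4/3 * r ^ 3)) * - (4/3 * (of_nat 3 * (inverse (2 * r) * r ^ (3 - Suc 0))))) (at z)"
    unfolding r_def by (intro DERIV_fun_exp DERIV_minus DERIV_cmult DERIV_power)
  moreover have "- (4/3 * (of_nat 3 * (inverse (2 * r) * r ^ (3 - Suc 0)))) = - (2 * r)"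
    using rz by (simp add: field_simps power2_eq_square)
  ultimately have d2: "((\<lambda>z. exp (- (4/3 * csqrt z ^ 3))) has_field_derivative exp (- (4/3 * r ^ 3)) * (- (2 * r))) (at z)"
    by (simp only:)
  have w: "airy_V' z * airy_U z - airy_V z * airy_U' z = 2 * gauss_const\<^sup>2"
    using wronskian_U_V[OF z0] by (simp add: mult.commute)
  have "(airy_K has_field_derivative
     2 * gauss_const\<^sup>2 / (airy_U z * airy_U z) * exp (- (4/3 * r ^ 3))
      + exp (- (4/3 * r ^ 3)) * (- (2 * r)) * (airy_V z / airy_U z)) (at z)"
    unfolding airy_K_def[abs_def] using DERIV_mult[OF d1 d2] by (simp only: w r_def[symmetric])
  also have "2 * gauss_const\<^sup>2 / (airy_U z * airy_U z) * exp (- (4/3 * r ^ 3))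
      + exp (- (4/3 * r ^ 3)) * (- (2 * r)) * (airy_V z / airy_U z)
     = airy_V z / airy_U z * exp (- (4/3 * r ^ 3)) * (2 * gauss_const\<^sup>2 / (airy_U z * airy_V z) - 2 * r)"
    using nz by (simp add: divide_simps) (simp add: algebra_simps)
  finally show ?thesis by (simp only: airy_K_def[abs_def] r_def)
qed

section \<open>Rescaling and the geometry of the sector\<close>

lemma csqrt_divide_of_real:
  assumes "x > 0"
  shows "csqrt (s / complex_of_real x) = csqrt s / complex_of_real (sqrt x)"
proof -
  have "csqrt (s * complex_of_real (1 / x)) = csqrt s * csqrt (complex_of_real (1 / x))"
  proof (rule csqrt_mult)
    have "Arg (complex_of_real (1 / x)) = 0" using assms by (simp add: Arg_of_real)
    then show "Arg s + Arg (complex_of_real (1 / x)) \<in> {-pi<..pi}"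
      using mpi_less_Arg[of s] Arg_le_pi[of s] by simp
  qed
  then show ?thesis using assms
    by (simp add: of_real_sqrt[symmetric] real_sqrt_divide flip: of_real_divide) (simp add: divide_inverse)
qed

lemma sqrt_root3_cube: "\<epsilon> > 0 \<Longrightarrow> sqrt (root 3 \<epsilon>) ^ 3 = sqrt \<epsilon>"
  by (simp flip: real_sqrt_power)

text \<open>The dilation that turns \<epsilon> u'' = s u into the Airy equation.\<close>

definition scale :: "real \<Rightarrow> complex \<Rightarrow> complex" where
  "scale \<epsilon> s = s / complex_of_real (root 3 \<epsilon>)"

lemma csqrt_scale:
  assumes "\<epsilon> > 0"
  shows "csqrt (scale \<epsilon> s) = csqrt s / complex_of_real (sqrt (root 3 \<epsilon>))"
    "csqrt (scale \<epsilon> s) ^ 3 = csqrt s ^ 3 / complex_of_real (sqrt \<epsilon>)"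
proof -
  show 1: "csqrt (scale \<epsilon> s) = csqrt s / complex_of_real (sqrt (root 3 \<epsilon>))"
    using assms by (simp add: scale_def csqrt_divide_of_real)
  show "csqrt (scale \<epsilon> s) ^ 3 = csqrt s ^ 3 / complex_of_real (sqrt \<epsilon>)"
    unfolding 1 power_divide of_real_power[symmetric] sqrt_root3_cube[OF assms] ..
qed

text \<open>The horizontal distance of s from the rays Arg s = pi/3 and Arg s = - pi/3, on which the
  recessive and dominant exponentials have equal modulus.\<close>

definition sector_gap :: "complex \<Rightarrow> real" where
  "sector_gap s = Re s - \<bar>Im s\<bar> / sqrt 3"

text \<open>The gap keeps s away from the rays, the bound on \<open>Re s\<close> away from the
  turning point 0.\<close>

definition wkb_region :: "real \<Rightarrow> complex set" where
  "wkb_region m = {s. Re s > 1 / sqrt 3 \<and> sector_gap s > m}"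

lemma wkb_region_sector:
  assumes "s \<in> wkb_region m" "m \<ge> 0"
  shows "s \<in> airy_sector 0"
proof -
  have "0 < (Re s - \<bar>Im s\<bar> / sqrt 3) * sqrt 3"
    using assms by (auto simp: wkb_region_def sector_gap_def)
  then have "\<bar>Im s\<bar> < sqrt 3 * Re s" by (simp add: algebra_simps)
  then show ?thesis using assms by (auto simp: airy_sector_def wkb_region_def intro: less_trans[rotated])
qed

text \<open>The number 9/16 serves as a rational square slightly below 1 / sqrt 3.\<close>

lemma inv_sqrt3_bounds: "1 / sqrt 3 > (9/16::real)" "1 / sqrt 3 < (1::real)"
proof -
  have "sqrt 3 < 16 / (9::real)" by (rule real_less_lsqrt) (auto simp: power2_eq_square)
  then show "1 / sqrt 3 > (9/16::real)" by (simp add: field_simps)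
  show "1 / sqrt 3 < (1::real)" by simp
qed

text \<open>Both the decay exponent Re s^(3/2) and the gap vanish on the rays. Written in p and q
  they share the factor p - sqrt 3 q, which makes them comparable.\<close>

lemma Re_csqrt_cube_factor:
  defines "p \<equiv> \<lambda>s. Re (csqrt s)" and "q \<equiv> \<lambda>s. \<bar>Im (csqrt s)\<bar>"
  assumes s: "s \<in> airy_sector 0"
  shows "Re (csqrt s ^ 3) = p s * (p s - sqrt 3 * q s) * (p s + sqrt 3 * q s)"
    "sector_gap s = (p s - sqrt 3 * q s) * (p s + q s / sqrt 3)"
    "p s > 0" "sqrt 3 * q s < p s" "Re s = (p s)\<^sup>2 - (q s)\<^sup>2" "\<bar>Im s\<bar> = 2 * p s * q s" "p s \<ge> sqrt (Re s)"
proof -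
  define P Q where "P = Re (csqrt s)" and "Q = Im (csqrt s)"
  have cs: "csqrt s = Complex P Q" by (simp only: P_def Q_def complex_surj)
  have zz: "s = (Complex P Q)\<^sup>2" by (simp only: P_def Q_def complex_surj power2_csqrt)
  have pq: "p s = P" "q s = \<bar>Q\<bar>" by (simp_all only: p_def q_def P_def Q_def)
  show pos: "p s > 0" "sqrt 3 * q s < p s"
    using csqrt_airy_sector[OF s order_refl] by (simp_all only: p_def q_def)
  have s3: "sqrt 3 * sqrt 3 = (3::real)" by simp
  have QQ: "\<bar>Q\<bar> * \<bar>Q\<bar> = Q * Q" by simp
  show "Re (csqrt s ^ 3) = p s * (p s - sqrt 3 * q s) * (p s + sqrt 3 * q s)"
  proof -
    have "Re (csqrt s ^ 3) = P * (P * P - 3 * (Q * Q))"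
      unfolding cs by (simp add: power3_eq_cube algebra_simps)
    also have "\<dots> = P * (P * P - (sqrt 3 * sqrt 3) * (\<bar>Q\<bar> * \<bar>Q\<bar>))" by simp
    finally show ?thesis unfolding pq by (simp only: algebra_simps)
  qed
  show R: "Re s = (p s)\<^sup>2 - (q s)\<^sup>2" unfolding pq by (subst zz) (simp add: power2_eq_square)
  show I: "\<bar>Im s\<bar> = 2 * p s * q s" using pos(1) unfolding pq by (subst zz) (simp add: power2_eq_square abs_mult)
  show "sector_gap s = (p s - sqrt 3 * q s) * (p s + q s / sqrt 3)"
    unfolding sector_gap_def R I by (simp add: field_simps power2_eq_square)
  show "p s \<ge> sqrt (Re s)" using pos(1) unfolding R by (intro real_le_lsqrt) auto
qed

text \<open>After the common factor is cancelled, p \<ge> 3/4 suffices. The factor 3/4 compensates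
  4/3 in the exponent, so that the Stokes term is at most exp (- gap / sqrt \<epsilon>).\<close>

lemma Re_csqrt_cube_ge_gap:
  assumes s: "s \<in> wkb_region m" "m \<ge> 0"
  shows "Re (csqrt s ^ 3) \<ge> 3/4 * sector_gap s"
proof -
  note f = Re_csqrt_cube_factor[OF wkb_region_sector[OF s]]
  define p q where "p = Re (csqrt s)" and "q = \<bar>Im (csqrt s)\<bar>"
  note f = f[folded p_def q_def]
  have "sqrt (9/16) \<le> sqrt (Re s)" using s inv_sqrt3_bounds(1) by (auto simp: wkb_region_def)
  moreover have "sqrt (9/16) = (3/4::real)" by (rule real_sqrt_unique) (auto simp: power2_eq_square)
  ultimately have p34: "p \<ge> 3/4" using f(7) by linarith
  have q0: "q \<ge> 0" by (simp add: q_def)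
  have "q / sqrt 3 \<le> sqrt 3 * q" using q0 mult_nonneg_nonneg[of q 2] by (simp add: field_simps)
  then have "3/4 * ((p - sqrt 3 * q) * (p + q / sqrt 3)) \<le> p * ((p - sqrt 3 * q) * (p + sqrt 3 * q))"
    using p34 q0 f(4) by (intro mult_mono) auto
  then show ?thesis unfolding f(1,2) by (simp add: mult.assoc)
qed

text \<open>On the lines Im s = 1 and Im s = -1 the constant has to be sharp at the tip, since it
  determines the admissible \<theta>.\<close>

lemma Re_csqrt_cube_line:
  assumes "\<rho> > 1 / sqrt 3" "\<bar>y\<bar> = 1"
  shows "2/3 * Re (csqrt (Complex \<rho> y) ^ 3) \<ge> (3/4) powr (1/4) * (\<rho> - 1 / sqrt 3)"
proof -
  let ?s = "Complex \<rho> y"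
  have gap: "sector_gap ?s = \<rho> - 1 / sqrt 3" using assms by (simp add: sector_gap_def)
  have s: "?s \<in> wkb_region 0" using assms by (simp add: wkb_region_def gap)
  define p q where "p = Re (csqrt ?s)" and "q = \<bar>Im (csqrt ?s)\<bar>"
  note f = Re_csqrt_cube_factor[OF wkb_region_sector[OF s order_refl], folded p_def q_def]
  \<comment> \<open>The value of \<open>p\<close> at 1 / sqrt 3 + i, where p q = 1/2 and p = sqrt 3
    q.\<close>
  define a where "a = (3/4::real) powr (1/4)"
  have a: "a > 0" by (simp add: a_def)
  have "a\<^sup>2 = (3/4) powr (1/2)" unfolding a_def by (simp add: powr_power)
  also have "\<dots> = sqrt 3 / 2" by (simp add: powr_half_sqrt real_sqrt_divide)
  finally have a2: "a\<^sup>2 = sqrt 3 / 2" .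
  have pq: "p * q = 1/2" using f(6) assms(2) by simp
  have p0: "p > 0" and q0: "q \<ge> 0" using f(3) by (auto simp: q_def)
  have s3: "sqrt 3 * sqrt 3 = (3::real)" by simp
  have "a\<^sup>2 \<le> p\<^sup>2"
  proof -
    have "sqrt 3 * q * p \<le> p * p" using f(4) p0 by (intro mult_right_mono) auto
    then have "sqrt 3 * (p * q) \<le> p\<^sup>2" by (simp add: power2_eq_square mult_ac)
    then show ?thesis unfolding pq a2 by simp
  qed
  then have ap: "a \<le> p" using p0 by - (rule power2_le_imp_le, auto)
  \<comment> \<open>The required inequality is a cubic one in p with equality at p = a; the
    remaining quadratic factor is a sum of squares.\<close>
  have "0 \<le> (p - a) * ((p - a / 4)\<^sup>2 + 7/16 * a\<^sup>2)" using ap by (intro mult_nonneg_nonneg) auto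
  also have "\<dots> = (p * p\<^sup>2 + p * a\<^sup>2) - 3/2 * a * (p\<^sup>2 + a\<^sup>2 / 3)"
    by (simp add: power2_eq_square field_simps)
  finally have key: "3/2 * a * (p\<^sup>2 + a\<^sup>2 / 3) \<le> p * (p\<^sup>2 + a\<^sup>2)" by (simp add: algebra_simps)
  have "p * (p + sqrt 3 * q) = p\<^sup>2 + sqrt 3 * (p * q)"
    by (simp add: power2_eq_square algebra_simps)
  then have 1: "p * (p + sqrt 3 * q) = p\<^sup>2 + a\<^sup>2" by (simp add: pq a2)
  have "p * (p + q / sqrt 3) = p\<^sup>2 + (p * q) / sqrt 3"
    by (simp add: power2_eq_square algebra_simps)
  moreover have "(1/2) / sqrt 3 = (sqrt 3 / 2) / 3" by (simp add: field_simps)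
  ultimately have 2: "p * (p + q / sqrt 3) = p\<^sup>2 + a\<^sup>2 / 3" by (simp add: pq a2)
  have "p * (3/2 * a * (p + q / sqrt 3)) \<le> p * (p * (p + sqrt 3 * q))"
    using key unfolding 1[symmetric] 2[symmetric] by (simp add: mult_ac)
  then have 3: "3/2 * a * (p + q / sqrt 3) \<le> p * (p + sqrt 3 * q)"
    using p0 by (simp only: mult_le_cancel_left_pos)
  have "3/2 * a * sector_gap ?s = (p - sqrt 3 * q) * (3/2 * a * (p + q / sqrt 3))"
    unfolding f(2) by (simp only: mult_ac)
  also have "\<dots> \<le> (p - sqrt 3 * q) * (p * (p + sqrt 3 * q))"
    using 3 f(4) by (intro mult_left_mono) auto
  also have "\<dots> = Re (csqrt ?s ^ 3)" unfolding f(1) by (simp only: mult_ac)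
  finally have "3/2 * (a * (\<rho> - 1 / sqrt 3)) \<le> Re (csqrt ?s ^ 3)" unfolding gap by (simp only: mult.assoc)
  then show ?thesis unfolding a_def[symmetric] by linarith
qed

section \<open>The logarithmic correction after rescaling\<close>

definition qlog :: "real \<Rightarrow> complex \<Rightarrow> complex" where
  "qlog \<epsilon> s = ln (airy_K (scale \<epsilon> s))"

definition qlog' :: "real \<Rightarrow> complex \<Rightarrow> complex" where
  "qlog' \<epsilon> s = (2 * gauss_const\<^sup>2 / (airy_U (scale \<epsilon> s) * airy_V (scale \<epsilon> s)) - 2 * csqrt (scale \<epsilon> s))
     / complex_of_real (root 3 \<epsilon>)"

text \<open>The bound on the value keeps the exact Stokes exponent, which matters at the tip. For
  the derivative, where only smallness against the leading term counts, the cruder exponent given by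
  the gap suffices.\<close>

definition qlog_bounds :: "real \<Rightarrow> real \<Rightarrow> complex \<Rightarrow> bool" where
  "qlog_bounds C \<epsilon> s \<longleftrightarrow>
      airy_U (scale \<epsilon> s) \<noteq> 0 \<and> airy_V (scale \<epsilon> s) \<noteq> 0 \<and>
      (qlog \<epsilon> has_field_derivative qlog' \<epsilon> s) (at s) \<and>
      qlog \<epsilon> (cnj s) = cnj (qlog \<epsilon> s) \<and>
      airy_V (scale \<epsilon> s) / airy_U (scale \<epsilon> s) = exp (4/3 * csqrt s ^ 3 / complex_of_real (sqrt \<epsilon>) + qlog \<epsilon> s) \<and>
      norm (qlog \<epsilon> s) \<le> C * (sqrt \<epsilon> / norm (csqrt s) ^ 3 + exp (- (4/3 * Re (csqrt s ^ 3) / sqrt \<epsilon>))) \<and>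
      norm (qlog' \<epsilon> s) \<le> C * (1 / norm s + norm (csqrt s) / sqrt \<epsilon> * exp (- sector_gap s / sqrt \<epsilon>))"

lemma qlog_properties:
  obtains e1 c1 C where "e1 > 0" "c1 > 0" "C > 0"
    "\<And>\<epsilon> m s. \<lbrakk>0 < \<epsilon>; \<epsilon> < e1; m > 0; exp (- m / sqrt \<epsilon>) \<le> c1; s \<in> wkb_region m\<rbrakk> \<Longrightarrow>
      qlog_bounds C \<epsilon> s"
proof -
  obtain R C c where RC: "R \<ge> 1" "C > 0" "c > 0"
    and U: "\<And>z. z \<in> airy_sector R \<Longrightarrow> airy_U z \<noteq> 0"
    and V: "\<And>z. \<lbrakk>z \<in> airy_sector R; airy_E z \<le> c\<rbrakk> \<Longrightarrow> airy_V z \<noteq> 0"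
    and K: "\<And>z. \<lbrakk>z \<in> airy_sector R; airy_E z \<le> c\<rbrakk> \<Longrightarrow>
       norm (airy_K z - 1) \<le> C * (1 / norm (csqrt z) ^ 3 + airy_E z)"
    and P: "\<And>z. \<lbrakk>z \<in> airy_sector R; airy_E z \<le> c\<rbrakk> \<Longrightarrow>
       norm (2 * gauss_const\<^sup>2 / (airy_U z * airy_V z) - 2 * csqrt z)
         \<le> C * (1 / (norm (csqrt z))\<^sup>2 + norm (csqrt z) * airy_E z)"
    by (rule airy_K_estimates) (rule that)
  \<comment> \<open>The first entries of the two minima bound the Stokes term by \<open>c\<close>
    and place \<open>scale \<epsilon> s\<close> in \<open>airy_sector R\<close>. The second entries
    bound the two errors by 1/8 and 1/4, so \<open>airy_K\<close> stays within 3/8 of 1, away from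
    the cut of the logarithm.\<close>
  define c1 where "c1 = min c (1 / (8 * C))"
  define e1 where "e1 = min (1 / (2 * R) ^ 3) (1 / (16 * C)\<^sup>2)"
  show thesis
  proof (rule that[of e1 c1 "2 * C"])
    show "e1 > 0" "c1 > 0" "2 * C > 0" using RC by (auto simp: e1_def c1_def)
    fix \<epsilon> m :: real and s :: complex
    assume eps: "0 < \<epsilon>" "\<epsilon> < e1" and m: "m > 0" "exp (- m / sqrt \<epsilon>) \<le> c1" and s: "s \<in> wkb_region m"
    define z where "z = scale \<epsilon> s"
    define \<delta> where "\<delta> = root 3 \<epsilon>"
    have d0: "\<delta> > 0" using eps by (simp add: \<delta>_def)
    have d3: "\<delta> ^ 3 = \<epsilon>" using eps by (simp add: \<delta>_def)
    have "\<delta> ^ 3 \<le> (1 / (2 * R)) ^ 3" using eps by (simp add: d3 e1_def power_divide)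
    then have dR: "\<delta> \<le> 1 / (2 * R)" using RC(1) d0 power_mono_iff[of \<delta> "1 / (2 * R)" 3] by simp
    have s0: "s \<in> airy_sector 0" using wkb_region_sector[OF s] m by simp
    have zsec: "z \<in> airy_sector R"
    proof -
      have "R * \<delta> \<le> 1/2" using dR RC(1) by (simp add: field_simps)
      also have "\<dots> < Re s" using s inv_sqrt3_bounds(1) by (auto simp: wkb_region_def)
      finally have "R < Re s / \<delta>" using d0 by (simp add: field_simps)
      moreover have "\<bar>Im s\<bar> / \<delta> < sqrt 3 * Re s / \<delta>"
        using s0 d0 by (intro divide_strict_right_mono) (auto simp: airy_sector_def)
      ultimately show ?thesis using d0 by (simp add: airy_sector_def z_def scale_def \<delta>_def[symmetric])
    qed
    have R0: "R \<ge> 0" using RC by simp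
    define E where "E = exp (- (4/3 * Re (csqrt s ^ 3) / sqrt \<epsilon>))"
    have zE: "airy_E z = E" unfolding airy_E_def z_def csqrt_scale(2)[OF eps(1)] E_def by simp
    have gap: "sector_gap s > m" using s by (simp add: wkb_region_def)
    have Egap: "E \<le> exp (- sector_gap s / sqrt \<epsilon>)"
    proof -
      have "sector_gap s / sqrt \<epsilon> \<le> (4/3 * Re (csqrt s ^ 3)) / sqrt \<epsilon>"
        using Re_csqrt_cube_ge_gap[OF s] m eps by (intro divide_right_mono) auto
      then show ?thesis by (simp add: E_def)
    qed
    also have "\<dots> \<le> exp (- m / sqrt \<epsilon>)" using gap eps by (simp add: divide_right_mono)
    finally have Ec: "E \<le> c1" using m by simp
    then have Ec': "airy_E z \<le> c" "E \<le> 1 / (8 * C)" by (simp_all add: zE c1_def)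
    have Uz: "airy_U z \<noteq> 0" and Vz: "airy_V z \<noteq> 0" using U V zsec Ec' by auto
    have n3: "norm (csqrt z) ^ 3 = norm (csqrt s) ^ 3 / sqrt \<epsilon>"
      using arg_cong[OF csqrt_scale(2)[OF eps(1), of s], of norm] eps by (simp only: z_def norm_power norm_divide) simp
    have s1: "norm (csqrt s) ^ 3 \<ge> 1/4"
    proof -
      have "norm s \<ge> 9/16" using s inv_sqrt3_bounds(1) complex_Re_le_cmod[of s] by (auto simp: wkb_region_def)
      then have "sqrt (norm s) \<ge> sqrt (9/16)" by (rule real_sqrt_le_mono)
      moreover have "sqrt (9/16) = (3/4::real)" by (rule real_sqrt_unique) (auto simp: power2_eq_square)
      ultimately have "norm (csqrt s) \<ge> 3/4" by simp
      then have "norm (csqrt s) ^ 3 \<ge> (3/4) ^ 3" by (intro power_mono) auto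
      then show ?thesis by (simp add: eval_nat_numeral)
    qed
    have K1: "norm (airy_K z - 1) \<le> C * (sqrt \<epsilon> / norm (csqrt s) ^ 3 + E)"
      using K[OF zsec Ec'(1)] by (simp only: n3 zE) simp
    have "sqrt \<epsilon> \<le> 1 / (16 * C)"
      using eps RC(2) by (intro real_le_lsqrt) (auto simp: e1_def power_divide power_mult_distrib)
    then have "sqrt \<epsilon> / norm (csqrt s) ^ 3 \<le> (1 / (16 * C)) / (1/4)"
      using s1 eps RC(2) by (intro frac_le) auto
    then have "C * (sqrt \<epsilon> / norm (csqrt s) ^ 3 + E) \<le> C * (1 / (4 * C) + 1 / (8 * C))"
      using Ec'(2) RC(2) by (intro mult_left_mono add_mono) auto
    moreover have "C * (1 / (4 * C) + 1 / (8 * C)) = 3/8" using RC(2) by simp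
    ultimately have K2: "norm (airy_K z - 1) \<le> 3/8" using K1 by linarith
    have Kre: "Re (airy_K z) > 0"
      using K2 abs_Re_le_cmod[of "airy_K z - 1"] by simp
    then have Knn: "airy_K z \<notin> \<real>\<^sub>\<le>\<^sub>0" and Kz: "airy_K z \<noteq> 0" by (auto simp: complex_nonpos_Reals_iff)
    have "norm (ln (1 + (airy_K z - 1))) \<le> 2 * norm (airy_K z - 1)"
      using K2 by (intro norm_Ln_le) auto
    then have q1: "norm (qlog \<epsilon> s) \<le> 2 * C * (sqrt \<epsilon> / norm (csqrt s) ^ 3 + E)"
      using K1 by (simp add: qlog_def z_def)
    have zd: "((\<lambda>s. scale \<epsilon> s) has_field_derivative 1 / complex_of_real \<delta>) (at s)"
      unfolding scale_def \<delta>_def[symmetric] using DERIV_cdivide[OF DERIV_ident] by blast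
    have qd: "(qlog \<epsilon> has_field_derivative inverse (airy_K z) *
       (airy_K z * (2 * gauss_const\<^sup>2 / (airy_U z * airy_V z) - 2 * csqrt z) * (1 / complex_of_real \<delta>))) (at s)"
      unfolding qlog_def[abs_def] z_def
      by (rule DERIV_chain2[OF has_field_derivative_Ln])
        (use Knn DERIV_chain2[OF DERIV_airy_K[OF zsec[unfolded z_def] R0 Uz[unfolded z_def] Vz[unfolded z_def]] zd]
          in \<open>simp_all add: z_def\<close>)
    have q2: "(qlog \<epsilon> has_field_derivative qlog' \<epsilon> s) (at s)"
    proof -
      have "inverse (airy_K z) * (airy_K z * A * B) = A * B" for A B using Kz by simp
      then have eq: "inverse (airy_K z) *
         (airy_K z * (2 * gauss_const\<^sup>2 / (airy_U z * airy_V z) - 2 * csqrt z) * (1 / complex_of_real \<delta>))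
        = qlog' \<epsilon> s"
        by (simp only: qlog'_def z_def[symmetric] \<delta>_def[symmetric]) simp
      show ?thesis using qd unfolding eq .
    qed
    have "scale \<epsilon> (cnj s) = cnj z" by (simp add: scale_def z_def)
    then have q3: "qlog \<epsilon> (cnj s) = cnj (qlog \<epsilon> s)"
      using Knn by (simp add: qlog_def z_def[symmetric] airy_K_cnj[OF zsec R0] cnj_Ln)
    have q4: "airy_V z / airy_U z = exp (4/3 * csqrt s ^ 3 / complex_of_real (sqrt \<epsilon>) + qlog \<epsilon> s)"
    proof -
      have "exp (4/3 * csqrt s ^ 3 / complex_of_real (sqrt \<epsilon>) + qlog \<epsilon> s)
         = exp (4/3 * csqrt z ^ 3) * airy_K z"
        using Kz by (simp add: exp_add qlog_def z_def csqrt_scale(2)[OF eps(1)])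
      also have "\<dots> = airy_V z / airy_U z * (exp (4/3 * csqrt z ^ 3) * exp (- (4/3 * csqrt z ^ 3)))"
        by (simp add: airy_K_def)
      also have "exp (4/3 * csqrt z ^ 3) * exp (- (4/3 * csqrt z ^ 3)) = 1" by (simp flip: exp_add)
      finally show ?thesis by simp
    qed
    have n1: "norm (csqrt z) = norm (csqrt s) / sqrt \<delta>"
      using d0 unfolding z_def csqrt_scale(1)[OF eps(1)] norm_divide \<delta>_def[symmetric] by simp
    have sd: "\<delta> * sqrt \<delta> = sqrt \<epsilon>"
    proof -
      have "\<delta> * sqrt \<delta> = sqrt \<delta> ^ 3" using d0 by (simp add: power3_eq_cube)
      then show ?thesis using sqrt_root3_cube[OF eps(1)] by (simp add: \<delta>_def)
    qed
    have ns: "(norm (csqrt s))\<^sup>2 = norm s" by (simp flip: norm_power)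
    have sz: "norm s > 0" using s0 by (auto simp: airy_sector_def)
    have "norm (qlog' \<epsilon> s) = norm (2 * gauss_const\<^sup>2 / (airy_U z * airy_V z) - 2 * csqrt z) / \<delta>"
      using d0 by (simp add: qlog'_def z_def[symmetric] \<delta>_def[symmetric] norm_divide)
    also have "\<dots> \<le> C * (1 / (norm (csqrt z))\<^sup>2 + norm (csqrt z) * E) / \<delta>"
      using P[OF zsec Ec'(1)] d0 unfolding zE by (intro divide_right_mono) auto
    also have "\<dots> = C * (1 / norm s + norm (csqrt s) / (\<delta> * sqrt \<delta>) * E)"
      unfolding n1 power_divide ns using d0 sz by (simp add: field_simps)
    also have "\<dots> \<le> 2 * C * (1 / norm s + norm (csqrt s) / sqrt \<epsilon> * exp (- sector_gap s / sqrt \<epsilon>))"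
      unfolding sd using RC(2) Egap eps
      by (intro mult_mono add_mono mult_left_mono) (auto simp: E_def intro!: add_nonneg_nonneg)
    finally have q5: "norm (qlog' \<epsilon> s) \<le> 2 * C * (1 / norm s + norm (csqrt s) / sqrt \<epsilon> * exp (- sector_gap s / sqrt \<epsilon>))" .
    show "qlog_bounds (2 * C) \<epsilon> s"
      unfolding qlog_bounds_def using Uz Vz q1 q2 q3 q4 q5 by (simp only: z_def E_def simp_thms)
  qed
qed

section \<open>The quantisation function\<close>

text \<open>\<open>qdom m\<close> is \<open>D_dom\<close> in the variable \<open>\<sigma> = \<i> \<mu>\<close>, with \<open>m = depth \<theta> \<epsilon> - 1 / sqrt 3\<close>.\<close>

definition qdom :: "real \<Rightarrow> complex set" where
  "qdom m = {\<sigma>. \<bar>Im \<sigma>\<bar> < 1 \<and> (1 / sqrt 3 + m) * (1 + \<bar>Im \<sigma>\<bar>) < Re \<sigma>}"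

definition qfun :: "real \<Rightarrow> complex \<Rightarrow> complex" where
  "qfun \<epsilon> \<sigma> = ((4/3 * csqrt (\<sigma> + \<i>) ^ 3 / complex_of_real (sqrt \<epsilon>) + qlog \<epsilon> (\<sigma> + \<i>))
     - (4/3 * csqrt (\<sigma> - \<i>) ^ 3 / complex_of_real (sqrt \<epsilon>) + qlog \<epsilon> (\<sigma> - \<i>))) / (2 * \<i>)"

definition qfun' :: "real \<Rightarrow> complex \<Rightarrow> complex" where
  "qfun' \<epsilon> \<sigma> = ((2 * csqrt (\<sigma> + \<i>) / complex_of_real (sqrt \<epsilon>) + qlog' \<epsilon> (\<sigma> + \<i>))
     - (2 * csqrt (\<sigma> - \<i>) / complex_of_real (sqrt \<epsilon>) + qlog' \<epsilon> (\<sigma> - \<i>))) / (2 * \<i>)"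

text \<open>The values of \<open>f_int\<close> on the negative imaginary axis, as shown in
  \<open>f_int_imaginary\<close>.\<close>

definition wkb_phase :: "real \<Rightarrow> real" where
  "wkb_phase \<rho> = 4/3 * Im (csqrt (Complex \<rho> 1) ^ 3)"

text \<open>The slanted sides of the domain are made for this: on the segment the gap is at least Re
  \<sigma> - (1 + |Im \<sigma>|) / sqrt 3 > m (1 + |Im \<sigma>|). The segment is the image of
  [-1,1], on all of which U must be free of zeros.\<close>

lemma qdom_shift:
  assumes "\<sigma> \<in> qdom m" "\<bar>y\<bar> \<le> 1" "m > 0"
  shows "\<sigma> + \<i> * complex_of_real y \<in> wkb_region m"
proof -
  define \<tau> where "\<tau> = \<bar>Im \<sigma>\<bar>"
  have s: "\<tau> < 1" "\<tau> \<ge> 0" "(1 / sqrt 3 + m) * (1 + \<tau>) < Re \<sigma>"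
    using assms by (auto simp: qdom_def \<tau>_def)
  have "1 / sqrt 3 + m \<le> (1 / sqrt 3 + m) * (1 + \<tau>)"
    using s(2) assms(3) mult_left_mono[of 1 "1 + \<tau>" "1 / sqrt 3 + m"] by simp
  then have r: "Re \<sigma> > 1 / sqrt 3" using s(3) assms(3) by linarith
  have "\<bar>Im \<sigma> + y\<bar> / sqrt 3 \<le> (1 + \<tau>) / sqrt 3"
    using assms(2) by (intro divide_right_mono) (auto simp: \<tau>_def)
  moreover have "(1 / sqrt 3 + m) * (1 + \<tau>) = (1 + \<tau>) / sqrt 3 + m + m * \<tau>"
    by (simp add: algebra_simps add_divide_distrib)
  moreover have "m * \<tau> \<ge> 0" using s assms by simp
  ultimately have "Re \<sigma> - \<bar>Im \<sigma> + y\<bar> / sqrt 3 > m" using s(3) by linarith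
  then show ?thesis using r by (simp add: wkb_region_def sector_gap_def)
qed

lemma DERIV_csqrt_cube:
  assumes "s \<notin> \<real>\<^sub>\<le>\<^sub>0"
  shows "((\<lambda>s. csqrt s ^ 3) has_field_derivative 3/2 * csqrt s) (at s)"
proof -
  have nz: "csqrt s \<noteq> 0" using assms by auto
  have "((\<lambda>s. csqrt s ^ 3) has_field_derivative of_nat 3 * (inverse (2 * csqrt s) * csqrt s ^ (3 - Suc 0))) (at s)"
    by (intro DERIV_power has_field_derivative_csqrt assms)
  also have "of_nat 3 * (inverse (2 * csqrt s) * csqrt s ^ (3 - Suc 0)) = 3/2 * csqrt s"
  proof -
    have "csqrt s ^ (3 - Suc 0) = csqrt s * csqrt s" by (simp only: eval_nat_numeral) simp
    then show ?thesis using nz by (simp only:) (simp add: field_simps)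
  qed
  finally show ?thesis .
qed

text \<open>What the asymptotic analysis supplies for one fixed \<epsilon>. The assumptions
  \<open>small1\<close> and \<open>small2\<close> keep the amplitude and Stokes contributions to
  \<open>qfun'\<close> below its leading part.\<close>

locale wkb =
  fixes \<epsilon> m C :: real
  assumes eps: "\<epsilon> > 0" "sqrt \<epsilon> \<le> 1/2" and m: "m > 0" and C: "C > 0"
    and small1: "3 * C * sqrt \<epsilon> \<le> 1/8" and small2: "4 * C * exp (- m / (2 * sqrt \<epsilon>)) \<le> 1/8"
    and UV: "\<And>s. s \<in> wkb_region m \<Longrightarrow> airy_U (scale \<epsilon> s) \<noteq> 0"
      "\<And>s. s \<in> wkb_region m \<Longrightarrow> airy_V (scale \<epsilon> s) \<noteq> 0"
    and DERIV_qlog: "\<And>s. s \<in> wkb_region m \<Longrightarrow> (qlog \<epsilon> has_field_derivative qlog' \<epsilon> s) (at s)"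
    and qlog_cnj: "\<And>s. s \<in> wkb_region m \<Longrightarrow> qlog \<epsilon> (cnj s) = cnj (qlog \<epsilon> s)"
    and ratio: "\<And>s. s \<in> wkb_region m \<Longrightarrow> airy_V (scale \<epsilon> s) / airy_U (scale \<epsilon> s)
        = exp (4/3 * csqrt s ^ 3 / complex_of_real (sqrt \<epsilon>) + qlog \<epsilon> s)"
    and norm_qlog: "\<And>s. s \<in> wkb_region m \<Longrightarrow> norm (qlog \<epsilon> s)
        \<le> C * (sqrt \<epsilon> / norm (csqrt s) ^ 3 + exp (- (4/3 * Re (csqrt s ^ 3) / sqrt \<epsilon>)))"
    and norm_qlog': "\<And>s. s \<in> wkb_region m \<Longrightarrow> norm (qlog' \<epsilon> s)
        \<le> C * (1 / norm s + norm (csqrt s) / sqrt \<epsilon> * exp (- sector_gap s / sqrt \<epsilon>))"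
begin

lemma region:
  assumes "s \<in> wkb_region m"
  shows "s \<in> airy_sector 0" "s \<notin> \<real>\<^sub>\<le>\<^sub>0" "Re s > 9/16"
    "Re (csqrt s) > 0" "sqrt 3 * \<bar>Im (csqrt s)\<bar> < Re (csqrt s)"
proof -
  show 1: "s \<in> airy_sector 0" using wkb_region_sector[OF assms] m by simp
  show "s \<notin> \<real>\<^sub>\<le>\<^sub>0" "Re (csqrt s) > 0" "sqrt 3 * \<bar>Im (csqrt s)\<bar> < Re (csqrt s)"
    using csqrt_airy_sector[OF 1] by auto
  show "Re s > 9/16" using assms inv_sqrt3_bounds(1) by (auto simp: wkb_region_def)
qed

lemma qdom_region:
  assumes "\<sigma> \<in> qdom m"
  shows "\<sigma> + \<i> \<in> wkb_region m" "\<sigma> - \<i> \<in> wkb_region m"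
  using qdom_shift[OF assms _ m, of 1] qdom_shift[OF assms _ m, of "-1"] by simp_all

lemma DERIV_qfun:
  assumes "\<sigma> \<in> qdom m"
  shows "(qfun \<epsilon> has_field_derivative qfun' \<epsilon> \<sigma>) (at \<sigma>)"
proof -
  have d: "((\<lambda>\<sigma>. 4/3 * csqrt (\<sigma> + a) ^ 3 / complex_of_real (sqrt \<epsilon>) + qlog \<epsilon> (\<sigma> + a)) has_field_derivative
     2 * csqrt (\<sigma> + a) / complex_of_real (sqrt \<epsilon>) + qlog' \<epsilon> (\<sigma> + a)) (at \<sigma>)"
    if a: "\<sigma> + a \<in> wkb_region m" for a
  proof -
    have "((\<lambda>s. 4/3 * csqrt s ^ 3 / complex_of_real (sqrt \<epsilon>) + qlog \<epsilon> s) has_field_derivative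
       4/3 * (3/2 * csqrt (\<sigma> + a)) / complex_of_real (sqrt \<epsilon>) + qlog' \<epsilon> (\<sigma> + a)) (at (\<sigma> + a))"
      by (intro DERIV_add DERIV_cdivide DERIV_cmult DERIV_csqrt_cube DERIV_qlog region(2) a)
    then show ?thesis using DERIV_shift[of _ _ \<sigma> a] by simp
  qed
  show ?thesis
    unfolding qfun_def[abs_def] qfun'_def
    using DERIV_cdivide[OF DERIV_diff[OF d[of "\<i>"] d[of "- \<i>"]], of "2 * \<i>"] qdom_region[OF assms] by simp
qed

text \<open>The difference of the two square roots is 2 i over their sum T. As T lies in the convex
  sector |Arg T| < pi/6, the leading part has a real part of order 1 / (Y sqrt \<epsilon>), with Y
  bounding the roots.\<close>

lemma Re_qfun'_pos:
  assumes \<sigma>: "\<sigma> \<in> qdom m"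
  shows "Re (qfun' \<epsilon> \<sigma>) > 0"
proof -
  define X where "X = Re \<sigma>"
  define Y where "Y = sqrt (2 * X)"
  define k where "k = exp (- m / (2 * sqrt \<epsilon>))"
  define e where "e = sqrt \<epsilon>"
  have e: "e > 0" "e \<le> 1/2" using eps by (auto simp: e_def)
  note r1 = qdom_region(1)[OF \<sigma>] and r2 = qdom_region(2)[OF \<sigma>]
  have X: "X > 9/16" using region(3)[OF r1] by (simp add: X_def)
  have Y1: "Y \<ge> 1" unfolding Y_def using X by simp
  have Y2: "Y\<^sup>2 = 2 * X" using X by (simp add: Y_def)
  have bound: "norm (csqrt s) \<le> Y \<and> norm (qlog' \<epsilon> s) \<le> C * (1 / X + Y / e * (2 * k / X))"
    if s: "s \<in> wkb_region m" "Re s = X" "\<bar>Im s\<bar> \<le> 2" for s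
  proof
    have "norm s \<le> 2 * X"
    proof (rule power2_le_imp_le)
      have "(Im s)\<^sup>2 \<le> (sqrt 3 * X)\<^sup>2"
        using region(1)[OF s(1)] s(2) X by (intro power2_le_iff_abs_le[THEN iffD2]) (auto simp: airy_sector_def)
      then show "(norm s)\<^sup>2 \<le> (2 * X)\<^sup>2" by (simp add: cmod_power2 s(2) power_mult_distrib)
    qed (use X in simp)
    then show nY: "norm (csqrt s) \<le> Y" by (simp add: Y_def)
    have sX: "norm s \<ge> X" using complex_Re_le_cmod[of s] s(2) by simp
    define t where "t = sector_gap s"
    have t: "t > m" using s by (simp add: wkb_region_def t_def)
    have "\<bar>Im s\<bar> / sqrt 3 \<le> 2 * 1"
      using s(3) inv_sqrt3_bounds(2) mult_mono[of "\<bar>Im s\<bar>" 2 "1 / sqrt 3" 1] by simp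
    then have Xt: "X \<le> t + 2" using s(2) by (simp add: t_def sector_gap_def)
    \<comment> \<open>One half of the exponent supplies the small factor \<open>k\<close>. The other
      is at least \<open>t\<close> because e \<le> 1/2, and since X \<le> t + 2 it yields the decay
      1 / X.\<close>
    have "exp (- t / e) = exp (- t / (2 * e)) * exp (- t / (2 * e))" by (simp flip: exp_add)
    also have "\<dots> \<le> k * exp (- t)"
    proof (intro mult_mono)
      show "exp (- t / (2 * e)) \<le> k"
        unfolding k_def e_def[symmetric] using t e by (simp add: divide_right_mono)
      have "t * 1 \<le> t * (1 / (2 * e))" using t m e by (intro mult_left_mono) auto
      then show "exp (- t / (2 * e)) \<le> exp (- t)" by simp
    qed (auto simp: k_def)
    finally have E: "exp (- t / e) \<le> k * exp (- t)" .
    have "X * exp (- t / e) \<le> (t + 2) * (k * exp (- t))"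
      using Xt E X by (intro mult_mono) auto
    also have "\<dots> = 2 * k * ((1 + t / 2) * exp (- t))" by (simp add: algebra_simps)
    also have "\<dots> \<le> 2 * k * (exp t * exp (- t))"
    proof (intro mult_left_mono mult_right_mono)
      show "1 + t / 2 \<le> exp t" using exp_ge_add_one_self[of t] t m by linarith
    qed (auto simp: k_def)
    also have "\<dots> = 2 * k" by (simp flip: exp_add)
    finally have E2: "exp (- t / e) \<le> 2 * k / X" using X by (simp add: field_simps)
    have "norm (qlog' \<epsilon> s) \<le> C * (1 / norm s + norm (csqrt s) / e * exp (- t / e))"
      using norm_qlog'[OF s(1)] by (simp only: e_def t_def)
    also have "\<dots> \<le> C * (1 / X + Y / e * (2 * k / X))"
      using nY sX E2 e C X Y1
      by (intro mult_left_mono add_mono mult_mono divide_right_mono divide_left_mono mult_pos_pos) auto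
    finally show "norm (qlog' \<epsilon> s) \<le> C * (1 / X + Y / e * (2 * k / X))" .
  qed
  have im: "\<bar>Im \<sigma>\<bar> < 1" using \<sigma> by (simp add: qdom_def)
  define w1 w2 where "w1 = csqrt (\<sigma> + \<i>)" and "w2 = csqrt (\<sigma> - \<i>)"
  have b1: "norm w1 \<le> Y" "norm (qlog' \<epsilon> (\<sigma> + \<i>)) \<le> C * (1 / X + Y / e * (2 * k / X))"
    unfolding w1_def using bound[OF r1] im by (auto simp: X_def)
  have b2: "norm w2 \<le> Y" "norm (qlog' \<epsilon> (\<sigma> - \<i>)) \<le> C * (1 / X + Y / e * (2 * k / X))"
    unfolding w2_def using bound[OF r2] im by (auto simp: X_def)
  define T where "T = w1 + w2"
  have T1: "Re T > 0" "sqrt 3 * \<bar>Im T\<bar> < Re T"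
  proof -
    note a = region(4,5)[OF r1, folded w1_def] and b = region(4,5)[OF r2, folded w2_def]
    show "Re T > 0" using a b by (simp add: T_def)
    have "sqrt 3 * \<bar>Im T\<bar> \<le> sqrt 3 * (\<bar>Im w1\<bar> + \<bar>Im w2\<bar>)"
      by (intro mult_left_mono) (auto simp: T_def)
    then show "sqrt 3 * \<bar>Im T\<bar> < Re T" using a b by (simp add: T_def algebra_simps)
  qed
  have nT: "norm T \<le> 2 * Re T" by (rule norm_le_2_Re[OF T1(2)])
  have Tz: "T \<noteq> 0" using T1 by auto
  have TY: "norm T \<le> 2 * Y" using norm_triangle_ineq[of w1 w2] b1 b2 by (simp add: T_def)
  have "(w1 - w2) * T = w1\<^sup>2 - w2\<^sup>2" by (simp add: T_def power2_eq_square algebra_simps)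
  also have "\<dots> = 2 * \<i>" by (simp add: w1_def w2_def)
  finally have "w1 - w2 = 2 * \<i> / T" using Tz by (simp add: field_simps)
  then have A: "(2 * w1 - 2 * w2) / (2 * \<i>) = 2 / T" by (simp add: right_diff_distrib[symmetric])
  have "1 / norm T \<le> 2 * Re T / (norm T)\<^sup>2"
    using nT Tz by (simp add: divide_simps power2_eq_square)
  also have "\<dots> = Re (2 / T)" by (simp add: Re_divide cmod_power2)
  finally have "1 / (2 * Y) \<le> Re (2 / T)"
    using TY Tz Y1 frac_le[of 1 1 "norm T" "2 * Y"] by simp
  then have "1 / (2 * Y) / e \<le> Re (2 / T) / e" using e by (intro divide_right_mono) auto
  also have "\<dots> = Re ((2 * w1 - 2 * w2) / (2 * \<i>) / complex_of_real e)" unfolding A by (simp only: Re_divide_of_real)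
  finally have main: "1 / (2 * Y) / e \<le> Re ((2 * w1 - 2 * w2) / (2 * \<i>) / complex_of_real e)" .
  define q1 q2 where "q1 = qlog' \<epsilon> (\<sigma> + \<i>)" and "q2 = qlog' \<epsilon> (\<sigma> - \<i>)"
  have "qfun' \<epsilon> \<sigma> = (2 * w1 - 2 * w2) / (2 * \<i>) / complex_of_real e + (q1 - q2) / (2 * \<i>)"
    unfolding qfun'_def w1_def[symmetric] w2_def[symmetric] q1_def[symmetric] q2_def[symmetric] e_def[symmetric]
    using e by (simp add: field_simps)
  moreover have "\<bar>Re ((q1 - q2) / (2 * \<i>))\<bar> \<le> C * (1 / X + Y / e * (2 * k / X))"
  proof -
    have "\<bar>Re ((q1 - q2) / (2 * \<i>))\<bar> \<le> norm ((q1 - q2) / (2 * \<i>))" by (rule abs_Re_le_cmod)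
    also have "\<dots> = norm (q1 - q2) / 2" by (simp add: norm_divide norm_mult)
    also have "\<dots> \<le> (norm q1 + norm q2) / 2" by (simp add: norm_triangle_ineq4)
    also have "\<dots> \<le> C * (1 / X + Y / e * (2 * k / X))" proof -
      have "(a + b) / 2 \<le> B" if "a \<le> B" "b \<le> B" for a b B :: real using that by simp
      then show ?thesis unfolding q1_def q2_def using b1(2) b2(2) .
    qed
    finally show ?thesis .
  qed
  moreover have "C * (1 / X + Y / e * (2 * k / X)) < 1 / (2 * Y) / e"
  proof -
    have YX: "Y / X \<le> 2" "Y * Y / X = 2"
      using Y2 X Y1 mult_left_mono[OF Y1, of Y] by (auto simp: divide_simps power2_eq_square)
    \<comment> \<open>Multiplication by Y e makes both sides independent of the size of X, since the
      square of Y is 2 X; the leading part becomes 1/2.\<close>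
    have "C * (1 / X + Y / e * (2 * k / X)) * (Y * e) = C * e * (Y / X) + 2 * C * k * (Y * Y / X)"
      using e X by (simp add: field_simps)
    also have "\<dots> \<le> C * e * 2 + 2 * C * k * 2"
      unfolding YX(2) using YX C e by (intro add_mono mult_left_mono) (auto simp: k_def)
    also have "\<dots> < 1 / 2" using small1 small2 C e by (simp add: e_def k_def)
    also have "\<dots> = 1 / (2 * Y) / e * (Y * e)" using e Y1 by simp
    finally show ?thesis by (rule mult_right_less_imp_less) (use e Y1 in auto)
  qed
  moreover have "a + b > 0" if "L \<le> a" "\<bar>b\<bar> \<le> c" "c < L" for a b c L :: real
    using that by linarith
  ultimately show ?thesis using main by (metis plus_complex.sel(1))
qed

lemma Im_qfun_nonzero:
  assumes \<sigma>: "\<sigma> \<in> qdom m" and re: "Im (qfun \<epsilon> (complex_of_real (Re \<sigma>))) = 0" and im: "Im \<sigma> \<noteq> 0"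
  shows "Im (qfun \<epsilon> \<sigma>) \<noteq> 0"
proof -
  define X where "X = Re \<sigma>"
  let ?f = "\<lambda>t. Im (qfun \<epsilon> (Complex X t))"
  \<comment> \<open>The domain narrows as |Im \<sigma>| grows, so the vertical segment down to the
    real axis stays inside.\<close>
  have dom: "Complex X t \<in> qdom m" if "\<bar>t\<bar> \<le> \<bar>Im \<sigma>\<bar>" for t
  proof -
    have "(1 / sqrt 3 + m) * (1 + \<bar>t\<bar>) \<le> (1 / sqrt 3 + m) * (1 + \<bar>Im \<sigma>\<bar>)"
      using that m by (intro mult_left_mono) auto
    then show ?thesis using \<sigma> that by (simp add: qdom_def X_def)
  qed
  have d: "(?f has_real_derivative Re (qfun' \<epsilon> (Complex X t))) (at t)" if "\<bar>t\<bar> \<le> \<bar>Im \<sigma>\<bar>" for t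
  proof -
    have l: "((\<lambda>t. Complex X t) has_vector_derivative \<i>) (at t)"
      unfolding has_vector_derivative_def Complex_eq
      by (auto intro!: derivative_eq_intros simp: scaleR_conv_of_real)
    have "((qfun \<epsilon> \<circ> (\<lambda>t. Complex X t)) has_vector_derivative \<i> * qfun' \<epsilon> (Complex X t)) (at t)"
      by (rule field_vector_diff_chain_at[OF l DERIV_qfun[OF dom[OF that]]])
    then have "((\<lambda>t. qfun \<epsilon> (Complex X t)) has_vector_derivative \<i> * qfun' \<epsilon> (Complex X t)) (at t)"
      by (simp add: o_def)
    then have "((\<lambda>t. Im (qfun \<epsilon> (Complex X t))) has_vector_derivative Im (\<i> * qfun' \<epsilon> (Complex X t))) (at t)"
      by (rule bounded_linear.has_vector_derivative[OF bounded_linear_Im])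
    then show ?thesis by (simp add: has_real_derivative_iff_has_vector_derivative)
  qed
  have f0: "?f 0 = 0" using re by (simp add: X_def complex_of_real_def)
  have f1: "?f (Im \<sigma>) = Im (qfun \<epsilon> \<sigma>)" by (simp add: X_def)
  show ?thesis
  proof (cases "Im \<sigma> > 0")
    case True
    have "?f 0 < ?f (Im \<sigma>)"
    proof (rule DERIV_pos_imp_increasing[OF True])
      fix t assume "0 \<le> t" "t \<le> Im \<sigma>"
      then have "\<bar>t\<bar> \<le> \<bar>Im \<sigma>\<bar>" by simp
      then show "\<exists>y. (?f has_real_derivative y) (at t) \<and> 0 < y" using d Re_qfun'_pos[OF dom] by blast
    qed
    then show ?thesis using f0 f1 by simp
  next
    case False
    with im have n: "Im \<sigma> < 0" by simp
    have "?f (Im \<sigma>) < ?f 0"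
    proof (rule DERIV_pos_imp_increasing[OF n])
      fix t assume "Im \<sigma> \<le> t" "t \<le> 0"
      then have "\<bar>t\<bar> \<le> \<bar>Im \<sigma>\<bar>" by simp
      then show "\<exists>y. (?f has_real_derivative y) (at t) \<and> 0 < y" using d Re_qfun'_pos[OF dom] by blast
    qed
    then show ?thesis using f0 f1 by simp
  qed
qed

lemma real_in_qdom: "\<rho> > 1 / sqrt 3 + m \<Longrightarrow> complex_of_real \<rho> \<in> qdom m"
  by (simp add: qdom_def)

text \<open>On the real axis the two endpoint terms are conjugate. The error must decay like
  \<rho>^(-3/2): divided by the slope of the phase, of order \<rho>^(-1/2), it gives displacements
  of order \<epsilon> / \<rho> uniformly in the index.\<close>

lemma qfun_real:
  assumes \<rho>: "\<rho> > 1 / sqrt 3 + m" and m1: "m \<le> 1"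
    and small: "exp (- (2 * (3/4) powr (1/4) * m / sqrt \<epsilon>)) \<le> sqrt \<epsilon>"
  shows "Im (qfun \<epsilon> (complex_of_real \<rho>)) = 0"
    "\<bar>Re (qfun \<epsilon> (complex_of_real \<rho>)) - wkb_phase \<rho> / sqrt \<epsilon>\<bar> \<le> 5 * C * sqrt \<epsilon> / (\<rho> * sqrt \<rho>)"
proof -
  define s where "s = complex_of_real \<rho> + \<i>"
  define e where "e = sqrt \<epsilon>"
  have e: "e > 0" "e \<le> 1/2" using eps by (auto simp: e_def)
  have s1: "s \<in> wkb_region m" unfolding s_def by (rule qdom_region[OF real_in_qdom[OF \<rho>]])
  have sC: "s = Complex \<rho> 1" by (simp add: s_def complex_eq_iff)
  have cs: "complex_of_real \<rho> - \<i> = cnj s" by (simp add: s_def)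
  have ccs: "csqrt (cnj s) = cnj (csqrt s)" using region(2)[OF s1] by (simp add: cnj_csqrt)
  define Z where "Z = 4/3 * csqrt s ^ 3 / complex_of_real e + qlog \<epsilon> s"
  have "qfun \<epsilon> (complex_of_real \<rho>) = (Z - cnj Z) / (2 * \<i>)"
    unfolding qfun_def cs ccs qlog_cnj[OF s1] e_def[symmetric] s_def[symmetric] Z_def by simp
  also have "\<dots> = complex_of_real (Im Z)" by (simp add: complex_eq_iff)
  finally have q: "qfun \<epsilon> (complex_of_real \<rho>) = complex_of_real (Im Z)" .
  then show "Im (qfun \<epsilon> (complex_of_real \<rho>)) = 0" by simp
  have "Im Z = wkb_phase \<rho> / e + Im (qlog \<epsilon> s)"
    unfolding Z_def wkb_phase_def sC[symmetric] by simp
  then have "\<bar>Re (qfun \<epsilon> (complex_of_real \<rho>)) - wkb_phase \<rho> / e\<bar> \<le> norm (qlog \<epsilon> s)"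
    using abs_Im_le_cmod[of "qlog \<epsilon> s"] by (simp add: q)
  also have "\<dots> \<le> C * (e / norm (csqrt s) ^ 3 + exp (- (4/3 * Re (csqrt s ^ 3) / e)))"
    using norm_qlog[OF s1] by (simp only: e_def)
  also have "\<dots> \<le> C * (e / (\<rho> * sqrt \<rho>) + 4 * e / (\<rho> * sqrt \<rho>))"
  proof (intro mult_left_mono add_mono)
    have r0: "\<rho> > 0" using region(3)[OF s1] by (simp add: s_def)
    have "\<rho> \<le> norm s" using complex_Re_le_cmod[of s] by (simp add: s_def)
    then have "sqrt \<rho> ^ 3 \<le> norm (csqrt s) ^ 3" using r0 by (intro power_mono) auto
    moreover have "sqrt \<rho> ^ 3 = \<rho> * sqrt \<rho>" using r0 by (simp add: power3_eq_cube)
    ultimately show "e / norm (csqrt s) ^ 3 \<le> e / (\<rho> * sqrt \<rho>)"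
      using r0 e by (intro frac_le) auto
    define a where "a = (3/4::real) powr (1/4)"
    have "(3/4::real) powr 1 \<le> a" unfolding a_def by (intro powr_mono') auto
    then have a: "a \<ge> 1/2" by simp
    \<comment> \<open>The distance beyond the tip. The assumption \<open>small\<close> disposes of
      the exponential at the tip, and the additional factor exp (- 2 t) beats every power of
      \<rho>.\<close>
    define t where "t = \<rho> - 1 / sqrt 3 - m"
    have t: "t > 0" using \<rho> by (simp add: t_def)
    have "2 * (a * (\<rho> - 1 / sqrt 3)) \<le> 4/3 * Re (csqrt s ^ 3)"
    proof -
      have "a * (\<rho> - 1 / sqrt 3) \<le> 2/3 * Re (csqrt s ^ 3)"
        unfolding a_def sC using Re_csqrt_cube_line[of \<rho> 1] \<rho> m by simp
      then show ?thesis by linarith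
    qed
    then have "2 * (a * (\<rho> - 1 / sqrt 3)) / e \<le> 4/3 * Re (csqrt s ^ 3) / e"
      using e by (intro divide_right_mono) auto
    moreover have "2 * (a * (\<rho> - 1 / sqrt 3)) / e = 2 * a * m / e + 2 * a * t / e"
      using e by (simp add: t_def field_simps)
    moreover have "t * 2 \<le> 2 * a * t / e"
    proof -
      have "t * 2 * e \<le> t * 2 * (1/2)" using t e by (intro mult_left_mono) auto
      also have "\<dots> \<le> 2 * a * t" using a t by simp
      finally show ?thesis using e by (simp add: field_simps)
    qed
    ultimately have "exp (- (4/3 * Re (csqrt s ^ 3) / e)) \<le> exp (- (2 * a * m / e) + - (t * 2))"
      by simp
    also have "\<dots> = exp (- (2 * a * m / e)) * exp (- (t * 2))" by (rule exp_add)
    also have "\<dots> \<le> e * exp (- (t * 2))"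
      using small by (intro mult_right_mono) (auto simp: a_def e_def)
    also have "\<dots> \<le> e * (4 / (\<rho> * sqrt \<rho>))"
    proof (intro mult_left_mono)
      have rt: "\<rho> \<le> t + 2" unfolding t_def using m1 inv_sqrt3_bounds(2) by linarith
      have "sqrt \<rho> \<le> t + 2"
      proof (rule real_le_lsqrt)
        have "(t + 2)\<^sup>2 = t * t + 4 * t + 4" by (simp add: power2_eq_square algebra_simps)
        then show "\<rho> \<le> (t + 2)\<^sup>2" using rt t zero_le_square[of t] by linarith
      qed (use t in auto)
      then have "\<rho> * sqrt \<rho> \<le> (t + 2) * (t + 2)" using rt r0 t by (intro mult_mono) auto
      also have "\<dots> = 4 * ((1 + t / 2) * (1 + t / 2))" by (simp add: algebra_simps)
      also have "\<dots> \<le> 4 * (exp t * exp t)"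
      proof -
        have "1 + t / 2 \<le> exp t" using exp_ge_add_one_self[of t] t by linarith
        then show ?thesis using t by (intro mult_left_mono mult_mono) auto
      qed
      also have "\<dots> = 4 * exp (t * 2)" by (simp flip: exp_add)
      finally have "\<rho> * sqrt \<rho> \<le> 4 * exp (t * 2)" .
      then show "exp (- (t * 2)) \<le> 4 / (\<rho> * sqrt \<rho>)"
        using r0 by (simp add: exp_minus field_simps)
    qed (use e in auto)
    finally show "exp (- (4/3 * Re (csqrt s ^ 3) / e)) \<le> 4 * e / (\<rho> * sqrt \<rho>)" by (simp add: mult.commute)
  qed (use C in auto)
  also have "\<dots> = 5 * C * e / (\<rho> * sqrt \<rho>)" by (simp add: add_divide_distrib[symmetric])
  finally show "\<bar>Re (qfun \<epsilon> (complex_of_real \<rho>)) - wkb_phase \<rho> / sqrt \<epsilon>\<bar> \<le> 5 * C * sqrt \<epsilon> / (\<rho> * sqrt \<rho>)"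
    by (simp only: e_def)
qed

text \<open>For simplicity suppose that U has equal squares at the two ends. Equality of V / U then
  makes U V equal there as well. As \<open>qfun'\<close> is a multiple of the difference of the
  values of 1 / (U V), it would vanish.\<close>

lemma eigenvalue_iff_qfun:
  assumes \<sigma>: "\<i> * \<mu> \<in> qdom m"
  shows "eigenvalue \<epsilon> \<mu> \<longleftrightarrow> (\<exists>n::int. qfun \<epsilon> (\<i> * \<mu>) = complex_of_real (pi * of_int n))"
    "eigenvalue \<epsilon> \<mu> \<Longrightarrow> simple_eigenvalue \<epsilon> \<mu>"
proof -
  define \<delta> where "\<delta> = root 3 \<epsilon>"
  have d0: "\<delta> > 0" "\<delta> ^ 3 = \<epsilon>" using eps by (auto simp: \<delta>_def)
  define Z where "Z x = scale \<epsilon> (\<i> * \<mu> - \<i> * complex_of_real x)" for x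
  define k where "k = - \<i> / complex_of_real \<delta>"
  have Zr: "\<i> * \<mu> - \<i> * complex_of_real x \<in> wkb_region m" if "\<bar>x\<bar> \<le> 1" for x
    using qdom_shift[OF \<sigma>, of "- x"] that m by simp
  have Zs: "Z x \<in> airy_sector 0" if "\<bar>x\<bar> \<le> 1" for x
    using region(1)[OF Zr[OF that]] d0
    by (simp add: Z_def scale_def airy_sector_def \<delta>_def[symmetric] divide_strict_right_mono
        times_divide_eq_right[symmetric] del: times_divide_eq_right) (simp add: divide_simps)
  have dZ: "(Z has_vector_derivative k) (at x)" for x
    unfolding Z_def[abs_def] scale_def \<delta>_def[symmetric] k_def has_vector_derivative_def
    using d0(1) by (auto intro!: derivative_eq_intros simp: scaleR_conv_of_real)
  have chain: "((\<lambda>x. f (Z x)) has_vector_derivative k * D) (at x)"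
    if "(f has_field_derivative D) (at (Z x))" for f D x
    using field_vector_diff_chain_at[OF dZ that] by (simp add: o_def)
  \<comment> \<open>Two derivatives of the substitution and the dilation combine to
    \<open>k\<^sup>2 * Z x\<close>, the coefficient of the original equation.\<close>
  have k2: "k * (k * (Z x * u)) = (\<i> / \<epsilon>) * (x - \<mu>) * u" for x u
  proof -
    have "complex_of_real \<epsilon> = complex_of_real \<delta> * complex_of_real \<delta> * complex_of_real \<delta>"
      using d0 by (simp add: power3_eq_cube flip: of_real_mult)
    then show ?thesis using d0(1)
      by (simp add: k_def Z_def scale_def \<delta>_def[symmetric] field_simps)
  qed
  have kz: "k \<noteq> 0" using d0 by (simp add: k_def)
  interpret airy_bvp \<epsilon> \<mu> "\<lambda>x. airy_U (Z x)" "\<lambda>x. airy_V (Z x)"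
    "\<lambda>x. k * airy_U' (Z x)" "\<lambda>x. k * airy_V' (Z x)" "k * (2 * gauss_const\<^sup>2)"
  proof
    show "\<epsilon> > 0" by (rule eps)
    fix x :: real assume x: "\<bar>x\<bar> \<le> 1"
    note s = Zs[OF x]
    show "((\<lambda>x. airy_U (Z x)) has_vector_derivative k * airy_U' (Z x)) (at x)"
      by (rule chain[OF DERIV_airy_U(1)[OF s order_refl]])
    show "((\<lambda>x. airy_V (Z x)) has_vector_derivative k * airy_V' (Z x)) (at x)"
      by (rule chain[OF DERIV_airy_V(1)[OF s order_refl]])
    show "((\<lambda>x. k * airy_U' (Z x)) has_vector_derivative (\<i> / \<epsilon>) * (x - \<mu>) * airy_U (Z x)) (at x)"
      using has_vector_derivative_mult_right[OF chain[OF DERIV_airy_U(2)[OF s order_refl]], of k] by (simp only: k2)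
    show "((\<lambda>x. k * airy_V' (Z x)) has_vector_derivative (\<i> / \<epsilon>) * (x - \<mu>) * airy_V (Z x)) (at x)"
      using has_vector_derivative_mult_right[OF chain[OF DERIV_airy_V(2)[OF s order_refl]], of k] by (simp only: k2)
    show "airy_U (Z x) * (k * airy_V' (Z x)) - k * airy_U' (Z x) * airy_V (Z x) = k * (2 * gauss_const\<^sup>2)"
      unfolding wronskian_U_V[OF s, symmetric] by (simp add: algebra_simps)
    show "airy_U (Z x) \<noteq> 0" unfolding Z_def by (rule UV(1)[OF Zr[OF x]])
  qed (use kz gauss_const_pos in simp)
  have Z1: "Z (-1) = scale \<epsilon> (\<i> * \<mu> + \<i>)" "Z 1 = scale \<epsilon> (\<i> * \<mu> - \<i>)" by (simp_all add: Z_def)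
  note r1 = qdom_region(1)[OF \<sigma>] and r2 = qdom_region(2)[OF \<sigma>]
  define A where "A = 4/3 * csqrt (\<i> * \<mu> + \<i>) ^ 3 / complex_of_real (sqrt \<epsilon>) + qlog \<epsilon> (\<i> * \<mu> + \<i>)"
  define B where "B = 4/3 * csqrt (\<i> * \<mu> - \<i>) ^ 3 / complex_of_real (sqrt \<epsilon>) + qlog \<epsilon> (\<i> * \<mu> - \<i>)"
  have q: "A - B = 2 * \<i> * qfun \<epsilon> (\<i> * \<mu>)" by (simp add: qfun_def A_def B_def)
  have ev: "eigenvalue \<epsilon> \<mu> \<longleftrightarrow> airy_V (Z (-1)) / airy_U (Z (-1)) = airy_V (Z 1) / airy_U (Z 1)"
    by (rule eigenvalue_iff)
  also have "\<dots> \<longleftrightarrow> exp A = exp B"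
    unfolding Z1 ratio[OF r1] ratio[OF r2] A_def B_def ..
  also have "\<dots> \<longleftrightarrow> (\<exists>n::int. A = B + complex_of_real (2 * of_int n * pi) * \<i>)"
    by (simp add: exp_eq mult.assoc)
  also have "\<dots> \<longleftrightarrow> (\<exists>n::int. qfun \<epsilon> (\<i> * \<mu>) = complex_of_real (pi * of_int n))"
  proof (intro ex_cong1)
    fix n :: int
    have "A = B + complex_of_real (2 * of_int n * pi) * \<i> \<longleftrightarrow> A - B = 2 * \<i> * complex_of_real (pi * of_int n)"
      by (auto simp: algebra_simps)
    then show "A = B + complex_of_real (2 * of_int n * pi) * \<i> \<longleftrightarrow> qfun \<epsilon> (\<i> * \<mu>) = complex_of_real (pi * of_int n)"
      unfolding q by simp
  qed
  finally show "eigenvalue \<epsilon> \<mu> \<longleftrightarrow> (\<exists>n::int. qfun \<epsilon> (\<i> * \<mu>) = complex_of_real (pi * of_int n))" .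
  assume eig: "eigenvalue \<epsilon> \<mu>"
  have "(airy_U (Z 1))\<^sup>2 \<noteq> (airy_U (Z (-1)))\<^sup>2"
  proof
    assume eq: "(airy_U (Z 1))\<^sup>2 = (airy_U (Z (-1)))\<^sup>2"
    define h where "h = airy_V (Z 1) / airy_U (Z 1)"
    have h: "airy_V (Z 1) = h * airy_U (Z 1)" "airy_V (Z (-1)) = h * airy_U (Z (-1))"
      using ev eig pz[of 1] pz[of "-1"] by (auto simp: h_def field_simps)
    have UVeq: "airy_U (Z 1) * airy_V (Z 1) = airy_U (Z (-1)) * airy_V (Z (-1))"
      unfolding h using eq by (simp add: power2_eq_square)
    have sq: "complex_of_real (sqrt (root 3 \<epsilon>)) * complex_of_real (root 3 \<epsilon>) = complex_of_real (sqrt \<epsilon>)"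
      using sqrt_root3_cube[OF eps(1)] d0 by (simp add: power3_eq_cube \<delta>_def mult.commute flip: of_real_mult)
    \<comment> \<open>Adding the WKB term to \<open>qlog'\<close> restores the exact logarithmic
      derivative of V / U.\<close>
    have ql: "2 * csqrt s / complex_of_real (sqrt \<epsilon>) + qlog' \<epsilon> s
       = 2 * gauss_const\<^sup>2 / (airy_U (scale \<epsilon> s) * airy_V (scale \<epsilon> s)) / complex_of_real (root 3 \<epsilon>)" for s
      unfolding qlog'_def csqrt_scale(1)[OF eps(1)] sq[symmetric] by (simp add: diff_divide_distrib)
    have "qfun' \<epsilon> (\<i> * \<mu>) = 0"
      unfolding qfun'_def ql Z1[symmetric] UVeq by simp
    then show False using Re_qfun'_pos[OF \<sigma>] by simp
  qed
  then show "simple_eigenvalue \<epsilon> \<mu>" by (rule simple_eigenvalueI[OF eig])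
qed

end

section \<open>Smallness conditions as \<epsilon> tends to zero\<close>

text \<open>The logarithm in the depth turns exp (- b m / sqrt \<epsilon>) into \<epsilon>^(b
  \<theta>). The bound at the tip requires 2 (3/4)^(1/4) \<theta> \<ge> 1/2; for the others \<theta>
  > 0 is enough. The value 1/100 provides the bound 1/20 for \<open>5 * C\<close> in
  \<open>quantisation\<close>.\<close>

lemma wkb_eventually:
  fixes \<theta> :: real
  assumes \<theta>: "\<theta> > 1 / 3 * (3 / 4) powr (3 / 4)"
  obtains C where "C > 0"
    "\<forall>\<^sub>F \<epsilon> in at_right 0. wkb \<epsilon> (depth \<theta> \<epsilon> - 1 / sqrt 3) C \<and> depth \<theta> \<epsilon> - 1 / sqrt 3 \<le> 1 \<and>
       exp (- (2 * (3/4) powr (1/4) * (depth \<theta> \<epsilon> - 1 / sqrt 3) / sqrt \<epsilon>)) \<le> sqrt \<epsilon> \<and> C * sqrt \<epsilon> \<le> 1 / 100"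
proof -
  obtain e1 c1 C where C: "e1 > 0" "c1 > 0" "C > 0" and
    Q: "\<And>\<epsilon> m s. \<lbrakk>0 < \<epsilon>; \<epsilon> < e1; m > 0; exp (- m / sqrt \<epsilon>) \<le> c1; s \<in> wkb_region m\<rbrakk> \<Longrightarrow>
      qlog_bounds C \<epsilon> s"
    by (rule qlog_properties) (rule that)
  have \<theta>0: "\<theta> > 0" using \<theta> powr_ge_zero[of "3/4" "3/4"] by linarith
  define a where "a = (3/4::real) powr (1/4)"
  have a: "2 * a * \<theta> \<ge> 1/2"
  proof -
    have "a * (1 / 3 * (3 / 4) powr (3 / 4)) \<le> a * \<theta>" using \<theta> by (intro mult_left_mono) (auto simp: a_def)
    \<comment> \<open>This identity produces the threshold: a times (1/3) (3/4)^(3/4) equals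
      1/4.\<close>
    moreover have "a * (3 / 4) powr (3 / 4) = 3/4" by (simp add: a_def flip: powr_add)
    ultimately show ?thesis by simp
  qed
  define m where "m \<epsilon> = sqrt \<epsilon> * ln (\<epsilon> powr (- \<theta>))" for \<epsilon>
  have md: "depth \<theta> \<epsilon> - 1 / sqrt 3 = m \<epsilon>" for \<epsilon> by (simp add: depth_def m_def)
  have mexp: "exp (- (b * m \<epsilon> / sqrt \<epsilon>)) = \<epsilon> powr (b * \<theta>)" if "\<epsilon> > 0" for \<epsilon> b
    using that by (simp add: m_def ln_powr powr_def algebra_simps)
  have t1: "(m \<longlongrightarrow> 0) (at_right 0)" unfolding m_def[abs_def] by real_asymp
  have t2: "((\<lambda>\<epsilon>. C * sqrt \<epsilon>) \<longlongrightarrow> 0) (at_right 0)" by real_asymp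
  have t3: "((\<lambda>\<epsilon>. \<epsilon> powr \<theta>) \<longlongrightarrow> 0) (at_right 0)" using \<theta>0 by real_asymp
  have t4: "((\<lambda>\<epsilon>. C * \<epsilon> powr (1/2 * \<theta>)) \<longlongrightarrow> 0) (at_right 0)" using \<theta>0 by real_asymp
  have ev: "\<forall>\<^sub>F \<epsilon> in at_right (0::real). \<epsilon> > 0" "\<forall>\<^sub>F \<epsilon> in at_right 0. \<epsilon> < min e1 (1/4)"
    "\<forall>\<^sub>F \<epsilon> in at_right 0. m \<epsilon> < 1" "\<forall>\<^sub>F \<epsilon> in at_right 0. C * sqrt \<epsilon> < 1/100"
    "\<forall>\<^sub>F \<epsilon> in at_right 0. \<epsilon> powr \<theta> < c1" "\<forall>\<^sub>F \<epsilon> in at_right 0. C * \<epsilon> powr (1/2 * \<theta>) < 1/32"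
    using order_tendstoD(2)[OF t1, of 1] order_tendstoD(2)[OF t2, of "1/100"] order_tendstoD(2)[OF t3, of c1]
      order_tendstoD(2)[OF t4, of "1/32"] C eventually_at_right_less[of "0::real"]
      eventually_at_right_real[of 0 "min e1 (1/4)"]
    by (auto elim: eventually_mono)
  show thesis
  proof (rule that[OF C(3)])
    show "\<forall>\<^sub>F \<epsilon> in at_right 0. wkb \<epsilon> (depth \<theta> \<epsilon> - 1 / sqrt 3) C \<and> depth \<theta> \<epsilon> - 1 / sqrt 3 \<le> 1 \<and>
       exp (- (2 * (3/4) powr (1/4) * (depth \<theta> \<epsilon> - 1 / sqrt 3) / sqrt \<epsilon>)) \<le> sqrt \<epsilon> \<and> C * sqrt \<epsilon> \<le> 1 / 100"
      using ev unfolding md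
    proof eventually_elim
      case (elim \<epsilon>)
      have e: "\<epsilon> > 0" "\<epsilon> < e1" "\<epsilon> < 1/4" using elim by auto
      have sq: "sqrt \<epsilon> \<le> 1/2" by (rule real_le_lsqrt) (use e in \<open>auto simp: power2_eq_square\<close>)
      have m0: "m \<epsilon> > 0" using e \<theta>0 by (auto simp: m_def ln_powr mult_less_0_iff)
      have c: "exp (- m \<epsilon> / sqrt \<epsilon>) \<le> c1" using mexp[OF e(1), of 1] elim by simp
      have k: "exp (- m \<epsilon> / (2 * sqrt \<epsilon>)) = \<epsilon> powr (1/2 * \<theta>)" using mexp[OF e(1), of "1/2"] by simp
      note q = Q[OF e(1,2) m0 c, unfolded qlog_bounds_def]
      have "wkb \<epsilon> (m \<epsilon>) C"
      proof
        show "3 * C * sqrt \<epsilon> \<le> 1/8" "4 * C * exp (- m \<epsilon> / (2 * sqrt \<epsilon>)) \<le> 1/8"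
          using elim unfolding k by simp_all
      qed (use e sq m0 C q in blast)+
      moreover have "exp (- (2 * (3/4) powr (1/4) * m \<epsilon> / sqrt \<epsilon>)) \<le> sqrt \<epsilon>"
      proof -
        have "exp (- (2 * a * m \<epsilon> / sqrt \<epsilon>)) = \<epsilon> powr (2 * a * \<theta>)" using mexp[OF e(1), of "2 * a"] .
        also have "\<dots> \<le> \<epsilon> powr (1/2)" using a e by (intro powr_mono') auto
        finally show ?thesis using e by (simp add: a_def powr_half_sqrt)
      qed
      ultimately show ?case using elim by simp
    qed
  qed
qed

lemma D_dom_iff_qdom: "\<mu> \<in> D_dom \<theta> \<epsilon> \<longleftrightarrow> \<i> * \<mu> \<in> qdom (depth \<theta> \<epsilon> - 1 / sqrt 3)"
  by (auto simp: D_dom_def qdom_def)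

section \<open>The leading phase on the imaginary axis\<close>

lemma csqrt_line:
  assumes "\<rho> \<ge> 9/16"
  shows "sqrt \<rho> \<le> Re (csqrt (Complex \<rho> 1))" "Re (csqrt (Complex \<rho> 1)) \<le> 2 * sqrt \<rho>"
    "2 * Re (csqrt (Complex \<rho> 1)) * Im (csqrt (Complex \<rho> 1)) = 1"
proof -
  define p q where "p = Re (csqrt (Complex \<rho> 1))" and "q = Im (csqrt (Complex \<rho> 1))"
  have z: "Complex \<rho> 1 = (Complex p q)\<^sup>2" by (simp only: p_def q_def complex_surj power2_csqrt)
  have e: "p * p - q * q = \<rho>" "2 * p * q = 1"
    using z by (simp_all add: complex_eq_iff power2_eq_square)
  show "2 * Re (csqrt (Complex \<rho> 1)) * Im (csqrt (Complex \<rho> 1)) = 1" using e(2) by (simp only: p_def q_def)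
  have p0: "p \<ge> 0" using csqrt_principal[of "Complex \<rho> 1"] by (auto simp: p_def)
  have "\<rho> \<le> p\<^sup>2" using e(1) zero_le_square[of q] unfolding power2_eq_square by linarith
  then show s: "sqrt \<rho> \<le> Re (csqrt (Complex \<rho> 1))"
    unfolding p_def[symmetric] using p0 assms by (intro real_le_lsqrt) auto
  have "(3/4)\<^sup>2 \<le> \<rho>" using assms by (simp add: power2_eq_square)
  then have "3/4 \<le> sqrt \<rho>" by (rule real_le_rsqrt)
  with s have p34: "p \<ge> 3/4" unfolding p_def by linarith
  have q: "q = 1 / (2 * p)" using e(2) p34 by (simp add: field_simps)
  also have "\<dots> \<le> 1 / (2 * (3/4))" using p34 by (intro divide_left_mono) auto
  finally have "q \<le> 2/3" by simp
  moreover have "q \<ge> 0" unfolding q using p34 by simp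
  ultimately have "q * q \<le> 2/3 * (2/3)" by (intro mult_mono) auto
  then have "p\<^sup>2 \<le> 2\<^sup>2 * \<rho>" using e(1) assms unfolding power2_eq_square by linarith
  then have "p \<le> sqrt (2\<^sup>2 * \<rho>)" by (rule real_le_rsqrt)
  also have "\<dots> = 2 * sqrt \<rho>" by (simp only: real_sqrt_mult real_sqrt_abs abs_numeral)
  finally show "Re (csqrt (Complex \<rho> 1)) \<le> 2 * sqrt \<rho>" by (simp only: p_def)
qed

lemma DERIV_wkb_phase:
  assumes "\<rho> \<ge> 9/16"
  shows "(wkb_phase has_real_derivative 1 / Re (csqrt (Complex \<rho> 1))) (at \<rho>)"
proof -
  have nn: "Complex \<rho> 1 \<notin> \<real>\<^sub>\<le>\<^sub>0" by (auto simp: complex_nonpos_Reals_iff)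
  have l: "((\<lambda>t. Complex t 1) has_vector_derivative 1) (at \<rho>)"
    unfolding has_vector_derivative_def Complex_eq
    by (auto intro!: derivative_eq_intros simp: scaleR_conv_of_real)
  have "((\<lambda>t. csqrt (Complex t 1) ^ 3) has_vector_derivative 1 * (3/2 * csqrt (Complex \<rho> 1))) (at \<rho>)"
    using field_vector_diff_chain_at[OF l DERIV_csqrt_cube[OF nn]] by (simp add: o_def)
  then have "((\<lambda>t. Im (csqrt (Complex t 1) ^ 3)) has_vector_derivative Im (1 * (3/2 * csqrt (Complex \<rho> 1)))) (at \<rho>)"
    by (rule bounded_linear.has_vector_derivative[OF bounded_linear_Im])
  then have "((\<lambda>t. Im (csqrt (Complex t 1) ^ 3)) has_real_derivative Im (1 * (3/2 * csqrt (Complex \<rho> 1)))) (at \<rho>)"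
    by (simp add: has_real_derivative_iff_has_vector_derivative)
  from DERIV_cmult[OF this, of "4/3"]
  have "(wkb_phase has_real_derivative 4/3 * Im (1 * (3/2 * csqrt (Complex \<rho> 1)))) (at \<rho>)"
    by (simp add: wkb_phase_def[abs_def])
  also have "4/3 * Im (1 * (3/2 * csqrt (Complex \<rho> 1))) = 1 / Re (csqrt (Complex \<rho> 1))"
  proof -
    have "4/3 * Im (1 * (3/2 * w)) = 1 / Re w" if "2 * Re w * Im w = 1" for w :: complex
    proof -
      have "Re w \<noteq> 0" using that by auto
      then show ?thesis using that by (simp add: field_simps)
    qed
    then show ?thesis using csqrt_line(3)[OF assms] .
  qed
  finally show ?thesis .
qed

text \<open>The slope is the reciprocal of the real part of \<open>csqrt\<close> at \<rho> + i,
  which lies between sqrt \<rho> and 2 sqrt \<rho>.\<close>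

lemma wkb_phase_increments:
  assumes "9/16 \<le> x" "x < y"
  shows "(y - x) / (2 * sqrt y) \<le> wkb_phase y - wkb_phase x" "wkb_phase y - wkb_phase x \<le> 2 * (y - x)"
proof -
  obtain z where z: "x < z" "z < y"
    "wkb_phase y - wkb_phase x = (y - x) * (1 / Re (csqrt (Complex z 1)))"
    using MVT2[OF assms(2), of wkb_phase "\<lambda>z. 1 / Re (csqrt (Complex z 1))"] DERIV_wkb_phase assms by force
  have z1: "z \<ge> 9/16" using z assms by simp
  define p where "p = Re (csqrt (Complex z 1))"
  have p: "sqrt z \<le> p" "p \<le> 2 * sqrt z" using csqrt_line[OF z1] by (simp_all only: p_def)
  have "(3/4)\<^sup>2 \<le> z" using z1 by (simp add: power2_eq_square)
  then have s34: "3/4 \<le> sqrt z" by (rule real_le_rsqrt)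
  have "sqrt z \<le> sqrt y" using z by simp
  then have "p \<le> 2 * sqrt y" using p(2) by linarith
  then have 1: "1 / (2 * sqrt y) \<le> 1 / p" using p s34 by (intro frac_le) auto
  have 2: "1 / p \<le> 1 / (1/2)" using p s34 by (intro frac_le) auto
  show "(y - x) / (2 * sqrt y) \<le> wkb_phase y - wkb_phase x"
    using mult_left_mono[OF 1, of "y - x"] assms(2) z(3) by (simp add: p_def)
  show "wkb_phase y - wkb_phase x \<le> 2 * (y - x)"
    using mult_left_mono[OF 2, of "y - x"] assms(2) z(3) by (simp add: p_def mult.commute)
qed

text \<open>Writing the root as p + i q, the sign is that of q (3 p^2 - q^2), where 0 < q \<le> p.
  Positivity at the tip excludes the index 0.\<close>

lemma wkb_phase_pos:
  assumes "\<rho> > 1 / sqrt 3"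
  shows "wkb_phase \<rho> > 0"
proof -
  have s: "Complex \<rho> 1 \<in> wkb_region 0" using assms by (simp add: wkb_region_def sector_gap_def)
  define p q where "p = Re (csqrt (Complex \<rho> 1))" and "q = Im (csqrt (Complex \<rho> 1))"
  have \<rho>: "\<rho> \<ge> 9/16" using assms inv_sqrt3_bounds(1) by linarith
  have pq: "2 * p * q = 1" using csqrt_line(3)[OF \<rho>] by (simp only: p_def q_def)
  have p: "p > 0" "sqrt 3 * \<bar>q\<bar> < p"
    using csqrt_airy_sector[OF wkb_region_sector[OF s order_refl] order_refl] by (simp_all only: p_def q_def)
  have "q = 1 / (2 * p)" using pq p(1) by (simp add: field_simps)
  then have q: "q > 0" using p(1) by simp
  have "1 * \<bar>q\<bar> \<le> sqrt 3 * \<bar>q\<bar>" by (intro mult_right_mono) auto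
  then have "q \<le> p" using p by simp
  then have "q * q \<le> p * p" using q by (intro mult_mono) auto
  moreover have "p * p > 0" using p by simp
  ultimately have "3 * (p * p) - q * q > 0" by linarith
  then have "q * (3 * (p * p) - q * q) > 0" using q by simp
  moreover have "Im ((Complex p q) ^ 3) = q * (3 * (p * p) - q * q)"
    by (simp add: power3_eq_cube algebra_simps)
  moreover have "csqrt (Complex \<rho> 1) = Complex p q" by (simp only: p_def q_def complex_surj)
  ultimately show ?thesis by (simp only: wkb_phase_def)
qed

text \<open>The prefactor is the inverse of \<open>csqrt \<i>\<close> and rotates the integrand to
  the root of \<rho> - i x, with antiderivative (2/3) i (\<rho> - i x)^(3/2). Its end values combine
  to a real number because the two roots are conjugate.\<close>

lemma f_int_imaginary:
  assumes "\<rho> > 0"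
  shows "f_int (- \<i> * complex_of_real \<rho>) = complex_of_real (wkb_phase \<rho>)"
proof -
  let ?s = "\<lambda>x. complex_of_real \<rho> - \<i> * complex_of_real x"
  have rot: "exp (- \<i> * complex_of_real pi / 4) * csqrt (complex_of_real x - - \<i> * complex_of_real \<rho>) = csqrt (?s x)" for x
  proof -
    have "complex_of_real x - - \<i> * complex_of_real \<rho> = \<i> * ?s x" by (simp add: algebra_simps)
    moreover have "csqrt (\<i> * ?s x) = csqrt \<i> * csqrt (?s x)"
    proof (rule csqrt_mult)
      have "\<bar>Arg (?s x)\<bar> < pi / 2" using assms Arg_Re_pos[of "?s x"] by simp
      then show "Arg \<i> + Arg (?s x) \<in> {-pi<..pi}" using pi_gt_zero by auto
    qed
    moreover have "exp (- \<i> * complex_of_real pi / 4) * csqrt \<i> = 1"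
    proof -
      have "csqrt \<i> = exp (ln \<i> / 2)" by (rule csqrt_exp_Ln) simp
      then show ?thesis by (simp flip: exp_add)
    qed
    ultimately show ?thesis by (metis mult.assoc mult_1)
  qed
  have "((\<lambda>x. csqrt (?s x)) has_integral (2/3 * \<i> * csqrt (?s 1) ^ 3 - 2/3 * \<i> * csqrt (?s (-1)) ^ 3)) {-1..1}"
  proof (rule fundamental_theorem_of_calculus)
    fix x :: real
    have nn: "?s x \<notin> \<real>\<^sub>\<le>\<^sub>0" using assms by (auto simp: complex_nonpos_Reals_iff)
    have l: "(?s has_vector_derivative - \<i>) (at x)"
      unfolding has_vector_derivative_def by (auto intro!: derivative_eq_intros simp: scaleR_conv_of_real)
    have "((\<lambda>x. csqrt (?s x) ^ 3) has_vector_derivative - \<i> * (3/2 * csqrt (?s x))) (at x)"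
      using field_vector_diff_chain_at[OF l DERIV_csqrt_cube[OF nn]] by (simp add: o_def)
    moreover have "2/3 * \<i> * (- \<i> * (3/2 * u)) = u" for u by simp
    ultimately have "((\<lambda>x. 2/3 * \<i> * csqrt (?s x) ^ 3) has_vector_derivative csqrt (?s x)) (at x)"
      by (metis has_vector_derivative_mult_right)
    then show "((\<lambda>x. 2/3 * \<i> * csqrt (?s x) ^ 3) has_vector_derivative csqrt (?s x)) (at x within {-1..1})"
      by (rule has_vector_derivative_at_within)
  qed simp
  then have "f_int (- \<i> * complex_of_real \<rho>) = 2/3 * \<i> * (csqrt (?s 1) ^ 3 - csqrt (?s (-1)) ^ 3)"
    unfolding f_int_def rot by (simp only: integral_unique right_diff_distrib)
  also have "?s 1 = cnj (Complex \<rho> 1)" by (simp add: complex_eq_iff)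
  also have "?s (-1) = Complex \<rho> 1" by (simp add: complex_eq_iff)
  also have "csqrt (cnj (Complex \<rho> 1)) = cnj (csqrt (Complex \<rho> 1))"
    by (rule cnj_csqrt[symmetric]) (auto simp: complex_nonpos_Reals_iff)
  also have "2/3 * \<i> * (cnj w ^ 3 - w ^ 3) = complex_of_real (4/3 * Im (w ^ 3))" for w
  proof -
    have "2/3 * \<i> * (cnj v - v) = complex_of_real (4/3 * Im v)" for v by (simp add: complex_eq_iff)
    from this[of "w ^ 3"] show ?thesis by (simp only: complex_cnj_power)
  qed
  finally show ?thesis by (simp only: wkb_phase_def)
qed

section \<open>Counting the quantised levels\<close>

text \<open>Real-variable core: \<open>F\<close> is the exact quantisation function and \<open>g / e\<close> its leading term.\<close>

locale quantisation =
  fixes e d C :: real and g F :: "real \<Rightarrow> real" and k0 :: nat and rho :: "nat \<Rightarrow> real"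
  assumes e: "0 < e" "e \<le> 1/2" and d: "d > 9/16" and C: "C > 0" "C * e \<le> 1/20"
    and g_low: "\<And>x y. \<lbrakk>d \<le> x; x < y\<rbrakk> \<Longrightarrow> (y - x) / (2 * sqrt y) \<le> g y - g x"
    and g_up: "\<And>x y. \<lbrakk>d \<le> x; x < y\<rbrakk> \<Longrightarrow> g y - g x \<le> 2 * (y - x)"
    and F_mono: "\<And>x y. \<lbrakk>d < x; x < y\<rbrakk> \<Longrightarrow> F x < F y"
    and F_cont: "continuous_on {d<..} F"
    and F_g: "\<And>x. d < x \<Longrightarrow> \<bar>F x - g x / e\<bar> \<le> C * e / (x * sqrt x)"
    and k0: "k0 \<ge> 1" "pi * (real k0 - 1) * e \<le> g d"
    and rho: "\<And>k. k \<ge> k0 \<Longrightarrow> rho k > d" "\<And>k. k \<ge> k0 \<Longrightarrow> g (rho k) = pi * real k * e"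
begin

lemma sqrt_ge: "x \<ge> d \<Longrightarrow> sqrt x \<ge> 3/4"
  using d by (intro real_le_rsqrt) (auto simp: power2_eq_square)

lemma g_mono: "\<lbrakk>d \<le> x; x < y\<rbrakk> \<Longrightarrow> g x < g y"
proof -
  assume x: "d \<le> x" "x < y"
  have "(y - x) / (2 * sqrt y) > 0" using x d by simp
  then show "g x < g y" using g_low[OF x] by linarith
qed

lemma err: "d < x \<Longrightarrow> C * e / (x * sqrt x) \<le> 4 * (C * e)"
proof -
  assume x: "d < x"
  have "9/16 * (3/4) \<le> x * sqrt x" using sqrt_ge[of x] x d by (intro mult_mono) auto
  then have "C * e / (x * sqrt x) \<le> C * e / (1/4)" using C e by (intro frac_le) auto
  then show ?thesis by simp
qed

lemma F_g': "d < x \<Longrightarrow> \<bar>F x - g x / e\<bar> \<le> 4 * (C * e)"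
  using F_g err order.trans by blast

lemma F_inj: "\<lbrakk>d < x; d < y; F x = F y\<rbrakk> \<Longrightarrow> x = y"
  using F_mono by (metis linorder_neqE_linordered_idom less_irrefl)

lemma F_less_iff: "\<lbrakk>d < x; d < y\<rbrakk> \<Longrightarrow> F x < F y \<longleftrightarrow> x < y"
  using F_mono by (metis linorder_neqE_linordered_idom less_asym less_irrefl)

text \<open>Between \<open>rho k0\<close> and \<open>rho (Suc k)\<close> the leading term passes pi
  k with a margin of at least pi on each side, more than the error of F. For \<open>k = k0\<close>
  there is no such margin on the left.\<close>

lemma root_exists:
  assumes k: "k > k0"
  shows "\<exists>x>d. F x = pi * real k"
proof -
  define a b where "a = rho k0" and "b = rho (Suc k)"
  have a: "a > d" "g a = pi * real k0 * e" and b: "b > d" "g b = pi * real (Suc k) * e"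
    using rho k by (auto simp: a_def b_def)
  have "g a < g b" using a b k e by simp
  then have ab: "a \<le> b" using g_mono[of b a] b by (metis less_le_not_le linorder_le_less_linear order_less_imp_le order_less_asym)
  have Fa: "F a \<le> pi * real k"
  proof -
    have "F a \<le> pi * real k0 + 4 * (C * e)" using F_g'[OF a(1)] e by (simp add: a(2))
    also have "\<dots> \<le> pi * real k0 + pi * 1" using C pi_gt3 by simp
    also have "\<dots> = pi * (real k0 + 1)" by (simp add: algebra_simps)
    also have "\<dots> \<le> pi * real k" using k by (intro mult_left_mono) auto
    finally show ?thesis .
  qed
  have Fb: "pi * real k \<le> F b"
  proof -
    have "g b / e = pi * real k + pi" using b(2) e by (simp add: field_simps)
    then show ?thesis using F_g'[OF b(1)] C pi_gt3 by linarith
  qed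
  have "continuous_on {a..b} F" by (rule continuous_on_subset[OF F_cont]) (use a in auto)
  from IVT'[OF Fa Fb ab this] obtain x where "a \<le> x" "F x = pi * real k" by blast
  then show ?thesis using a(1) by (intro exI[of _ x]) auto
qed

definition root :: "nat \<Rightarrow> real" where
  "root k = (SOME x. d < x \<and> F x = pi * real k)"

lemma root:
  assumes "k > k0"
  shows "d < root k" "F (root k) = pi * real k"
  using someI_ex[of "\<lambda>x. d < x \<and> F x = pi * real k"] root_exists[OF assms] unfolding root_def by auto

text \<open>The defect in g is at most C e^2 / R^(3/2); division by the slope, of order R^(-1/2),
  gives order e^2 / R.\<close>

lemma root_near_rho:
  assumes k: "k > k0"
  shows "\<bar>root k - rho k\<bar> \<le> 8 * C * e\<^sup>2 / rho k"
proof -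
  define R r where "R = root k" and "r = rho k"
  have R: "R > d" "F R = pi * real k" using root[OF k] by (auto simp: R_def)
  have r: "r > d" "g r = pi * real k * e" using rho[of k] k by (auto simp: r_def)
  have sR: "sqrt R \<ge> 3/4" "R > 9/16" "R > 0" and sr: "sqrt r \<ge> 3/4" "r > 9/16" "r > 0"
    using sqrt_ge[of R] sqrt_ge[of r] R r d by auto
  have K: "C * e\<^sup>2 > 0" "C * e\<^sup>2 \<le> 1/40"
  proof -
    show "C * e\<^sup>2 > 0" using C e by simp
    have "C * e * e \<le> 1/20 * (1/2)" using C e by (intro mult_mono) auto
    then show "C * e\<^sup>2 \<le> 1/40" by (simp add: power2_eq_square mult.assoc)
  qed
  have gd: "\<bar>g R - g r\<bar> \<le> C * e\<^sup>2 / (R * sqrt R)"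
  proof -
    have "\<bar>pi * real k - g R / e\<bar> * e \<le> C * e / (R * sqrt R) * e"
      using F_g[OF R(1)] e unfolding R(2) by (intro mult_right_mono) auto
    also have "\<bar>pi * real k - g R / e\<bar> * e = \<bar>(pi * real k - g R / e) * e\<bar>" using e by (simp add: abs_mult)
    also have "(pi * real k - g R / e) * e = g r - g R" using e by (simp add: r(2) algebra_simps)
    finally show ?thesis by (simp add: power2_eq_square abs_minus_commute mult.assoc)
  qed
  have "\<bar>R - r\<bar> \<le> 8 * C * e\<^sup>2 / r"
  proof (cases R r rule: linorder_cases)
    case equal
    then show ?thesis using K sr by simp
  next
    case greater
    have "(R - r) / (2 * sqrt R) \<le> C * e\<^sup>2 / (R * sqrt R)"
      using g_low[of r R] gd greater r by linarith
    then have "R - r \<le> C * e\<^sup>2 / (R * sqrt R) * (2 * sqrt R)" using sR by (simp add: pos_divide_le_eq)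
    also have "\<dots> = 2 * (C * e\<^sup>2) / R" using sR by (simp add: field_simps)
    also have "\<dots> \<le> 8 * (C * e\<^sup>2) / r" using greater sr K by (intro frac_le) auto
    finally show ?thesis using greater by (simp add: mult.assoc)
  next
    case less
    have "(r - R) / (2 * sqrt r) \<le> C * e\<^sup>2 / (R * sqrt R)"
      using g_low[of R r] gd less R by linarith
    then have 1: "r - R \<le> C * e\<^sup>2 / (R * sqrt R) * (2 * sqrt r)" using sr by (simp add: pos_divide_le_eq)
    \<comment> \<open>Here the slope is controlled at \<open>r\<close> and the error at the smaller
      \<open>R\<close>, so a crude comparison r \<le> 2 R comes first.\<close>
    have "1/4 \<le> R * sqrt R" using mult_mono[of "9/16" R "3/4" "sqrt R"] sR by simp
    then have "C * e\<^sup>2 / (R * sqrt R) \<le> (1/40) / (1/4)" using K by (intro frac_le) auto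
    then have "C * e\<^sup>2 / (R * sqrt R) * (2 * sqrt r) \<le> 1/10 * (2 * sqrt r)"
      using sr by (intro mult_right_mono) auto
    then have "r - R \<le> 1/10 * (2 * sqrt r)" using 1 by linarith
    moreover have "sqrt r \<le> 4/3 * r"
      using mult_right_mono[OF sr(1), of "sqrt r"] sr by simp
    ultimately have rR: "r \<le> 2 * R" using sr(3) by linarith
    have "sqrt r \<le> sqrt (2\<^sup>2 * R)" using rR sR by simp
    also have "\<dots> = 2 * sqrt R" by (simp only: real_sqrt_mult real_sqrt_abs abs_numeral)
    finally have "C * e\<^sup>2 / (R * sqrt R) * (2 * sqrt r) \<le> C * e\<^sup>2 / (R * sqrt R) * (2 * (2 * sqrt R))"
      using K sR by (intro mult_left_mono) auto
    also have "\<dots> = 4 * (C * e\<^sup>2) / R" using sR by (simp add: field_simps)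
    also have "\<dots> \<le> 4 * (C * e\<^sup>2) / (r / 2)" using rR sr K by (intro frac_le) auto
    also have "\<dots> = 8 * (C * e\<^sup>2) / r" by simp
    finally show ?thesis using 1 less by (simp add: mult.assoc)
  qed
  then show ?thesis by (simp only: R_def r_def)
qed

text \<open>The right end of the exceptional interval. The offset raises the leading term by at
  least 8 C e / sqrt cut, more than the error C e / cut^(3/2), so F has already passed the level pi
  k0; it is too small to reach the next level.\<close>

definition cut :: real where "cut = rho k0 + 16 * C * e\<^sup>2"

lemma cut: "cut > d" "pi * real k0 < F cut" "F cut < pi * (real k0 + 1)"
proof -
  define a where "a = rho k0"
  have a: "a > d" "g a = pi * real k0 * e" using rho[of k0] by (auto simp: a_def)
  have D: "16 * C * e\<^sup>2 > 0" using C e by simp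
  have ac: "a < cut" using D by (simp add: cut_def a_def)
  show c: "cut > d" using ac a by simp
  have s: "sqrt cut \<ge> 3/4" "cut > 9/16" using sqrt_ge[of cut] c d by auto
  have "g cut - g a \<le> 2 * (16 * C * e\<^sup>2)" using g_up[of a cut] a ac by (simp add: cut_def a_def)
  then have "g cut / e \<le> (pi * real k0 * e + 2 * (16 * C * e\<^sup>2)) / e"
    using a(2) e by (intro divide_right_mono) auto
  also have "\<dots> = pi * real k0 + 32 * (C * e)" using e by (simp add: field_simps power2_eq_square)
  finally have "F cut \<le> pi * real k0 + 36 * (C * e)" using F_g'[OF c] by linarith
  also have "\<dots> < pi * real k0 + pi" using C pi_gt3 by simp
  finally show "F cut < pi * (real k0 + 1)" by (simp add: algebra_simps)
  have "16 * C * e\<^sup>2 / (2 * sqrt cut) \<le> g cut - g a" using g_low[of a cut] a ac by (simp add: cut_def a_def)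
  then have "(pi * real k0 * e + 16 * C * e\<^sup>2 / (2 * sqrt cut)) / e \<le> g cut / e"
    using a(2) e by (intro divide_right_mono) auto
  moreover have "(pi * real k0 * e + 16 * C * e\<^sup>2 / (2 * sqrt cut)) / e = pi * real k0 + 8 * (C * e / sqrt cut)"
    using e by (simp add: field_simps power2_eq_square)
  moreover have "C * e / (cut * sqrt cut) < 8 * (C * e / sqrt cut)"
  proof -
    have "C * e / (cut * sqrt cut) = (C * e / sqrt cut) * (1 / cut)" by simp
    also have "\<dots> < (C * e / sqrt cut) * 8"
      using s C e by (intro mult_strict_left_mono) (auto simp: divide_simps)
    finally show ?thesis by (simp only: mult.commute)
  qed
  ultimately show "pi * real k0 < F cut" using F_g[OF c] by linarith
qed

text \<open>By minimality of \<open>k0\<close>, g at d is at least pi (k0 - 1) e, and the error of F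
  is less than pi. Level k0 - 1 remains possible: its leading-order position is at or below d, but
  the correction may push it inside.\<close>

lemma quantum_number_lower:
  assumes "d < x" "F x = pi * of_int n"
  shows "n \<ge> int k0 - 1"
proof -
  have "g d / e < g x / e" using g_mono[of d x] assms e by (intro divide_strict_right_mono) auto
  moreover have "pi * (real k0 - 1) \<le> g d / e" using k0(2) e by (simp add: pos_le_divide_eq)
  ultimately have "pi * (real k0 - 1) - 4 * (C * e) < pi * of_int n"
    using F_g'[OF assms(1)] unfolding assms(2) by linarith
  then have "pi * (real k0 - 1) - pi < pi * of_int n" using C pi_gt3 by linarith
  then have "pi * (real k0 - 2) < pi * of_int n" by (simp add: algebra_simps)
  then have "real k0 - 2 < of_int n" by simp
  then show ?thesis by linarith
qed

lemma less_cut_iff: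
  assumes "d < x" "F x = pi * of_int n"
  shows "x < cut \<longleftrightarrow> n \<le> int k0"
proof -
  have "x < cut \<longleftrightarrow> pi * of_int n < F cut" using F_less_iff[OF assms(1) cut(1)] assms(2) by simp
  also have "\<dots> \<longleftrightarrow> n \<le> int k0"
  proof
    assume "pi * of_int n < F cut"
    then have "pi * of_int n < pi * (real k0 + 1)" using cut(3) by linarith
    then have "of_int n < real k0 + 1" by simp
    then show "n \<le> int k0" by linarith
  next
    assume "n \<le> int k0"
    then have "real_of_int n \<le> real k0" by linarith
    then have "pi * of_int n \<le> pi * real k0" by (intro mult_left_mono) auto
    then show "pi * of_int n < F cut" using cut(2) by linarith
  qed
  finally show ?thesis .
qed

definition levels :: "real set" where
  "levels = {x. d < x \<and> (\<exists>n::int. F x = pi * of_int n)}"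

lemma levels_above_cut: "{x \<in> levels. \<not> x < cut} = root ` {k0<..}"
proof (intro set_eqI iffI)
  fix x assume "x \<in> {x \<in> levels. \<not> x < cut}"
  then obtain n where x: "d < x" "F x = pi * of_int n" "\<not> x < cut" by (auto simp: levels_def)
  then have n: "n > int k0" using less_cut_iff[OF x(1,2)] by simp
  then have k: "nat n > k0" by simp
  have "F (root (nat n)) = F x" using root(2)[OF k] x(2) n by simp
  then have "x = root (nat n)" using F_inj root(1)[OF k] x(1) by metis
  then show "x \<in> root ` {k0<..}" using k by blast
next
  fix x assume "x \<in> root ` {k0<..}"
  then obtain k where k: "k > k0" "x = root k" by auto
  have x: "d < x" "F x = pi * of_int (int k)" using root[OF k(1)] k(2) by auto
  then have "x \<in> levels" unfolding levels_def by blast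
  then show "x \<in> {x \<in> levels. \<not> x < cut}" using less_cut_iff[OF x] k(1) by simp
qed

text \<open>F / pi is injective on the levels and leaves only the quantum numbers k0 - 1 and
  k0.\<close>

lemma levels_below_cut: "finite {x \<in> levels. x < cut}" "card {x \<in> levels. x < cut} \<le> 2"
proof -
  let ?S = "{x \<in> levels. x < cut}" and ?T = "{int k0 - 1, int k0}"
  have sub: "(\<lambda>x. F x / pi) ` ?S \<subseteq> real_of_int ` ?T"
  proof (rule image_subsetI)
    fix x assume "x \<in> ?S"
    then obtain n where x: "d < x" "F x = pi * of_int n" "x < cut" by (auto simp: levels_def)
    have "n \<in> ?T" using quantum_number_lower[OF x(1,2)] less_cut_iff[OF x(1,2)] x(3) by auto
    then have "real_of_int n \<in> real_of_int ` ?T" by (rule imageI)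
    moreover have "F x / pi = real_of_int n" using x(2) by simp
    ultimately show "F x / pi \<in> real_of_int ` ?T" by (simp only:)
  qed
  have inj: "inj_on (\<lambda>x. F x / pi) ?S"
    by (rule inj_onI) (auto simp: levels_def intro: F_inj)
  have fin: "finite (real_of_int ` ?T)" by simp
  show "finite ?S" by (rule inj_on_finite[OF inj sub fin])
  have "card ?S \<le> card (real_of_int ` ?T)" by (rule card_inj_on_le[OF inj sub fin])
  also have "\<dots> \<le> card ?T" by (rule card_image_le) simp
  finally show "card ?S \<le> 2" by simp
qed

lemma root_strict_mono: "strict_mono_on {k0<..} root"
proof (rule strict_mono_onI)
  fix j k assume jk: "j \<in> {k0<..}" "k \<in> {k0<..}" "j < k"
  then have "F (root j) < F (root k)" using root(2) by simp
  then show "root j < root k" using F_less_iff root(1) jk by simp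
qed

text \<open>Enumerating the set of quantum numbers that occur avoids deciding whether k0 - 1 and k0
  are among them. They are natural numbers because \<open>k0 \<ge> 1\<close>, and infinitely many
  because all indices above k0 occur.\<close>

lemma levels_enumeration:
  obtains r :: "nat \<Rightarrow> real" where "strict_mono r" "\<And>n. r n > d" "levels = range r"
proof -
  define N where "N = {n::nat. \<exists>x>d. F x = pi * real n}"
  have "{k0<..} \<subseteq> N" using root_exists by (auto simp: N_def)
  then have inf: "infinite N" using infinite_Ioi infinite_super by blast
  define s where "s n = (SOME x. d < x \<and> F x = pi * real n)" for n :: nat
  have s: "d < s n" "F (s n) = pi * real n" if "n \<in> N" for n
    using someI_ex[of "\<lambda>x. d < x \<and> F x = pi * real n"] that unfolding s_def N_def by auto
  have rg: "range (enumerate N) = N" by (rule range_enumerate[OF inf])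
  then have en: "enumerate N n \<in> N" for n by blast
  show thesis
  proof (rule that[of "\<lambda>n. s (enumerate N n)"])
    show "strict_mono (\<lambda>n. s (enumerate N n))"
    proof (rule strict_monoI)
      fix i j :: nat assume "i < j"
      then have "enumerate N i < enumerate N j" using inf by (simp add: enumerate_mono)
      then have "F (s (enumerate N i)) < F (s (enumerate N j))" using s(2)[OF en] by simp
      then show "s (enumerate N i) < s (enumerate N j)" using F_less_iff[OF s(1)[OF en] s(1)[OF en]] by simp
    qed
    show "s (enumerate N n) > d" for n using s en by simp
    have "levels = s ` N"
    proof (intro set_eqI iffI)
      fix x assume "x \<in> levels"
      then obtain n where x: "d < x" "F x = pi * of_int n" by (auto simp: levels_def)
      have "n \<ge> 0" using quantum_number_lower[OF x] k0(1) by simp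
      then have Fx: "F x = pi * real (nat n)" using x(2) by simp
      then have nN: "nat n \<in> N" using x(1) by (auto simp: N_def)
      have "x = s (nat n)" by (rule F_inj) (use s[OF nN] x(1) Fx in auto)
      then show "x \<in> s ` N" using nN by blast
    next
      fix x assume "x \<in> s ` N"
      then obtain n where n: "n \<in> N" "x = s n" by blast
      then have "d < x" "F x = pi * of_int (int n)" using s by auto
      then show "x \<in> levels" unfolding levels_def by blast
    qed
    also have "\<dots> = range (\<lambda>n. s (enumerate N n))" using rg by (metis image_image)
    finally show "levels = range (\<lambda>n. s (enumerate N n))" .
  qed
qed

end

section \<open>The index k0 and the approximate levels\<close>

lemma D_dom_imaginary: "- \<i> * complex_of_real r \<in> D_dom \<theta> \<epsilon> \<longleftrightarrow> r > depth \<theta> \<epsilon>"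
  by (simp add: D_dom_def)

text \<open>The phase is strictly increasing and unbounded, so index k is solvable in the domain
  exactly when its value exceeds the phase at the tip. This condition is upward closed in k, and
  \<open>k0\<close> is its first index.\<close>

lemma k0_rho_properties:
  assumes eps: "\<epsilon> > 0" and d: "depth \<theta> \<epsilon> > 1 / sqrt 3"
  shows "k0 \<theta> \<epsilon> \<ge> 1" "pi * (real (k0 \<theta> \<epsilon>) - 1) * sqrt \<epsilon> \<le> wkb_phase (depth \<theta> \<epsilon>)"
    "\<And>k. k \<ge> k0 \<theta> \<epsilon> \<Longrightarrow> rho \<theta> \<epsilon> k > depth \<theta> \<epsilon>"
    "\<And>k. k \<ge> k0 \<theta> \<epsilon> \<Longrightarrow> wkb_phase (rho \<theta> \<epsilon> k) = pi * real k * sqrt \<epsilon>"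
proof -
  define d where "d = depth \<theta> \<epsilon>"
  define e where "e = sqrt \<epsilon>"
  have e: "e > 0" using eps by (simp add: e_def)
  have d0: "d > 9/16" "d > 1 / sqrt 3" using assms inv_sqrt3_bounds(1) by (auto simp: d_def)
  have mono: "wkb_phase x < wkb_phase y" if "d \<le> x" "x < y" for x y
  proof -
    have "(y - x) / (2 * sqrt y) > 0" using that d0 by simp
    then show ?thesis using wkb_phase_increments(1)[of x y] that d0 by linarith
  qed
  have uniq: "x = y" if "d < x" "d < y" "wkb_phase x = wkb_phase y" for x y
    using mono[of x y] mono[of y x] that by (cases x y rule: linorder_cases) auto
  have ex: "\<exists>r>d. wkb_phase r = v" if v: "wkb_phase d < v" for v
  proof -
    define t where "t = v - wkb_phase d"
    \<comment> \<open>The phase is only known to grow like a square root, so the witness is a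
      square, chosen to satisfy (y - d) / (2 sqrt y) \<ge> t.\<close>
    define y where "y = (2 * t + d + 1)\<^sup>2"
    have t: "t > 0" using v by (simp add: t_def)
    have sy: "sqrt y = 2 * t + d + 1" using t d0 by (simp add: y_def)
    have "y - d = 2 * t * sqrt y + ((2 * t + d + 1) * (d + 1) - d)"
      unfolding sy by (simp add: y_def power2_eq_square algebra_simps)
    moreover have "1 * d \<le> (2 * t + d + 1) * (d + 1)" using t d0 by (intro mult_mono) auto
    ultimately have y: "2 * t * sqrt y \<le> y - d" by linarith
    have "2 * t * sqrt y > 0" using t d0 sy by simp
    then have dy: "d < y" using y by linarith
    have "t \<le> (y - d) / (2 * sqrt y)" using y t d0 sy by (simp add: pos_le_divide_eq mult_ac)
    then have vy: "v \<le> wkb_phase y" using wkb_phase_increments(1)[of d y] dy d0 by (simp add: t_def)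
    have "continuous_on {d..y} wkb_phase"
      using d0 by (intro continuous_at_imp_continuous_on ballI DERIV_isCont[OF DERIV_wkb_phase]) auto
    from IVT'[OF less_imp_le[OF v] vy less_imp_le[OF dy] this]
    obtain r where r: "d \<le> r" "wkb_phase r = v" by blast
    then show ?thesis using v by (intro exI[of _ r]) (auto simp: order.order_iff_strict)
  qed
  have sol: "- \<i> * complex_of_real r \<in> D_dom \<theta> \<epsilon> \<and>
      f_int (- \<i> * complex_of_real r) = complex_of_real (pi * real k * sqrt \<epsilon>)
     \<longleftrightarrow> d < r \<and> wkb_phase r = pi * real k * e" for r k
  proof (cases "d < r")
    case True
    then have "r > 0" using d0 by simp
    then show ?thesis using True
      by (simp only: D_dom_imaginary f_int_imaginary d_def[symmetric] e_def[symmetric] of_real_eq_iff)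
  next
    case False
    then show ?thesis by (simp only: D_dom_imaginary d_def[symmetric] simp_thms)
  qed
  have im: "\<mu> = - \<i> * complex_of_real (- Im \<mu>)" if "Re \<mu> = 0" for \<mu>
    using that by (simp add: complex_eq_iff)
  have P: "(\<exists>!\<mu>. \<mu> \<in> D_dom \<theta> \<epsilon> \<and> Re \<mu> = 0 \<and> f_int \<mu> = complex_of_real (pi * real k * sqrt \<epsilon>))
     \<longleftrightarrow> wkb_phase d < pi * real k * e" for k
  proof
    assume "\<exists>!\<mu>. \<mu> \<in> D_dom \<theta> \<epsilon> \<and> Re \<mu> = 0 \<and> f_int \<mu> = complex_of_real (pi * real k * sqrt \<epsilon>)"
    then obtain \<mu> where "\<mu> \<in> D_dom \<theta> \<epsilon>" "Re \<mu> = 0" "f_int \<mu> = complex_of_real (pi * real k * sqrt \<epsilon>)"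
      by blast
    then have "d < - Im \<mu> \<and> wkb_phase (- Im \<mu>) = pi * real k * e" using im[of \<mu>] sol by metis
    then show "wkb_phase d < pi * real k * e" using mono[of d "- Im \<mu>"] by simp
  next
    assume "wkb_phase d < pi * real k * e"
    then obtain r where r: "d < r" "wkb_phase r = pi * real k * e" using ex by blast
    show "\<exists>!\<mu>. \<mu> \<in> D_dom \<theta> \<epsilon> \<and> Re \<mu> = 0 \<and> f_int \<mu> = complex_of_real (pi * real k * sqrt \<epsilon>)"
    proof (rule ex1I[of _ "- \<i> * complex_of_real r"])
      show "- \<i> * complex_of_real r \<in> D_dom \<theta> \<epsilon> \<and> Re (- \<i> * complex_of_real r) = 0 \<and>
        f_int (- \<i> * complex_of_real r) = complex_of_real (pi * real k * sqrt \<epsilon>)"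
        using sol[of r k] r by auto
      fix \<mu> assume m: "\<mu> \<in> D_dom \<theta> \<epsilon> \<and> Re \<mu> = 0 \<and> f_int \<mu> = complex_of_real (pi * real k * sqrt \<epsilon>)"
      then have "d < - Im \<mu> \<and> wkb_phase (- Im \<mu>) = pi * real k * e" using im[of \<mu>] sol by metis
      then have "- Im \<mu> = r" using uniq[of "- Im \<mu>" r] r by simp
      then show "\<mu> = - \<i> * complex_of_real r" using im[of \<mu>] m by simp
    qed
  qed
  have k0_eq: "k0 \<theta> \<epsilon> = (LEAST m. \<forall>k\<ge>m. wkb_phase d < pi * real k * e)"
    unfolding k0_def P ..
  have up: "wkb_phase d < pi * real k * e" if "wkb_phase d < pi * real j * e" "j \<le> k" for j k
  proof -
    have "pi * real j * e \<le> pi * real k * e" using that e by (intro mult_right_mono mult_left_mono) auto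
    then show ?thesis using that by linarith
  qed
  obtain j where "wkb_phase d / (pi * e) < real j" using reals_Archimedean2 by blast
  then have "wkb_phase d < pi * real j * e" using e by (simp add: pos_divide_less_eq mult_ac)
  then have "\<forall>k\<ge>j. wkb_phase d < pi * real k * e" using up by blast
  then have k0_all: "\<forall>k\<ge>k0 \<theta> \<epsilon>. wkb_phase d < pi * real k * e"
    unfolding k0_eq by (rule LeastI)
  have pos: "wkb_phase d > 0" by (rule wkb_phase_pos[OF d0(2)])
  show k1: "k0 \<theta> \<epsilon> \<ge> 1"
  proof (rule ccontr)
    assume "\<not> k0 \<theta> \<epsilon> \<ge> 1"
    then show False using k0_all[rule_format, of 0] pos by simp
  qed
  \<comment> \<open>Minimality is applied to the predecessor of k0, which is a genuine one because
    k0 is at least 1.\<close>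
  have "\<not> (\<forall>k\<ge>k0 \<theta> \<epsilon> - 1. wkb_phase d < pi * real k * e)"
    using not_less_Least[of "k0 \<theta> \<epsilon> - 1" "\<lambda>m. \<forall>k\<ge>m. wkb_phase d < pi * real k * e"] k1
    unfolding k0_eq[symmetric] by simp
  then have "\<not> wkb_phase d < pi * real (k0 \<theta> \<epsilon> - 1) * e" using up by blast
  then show "pi * (real (k0 \<theta> \<epsilon>) - 1) * sqrt \<epsilon> \<le> wkb_phase (depth \<theta> \<epsilon>)"
    using k1 by (simp add: d_def e_def of_nat_diff)
  have rho: "d < rho \<theta> \<epsilon> k \<and> wkb_phase (rho \<theta> \<epsilon> k) = pi * real k * e" if k: "k \<ge> k0 \<theta> \<epsilon>" for k
  proof -
    obtain r where r: "d < r" "wkb_phase r = pi * real k * e" using ex k0_all k by blast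
    have "rho \<theta> \<epsilon> k = (THE r. d < r \<and> wkb_phase r = pi * real k * e)"
      unfolding rho_def sol ..
    also have "\<dots> = r" by (rule the_equality) (use r uniq in auto)
    finally show ?thesis using r by simp
  qed
  show "rho \<theta> \<epsilon> k > depth \<theta> \<epsilon>" if "k \<ge> k0 \<theta> \<epsilon>" for k using rho[OF that] by (simp add: d_def)
  show "wkb_phase (rho \<theta> \<epsilon> k) = pi * real k * sqrt \<epsilon>" if "k \<ge> k0 \<theta> \<epsilon>" for k
    using rho[OF that] by (simp add: e_def)
qed

section \<open>Monotonicity on the real axis and assembly of the theorem\<close>

context wkb
begin

definition real_qfun :: "real \<Rightarrow> real" where
  "real_qfun x = Re (qfun \<epsilon> (complex_of_real x))"

lemma DERIV_real_qfun:
  assumes "x > 1 / sqrt 3 + m"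
  shows "(real_qfun has_real_derivative Re (qfun' \<epsilon> (complex_of_real x))) (at x)"
proof -
  have "((\<lambda>x. qfun \<epsilon> (complex_of_real x)) has_vector_derivative qfun' \<epsilon> (complex_of_real x)) (at x)"
    by (rule has_vector_derivative_real_field[OF DERIV_qfun[OF real_in_qdom[OF assms]]])
  then have "((\<lambda>x. Re (qfun \<epsilon> (complex_of_real x))) has_vector_derivative Re (qfun' \<epsilon> (complex_of_real x))) (at x)"
    by (rule bounded_linear.has_vector_derivative[OF bounded_linear_Re])
  then show ?thesis
    by (simp add: has_real_derivative_iff_has_vector_derivative real_qfun_def[abs_def])
qed

lemma real_qfun_strict_mono:
  assumes "1 / sqrt 3 + m < x" "x < y"
  shows "real_qfun x < real_qfun y"
proof (rule DERIV_pos_imp_increasing[OF assms(2)])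
  fix t assume "x \<le> t" "t \<le> y"
  then have t: "1 / sqrt 3 + m < t" using assms by simp
  show "\<exists>D. (real_qfun has_real_derivative D) (at t) \<and> 0 < D"
    using DERIV_real_qfun[OF t] Re_qfun'_pos[OF real_in_qdom[OF t]] by blast
qed

end

theorem mainTheorem3:
  fixes \<theta> :: real
  assumes "\<theta> > 1 / 3 * (3 / 4) powr (3 / 4)"
  shows "\<exists>C::real. \<forall>\<^sub>F \<epsilon> in at_right (0::real).
     (\<forall>\<mu>\<in>D_dom \<theta> \<epsilon>. eigenvalue \<epsilon> \<mu> \<longrightarrow> simple_eigenvalue \<epsilon> \<mu>) \<and>
     (\<exists>r :: nat \<Rightarrow> real. strict_mono r \<and> (\<forall>n. r n > 0) \<and>
        {\<mu>\<in>D_dom \<theta> \<epsilon>. eigenvalue \<epsilon> \<mu>} = range (\<lambda>n. - \<i> * complex_of_real (r n))) \<and>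
     (\<exists>(\<delta>::real) (\<eta> :: nat \<Rightarrow> real).
        \<bar>\<delta>\<bar> \<le> C * \<epsilon> \<and> (\<forall>k>k0 \<theta> \<epsilon>. \<bar>\<eta> k\<bar> \<le> C * \<epsilon>) \<and>
        (let J = open_segment (d_pt \<theta> \<epsilon>)
                   (- \<i> * complex_of_real (rho \<theta> \<epsilon> (k0 \<theta> \<epsilon>) + \<delta>));
             s = (\<lambda>k. rho \<theta> \<epsilon> k + \<eta> k / rho \<theta> \<epsilon> k)
         in finite {\<mu>\<in>J. eigenvalue \<epsilon> \<mu>} \<and> card {\<mu>\<in>J. eigenvalue \<epsilon> \<mu>} \<le> 2 \<and>
            strict_mono_on {k0 \<theta> \<epsilon><..} s \<and>
            {\<mu>\<in>D_dom \<theta> \<epsilon>. eigenvalue \<epsilon> \<mu>} - J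
              = (\<lambda>k. - \<i> * complex_of_real (s k)) ` {k0 \<theta> \<epsilon><..}))"
proof -
  obtain C where C: "C > 0" and ev:
    "\<forall>\<^sub>F \<epsilon> in at_right 0. wkb \<epsilon> (depth \<theta> \<epsilon> - 1 / sqrt 3) C \<and> depth \<theta> \<epsilon> - 1 / sqrt 3 \<le> 1 \<and>
       exp (- (2 * (3/4) powr (1/4) * (depth \<theta> \<epsilon> - 1 / sqrt 3) / sqrt \<epsilon>)) \<le> sqrt \<epsilon> \<and> C * sqrt \<epsilon> \<le> 1 / 100"
    by (rule wkb_eventually[OF assms])
  show ?thesis
  \<comment> \<open>The phase error constant is 5 C by \<open>qfun_real\<close>; the offset of
    \<open>cut\<close> is 16 times that, while the roots need only 8 times it.\<close>
  proof (rule exI[of _ "80 * C"], rule eventually_mono[OF ev], goal_cases)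
    case *: (1 \<epsilon>)
    define d where "d = depth \<theta> \<epsilon>"
    define m where "m = d - 1 / sqrt 3"
    interpret W: wkb \<epsilon> m C using * by (simp add: m_def d_def)
    have dm: "d = 1 / sqrt 3 + m" by (simp add: m_def)
    have eps: "\<epsilon> > 0" by (rule W.eps)
    have d3: "depth \<theta> \<epsilon> > 1 / sqrt 3" using W.m by (simp add: m_def d_def)
    have d9: "d > 9/16" using d3 inv_sqrt3_bounds(1) by (simp add: d_def)
    note kr = k0_rho_properties[OF eps d3]
    have qr: "Im (qfun \<epsilon> (complex_of_real x)) = 0"
      "\<bar>W.real_qfun x - wkb_phase x / sqrt \<epsilon>\<bar> \<le> 5 * C * sqrt \<epsilon> / (x * sqrt x)" if "x > d" for x
      using W.qfun_real[of x] that * unfolding dm W.real_qfun_def by (auto simp: m_def d_def)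
    interpret Q: quantisation "sqrt \<epsilon>" d "5 * C" wkb_phase W.real_qfun "k0 \<theta> \<epsilon>" "rho \<theta> \<epsilon>"
    proof
      show "0 < sqrt \<epsilon>" "sqrt \<epsilon> \<le> 1/2" using W.eps by auto
      show "9/16 < d" "5 * C > 0" "5 * C * sqrt \<epsilon> \<le> 1/20" using d9 C * by auto
      show "(y - x) / (2 * sqrt y) \<le> wkb_phase y - wkb_phase x"
        "wkb_phase y - wkb_phase x \<le> 2 * (y - x)" if "d \<le> x" "x < y" for x y
        using wkb_phase_increments[of x y] that d9 by auto
      show "W.real_qfun x < W.real_qfun y" if "d < x" "x < y" for x y
        using W.real_qfun_strict_mono[of x y] that by (simp add: dm)
      show "continuous_on {d<..} W.real_qfun"
        by (intro continuous_at_imp_continuous_on ballI DERIV_isCont[OF W.DERIV_real_qfun]) (simp add: dm)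
      show "\<bar>W.real_qfun x - wkb_phase x / sqrt \<epsilon>\<bar> \<le> 5 * C * sqrt \<epsilon> / (x * sqrt x)" if "d < x" for x
        by (rule qr(2)[OF that])
      show "1 \<le> k0 \<theta> \<epsilon>" "pi * (real (k0 \<theta> \<epsilon>) - 1) * sqrt \<epsilon> \<le> wkb_phase d"
        using kr(1,2) by (simp_all add: d_def)
      show "d < rho \<theta> \<epsilon> k" "wkb_phase (rho \<theta> \<epsilon> k) = pi * real k * sqrt \<epsilon>" if "k0 \<theta> \<epsilon> \<le> k" for k
        using kr(3,4)[OF that] by (simp_all add: d_def)
    qed
    have D_qdom: "\<mu> \<in> D_dom \<theta> \<epsilon> \<longleftrightarrow> \<i> * \<mu> \<in> qdom m" for \<mu>
      unfolding D_dom_iff_qdom m_def d_def ..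
    define h where "h x = - \<i> * complex_of_real x" for x
    have inj: "inj h" by (auto simp: inj_on_def h_def)
    have hD: "h x \<in> D_dom \<theta> \<epsilon> \<longleftrightarrow> x > d" for x
      unfolding h_def D_dom_imaginary d_def ..
    have qx: "qfun \<epsilon> (\<i> * h x) = complex_of_real (W.real_qfun x)" if "x > d" for x
      using qr(1)[OF that] by (simp add: h_def W.real_qfun_def complex_eq_iff)
    have eig: "{\<mu> \<in> D_dom \<theta> \<epsilon>. eigenvalue \<epsilon> \<mu>} = h ` Q.levels"
    proof (intro set_eqI iffI)
      fix \<mu> assume "\<mu> \<in> {\<mu> \<in> D_dom \<theta> \<epsilon>. eigenvalue \<epsilon> \<mu>}"
      then have \<mu>: "\<mu> \<in> D_dom \<theta> \<epsilon>" "eigenvalue \<epsilon> \<mu>" by auto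
      have q: "\<i> * \<mu> \<in> qdom m" using \<mu>(1) D_qdom by simp
      obtain n :: int where n: "qfun \<epsilon> (\<i> * \<mu>) = complex_of_real (pi * of_int n)"
        using W.eigenvalue_iff_qfun(1)[OF q] \<mu>(2) by blast
      have "d * 1 \<le> d * (1 + \<bar>Im (\<i> * \<mu>)\<bar>)" using d9 by (intro mult_left_mono) auto
      then have xd: "Re (\<i> * \<mu>) > d" using q by (simp add: qdom_def dm[symmetric])
      have "Im (qfun \<epsilon> (\<i> * \<mu>)) = 0" by (simp only: n Im_complex_of_real)
      then have "Im (\<i> * \<mu>) = 0" using W.Im_qfun_nonzero[OF q qr(1)[OF xd]] by blast
      then have hm: "\<mu> = h (- Im \<mu>)" by (simp add: h_def complex_eq_iff)
      have dx: "- Im \<mu> > d" using xd by simp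
      have "complex_of_real (W.real_qfun (- Im \<mu>)) = complex_of_real (pi * of_int n)"
        using qx[OF dx] n hm by metis
      then have "W.real_qfun (- Im \<mu>) = pi * of_int n" by (simp only: of_real_eq_iff)
      then have "- Im \<mu> \<in> Q.levels" using dx unfolding Q.levels_def by blast
      then show "\<mu> \<in> h ` Q.levels" using hm by blast
    next
      fix \<mu> assume "\<mu> \<in> h ` Q.levels"
      then obtain x n where x: "\<mu> = h x" "d < x" "W.real_qfun x = pi * of_int n"
        unfolding Q.levels_def by blast
      have "\<mu> \<in> D_dom \<theta> \<epsilon>" using hD x by simp
      moreover have "qfun \<epsilon> (\<i> * \<mu>) = complex_of_real (pi * of_int n)" using qx[OF x(2)] x by simp
      ultimately show "\<mu> \<in> {\<mu> \<in> D_dom \<theta> \<epsilon>. eigenvalue \<epsilon> \<mu>}"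
        using W.eigenvalue_iff_qfun(1)[of \<mu>] D_qdom by blast
    qed
    have simple: "\<forall>\<mu>\<in>D_dom \<theta> \<epsilon>. eigenvalue \<epsilon> \<mu> \<longrightarrow> simple_eigenvalue \<epsilon> \<mu>"
      using W.eigenvalue_iff_qfun(2) D_qdom by blast
    obtain r :: "nat \<Rightarrow> real" where r: "strict_mono r" "\<And>n. r n > d" "Q.levels = range r"
      by (rule Q.levels_enumeration) (rule that)
    have enum: "\<exists>r :: nat \<Rightarrow> real. strict_mono r \<and> (\<forall>n. r n > 0) \<and>
        {\<mu>\<in>D_dom \<theta> \<epsilon>. eigenvalue \<epsilon> \<mu>} = range (\<lambda>n. - \<i> * complex_of_real (r n))"
    proof (intro exI[of _ r] conjI allI)
      show "r n > 0" for n using r(2)[of n] d9 by simp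
      show "{\<mu>\<in>D_dom \<theta> \<epsilon>. eigenvalue \<epsilon> \<mu>} = range (\<lambda>n. - \<i> * complex_of_real (r n))"
        unfolding eig r(3) image_image by (simp only: h_def)
    qed (rule r)
    define \<delta> where "\<delta> = 80 * C * \<epsilon>"
    \<comment> \<open>Read backwards from the exact roots, so that the asserted form is an identity
      and the content lies in the bound for \<eta>.\<close>
    define \<eta> where "\<eta> k = rho \<theta> \<epsilon> k * (Q.root k - rho \<theta> \<epsilon> k)" for k
    have rho_pos: "rho \<theta> \<epsilon> k > 0" if "k > k0 \<theta> \<epsilon>" for k using Q.rho(1)[of k] that d9 by simp
    have \<eta>: "\<bar>\<eta> k\<bar> \<le> 80 * C * \<epsilon>" if k: "k > k0 \<theta> \<epsilon>" for k
    proof -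
      have "\<bar>\<eta> k\<bar> = rho \<theta> \<epsilon> k * \<bar>Q.root k - rho \<theta> \<epsilon> k\<bar>"
        using rho_pos[OF k] by (simp add: \<eta>_def abs_mult)
      also have "\<dots> \<le> rho \<theta> \<epsilon> k * (8 * (5 * C) * (sqrt \<epsilon>)\<^sup>2 / rho \<theta> \<epsilon> k)"
        using rho_pos[OF k] by (intro mult_left_mono Q.root_near_rho k) auto
      also have "\<dots> = 40 * C * \<epsilon>" using rho_pos[OF k] eps by simp
      also have "\<dots> \<le> 80 * C * \<epsilon>" using C eps by simp
      finally show ?thesis .
    qed
    have s: "rho \<theta> \<epsilon> k + \<eta> k / rho \<theta> \<epsilon> k = Q.root k" if "k > k0 \<theta> \<epsilon>" for k
      using rho_pos[OF that] by (simp add: \<eta>_def)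
    have cut: "rho \<theta> \<epsilon> (k0 \<theta> \<epsilon>) + \<delta> = Q.cut" using eps by (simp add: Q.cut_def \<delta>_def)
    have J: "open_segment (d_pt \<theta> \<epsilon>) (- \<i> * complex_of_real (rho \<theta> \<epsilon> (k0 \<theta> \<epsilon>) + \<delta>)) = h ` {d<..<Q.cut}"
    proof -
      have lin: "linear h" by (rule linearI) (auto simp: h_def algebra_simps scaleR_conv_of_real)
      have "open_segment (h d) (h Q.cut) = h ` open_segment d Q.cut"
        using open_segment_linear_image[OF lin inj] by simp
      then show ?thesis using Q.cut(1) unfolding cut by (simp add: h_def d_pt_def d_def open_segment_eq_real_ivl)
    qed
    have JE: "{\<mu> \<in> h ` {d<..<Q.cut}. eigenvalue \<epsilon> \<mu>} = h ` {x \<in> Q.levels. x < Q.cut}"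
    proof -
      have sub: "h ` {d<..<Q.cut} \<subseteq> D_dom \<theta> \<epsilon>"
        by (rule image_subsetI) (simp only: hD greaterThanLessThan_iff)
      have "{\<mu> \<in> h ` {d<..<Q.cut}. eigenvalue \<epsilon> \<mu>} = {\<mu> \<in> D_dom \<theta> \<epsilon>. eigenvalue \<epsilon> \<mu>} \<inter> h ` {d<..<Q.cut}"
        using sub by blast
      also have "\<dots> = h ` (Q.levels \<inter> {d<..<Q.cut})" unfolding eig image_Int[OF inj] ..
      also have "Q.levels \<inter> {d<..<Q.cut} = {x \<in> Q.levels. x < Q.cut}" by (auto simp: Q.levels_def)
      finally show ?thesis .
    qed
    have rest: "{\<mu> \<in> D_dom \<theta> \<epsilon>. eigenvalue \<epsilon> \<mu>} - h ` {d<..<Q.cut} = h ` Q.root ` {k0 \<theta> \<epsilon><..}"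
    proof -
      have "{\<mu> \<in> D_dom \<theta> \<epsilon>. eigenvalue \<epsilon> \<mu>} - h ` {d<..<Q.cut} = h ` (Q.levels - {d<..<Q.cut})"
        unfolding eig image_set_diff[OF inj] ..
      also have "Q.levels - {d<..<Q.cut} = {x \<in> Q.levels. \<not> x < Q.cut}" by (auto simp: Q.levels_def)
      finally show ?thesis unfolding Q.levels_above_cut .
    qed
    show ?case
    proof (intro conjI simple enum exI[of _ \<delta>] exI[of _ \<eta>], goal_cases)
      case 1
      show ?case using C eps by (simp add: \<delta>_def)
    next
      case 2
      show ?case using \<eta> by blast
    next
      case 3
      have "card (h ` {x \<in> Q.levels. x < Q.cut}) \<le> 2"
        by (rule order.trans[OF card_image_le[OF Q.levels_below_cut(1)] Q.levels_below_cut(2)])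
      moreover have "strict_mono_on {k0 \<theta> \<epsilon><..} (\<lambda>k. rho \<theta> \<epsilon> k + \<eta> k / rho \<theta> \<epsilon> k)"
        using Q.root_strict_mono by (auto simp: strict_mono_on_def s)
      moreover have "h ` Q.root ` {k0 \<theta> \<epsilon><..}
          = (\<lambda>k. - \<i> * complex_of_real (rho \<theta> \<epsilon> k + \<eta> k / rho \<theta> \<epsilon> k)) ` {k0 \<theta> \<epsilon><..}"
        unfolding image_image by (rule image_cong) (simp_all only: s h_def greaterThan_iff)
      ultimately show ?case
        unfolding Let_def J JE rest using Q.levels_below_cut(1) by blast
    qed
  qed
qed

end
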